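(* Let $K$ be a local field of characteristic $p$ with perfect residue field $\mathbb{F}$, let $L/K$ be a totally ramified $C_p^2$-extension with a single ramification break $b>0$, and let $(\beta,\vec{\omega},\vec{\epsilon})$ be Artin–Schreier data for $L/K$ such that $\omega_1=1$ and $\epsilon_1=0$. Let $e_2=-v_K(\epsilon_2)$, and set $b_*=\min\{(b-e_2)p+b,\;bp\}$ and $B_1=\{b,b_*\}$. Then for $2\le k\le p$ the set of VC$_k$-refined breaks of $L/K$ (is defined and) equals $B_1$, and the set of SS$_k$-refined breaks of $L/K$ equals $B_1$.
   Context: A local field is a complete discretely valued field; $K$ has characteristic $p$ and perfect residue field $\mathbb{F}$, so $K\cong\mathbb{F}((t))$ and we regard $\mathbb{F}\subset K$. $v_K,v_L$ are the normalized valuations ($v(0)=\infty$; so $e_2=-\infty$ if $\epsilon_2=0$). $C_p$ is the cyclic group of order $p$. $L/K$ is totally ramified Galois with $G=\mathrm{Gal}(L/K)\cong C_p^2$ and a single (lower, equivalently upper) ramification break $b>0$ (then $p\nmid b$). Artin–Schreier data for $L/K$: a triple $(\beta,\vec{\omega},\vec{\epsilon})$ with $\beta\in K$, $v_K(\beta)=-b$, $\vec{\omega}=(\omega_1,\omega_2)^T\in\mathbb{F}^2$ with $\omega_1,\omega_2$ linearly independent over $\mathbb{F}_p$, and $\vec{\epsilon}=(\epsilon_1,\epsilon_2)^T\in K^2$ with $v_K(\epsilon_i)>-b$ and, for each $i$, either $v_K(\epsilon_i)<0$ and $p\nmid v_K(\epsilon_i)$, or $\epsilon_i\in\mathbb{F}$,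 such that $L=K(x_1,x_2)$ where $x_i$ in the separable closure of $K$ satisfies $x_i^p-x_i=\omega_i^{p^2}\beta+\epsilon_i$. Refined breaks. Let $R=\mathbb{F}[G]$ (acting $K$-linearly on $L$) with augmentation ideal $A$. Fix $2\le k\le p$ and set $\overline{R}=R/A^k$, $\overline{\gamma}=\gamma+A^k$. For $\gamma\in 1+A$ and $\omega\in\mathbb{F}$ define the truncated power $\gamma^{[\omega]}=\sum_{i=0}^{p-1}\binom{\omega}{i}(\gamma-1)^i$, where $\binom{\omega}{i}=\omega(\omega-1)\cdots(\omega-i+1)/i!$. The multiplicative group $(1+A)/(1+A^k)$, identified with the image of $1+A$ in $\overline{R}^\times$, is an $\mathbb{F}$-vector space with scalar multiplication $\omega\cdot\overline{\gamma}=\overline{\gamma^{[\omega]}}$; let $\overline{G}^{[\mathbb{F}]}$ be the $\mathbb{F}$-span of the image of $G$ in it. VC$_k$: a valuation criterion element is $\rho\in L$ with $v_L(\rho)\equiv b\pmod{p^2}$ (such $\rho$ generates a normal basis of $L/K$). For $\overline{\gamma}\in\overline{G}^{[\mathbb{F}]}$ put $i_\rho(\overline{\gamma})=\max\{v_L((\gamma'-1)(\rho)):\gamma'\in\overline{\gamma}\}$ and $B_{\rho,k}=\{i_\rho(\overline{\gamma})-v_L(\rho):\overline{\gamma}\in\overline{G}^{[\mathbb{F}]},\ \overline{\gamma}\ne\overline{1}\}$. If $B_{\rho,k}$ is the same set for all valuation criterion elements $\rho$, the VC$_k$-refined breaks of $L/K$ are said to be defined, and are the elements of this common set. SS$_k$: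 for $\gamma\in R$ let $\hat v_L(\gamma)=\min\{v_L(\gamma(x))-v_L(x):x\in L^\times\}$, and for $\overline{\gamma}\in\overline{R}$ let $\hat v_L(\overline{\gamma})=\max\{\hat v_L(\gamma'):\gamma'\in\overline{\gamma}\}$. For $h\ge 0$ let $\overline{G}^{[\mathbb{F}]}_h=\{\overline{\gamma}\in\overline{G}^{[\mathbb{F}]}:\hat v_L(\overline{\gamma}-\overline{1})\ge h\}$. An integer $h\ge0$ is an SS$_k$-refined break of $L/K$ if $\overline{G}^{[\mathbb{F}]}_{h+1}\ne\overline{G}^{[\mathbb{F}]}_h$. *)

theory Defs
  imports
    "HOL-Algebra.Algebraic_Closure_Type"
    "HOL-Algebra.Elementary_Groups"
    "HOL-Algebra.Generated_Fields"
    "HOL-Algebra.Ideal_Product"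
    "HOL-Algebra.QuotRing"
    "HOL-Library.Extended"
begin

text \<open>
  The top field \<open>L\<close> is a type \<open>'l\<close> of class \<open>field\<close>; the base field \<open>K\<close> and the copy \<open>F\<close> of the
  residue field are subfields of it, \<open>F \<subseteq> K \<subseteq> L\<close>, given as sets.  Valuations take values in
  \<^typ>\<open>int extended\<close>, where \<^const>\<open>Pinf\<close> is the value of \<open>0\<close>.  The valuation of \<open>K\<close> is a
  function on the type \<open>'l\<close> of which only the values on \<open>K\<close> matter.
\<close>


section \<open>Discretely valued fields\<close>

definition normalized_valuation :: "'l::field set \<Rightarrow> ('l \<Rightarrow> int extended) \<Rightarrow> bool" where
  "normalized_valuation K v \<longleftrightarrow>
     (\<forall>x\<in>K. v x \<noteq> Minf \<and> (v x = Pinf \<longleftrightarrow> x = 0)) \<and>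
     (\<forall>x\<in>K. \<forall>y\<in>K. v (x * y) = v x + v y) \<and>
     (\<forall>x\<in>K. \<forall>y\<in>K. v (x + y) \<ge> min (v x) (v y)) \<and>
     (\<forall>n. \<exists>x\<in>K. v x = Fin n)"

definition valuation_complete :: "'l::field set \<Rightarrow> ('l \<Rightarrow> int extended) \<Rightarrow> bool" where
  "valuation_complete K v \<longleftrightarrow>
     (\<forall>s :: nat \<Rightarrow> 'l. range s \<subseteq> K \<longrightarrow>
        (\<forall>N. \<exists>M. \<forall>m\<ge>M. \<forall>n\<ge>M. v (s m - s n) \<ge> Fin N) \<longrightarrow>
        (\<exists>x\<in>K. \<forall>N. \<exists>M. \<forall>n\<ge>M. v (s n - x) \<ge> Fin N))"

definition local_field :: "'l::field set \<Rightarrow> ('l \<Rightarrow> int extended) \<Rightarrow> bool" where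
  "local_field K v \<longleftrightarrow>
     subfield K ring_of_type_algebra \<and> normalized_valuation K v \<and> valuation_complete K v"

text \<open>
  \<open>F\<close> is a field contained in the valuation ring of \<open>K\<close> that maps bijectively, hence isomorphically,
  onto the residue field.
\<close>

definition coefficient_field :: "'l::field set \<Rightarrow> 'l set \<Rightarrow> ('l \<Rightarrow> int extended) \<Rightarrow> bool" where
  "coefficient_field F K v \<longleftrightarrow>
     subfield F ring_of_type_algebra \<and> F \<subseteq> {x \<in> K. v x \<ge> 0} \<and>
     (\<forall>x\<in>K. v x \<ge> 0 \<longrightarrow> (\<exists>!a. a \<in> F \<and> v (x - a) > 0))"

definition perfect_of_char :: "nat \<Rightarrow> 'l::field set \<Rightarrow> bool" where
  "perfect_of_char p F \<longleftrightarrow> (\<forall>a\<in>F. \<exists>c\<in>F. c ^ p = a)"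


section \<open>Galois extensions and ramification\<close>

definition galois_group :: "'l::field set \<Rightarrow> ('l \<Rightarrow> 'l) monoid" where
  "galois_group K =
     \<lparr>carrier = {\<sigma> \<in> ring_iso ring_of_type_algebra ring_of_type_algebra. \<forall>x\<in>K. \<sigma> x = x},
      monoid.mult = (\<circ>), one = id\<rparr>"

definition finite_galois :: "'l::field set \<Rightarrow> bool" where
  "finite_galois K \<longleftrightarrow>
     ring.finite_dimension ring_of_type_algebra K UNIV \<and>
     {x. \<forall>\<sigma>\<in>carrier (galois_group K). \<sigma> x = x} = K"

text \<open>
  The ramification index, by which the normalized valuation of \<open>L\<close> restricts to that of \<open>K\<close>, is
  the degree \<open>[L : K]\<close>.
\<close>

definition totally_ramified ::
  "'l::field set \<Rightarrow> ('l \<Rightarrow> int extended) \<Rightarrow> ('l \<Rightarrow> int extended) \<Rightarrow> bool" where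
  "totally_ramified K vK vL \<longleftrightarrow>
     (\<forall>x\<in>K. vL x = map_extended ((*) (int (ring.dim ring_of_type_algebra K UNIV))) (vK x))"

text \<open>Lower numbering.\<close>

definition ramification_group :: "'l::field set \<Rightarrow> ('l \<Rightarrow> int extended) \<Rightarrow> int \<Rightarrow> ('l \<Rightarrow> 'l) set" where
  "ramification_group K vL i =
     {\<sigma> \<in> carrier (galois_group K). \<forall>x. vL x \<ge> 0 \<longrightarrow> vL (\<sigma> x - x) \<ge> Fin (i + 1)}"

definition ramification_breaks :: "'l::field set \<Rightarrow> ('l \<Rightarrow> int extended) \<Rightarrow> int set" where
  "ramification_breaks K vL =
     {i. i \<ge> -1 \<and> ramification_group K vL i \<noteq> ramification_group K vL (i + 1)}"


section \<open>Artin--Schreier data\<close>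

definition reduced_error_term ::
  "nat \<Rightarrow> 'l::field set \<Rightarrow> ('l \<Rightarrow> int extended) \<Rightarrow> int \<Rightarrow> 'l \<Rightarrow> bool" where
  "reduced_error_term p F vK b \<epsilon> \<longleftrightarrow>
     vK \<epsilon> > Fin (- b) \<and> ((\<exists>n. vK \<epsilon> = Fin n \<and> n < 0 \<and> \<not> int p dvd n) \<or> \<epsilon> \<in> F)"

text \<open>The prime field of \<open>L\<close> is \<^term>\<open>range (of_int :: int \<Rightarrow> 'l::field)\<close>.\<close>

definition independent_over_prime_field :: "'l::field \<Rightarrow> 'l \<Rightarrow> bool" where
  "independent_over_prime_field \<omega>1 \<omega>2 \<longleftrightarrow>
     (\<forall>c1 \<in> range (of_int :: int \<Rightarrow> 'l). \<forall>c2 \<in> range (of_int :: int \<Rightarrow> 'l).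
        c1 * \<omega>1 + c2 * \<omega>2 = 0 \<longrightarrow> c1 = 0 \<and> c2 = 0)"

definition artin_schreier_data ::
  "nat \<Rightarrow> 'l::field set \<Rightarrow> 'l set \<Rightarrow> ('l \<Rightarrow> int extended) \<Rightarrow> int \<Rightarrow>
   'l \<Rightarrow> 'l \<times> 'l \<Rightarrow> 'l \<times> 'l \<Rightarrow> bool" where
  "artin_schreier_data p F K vK b \<beta> = (\<lambda>(\<omega>1, \<omega>2) (\<epsilon>1, \<epsilon>2).
     \<beta> \<in> K \<and> vK \<beta> = Fin (- b) \<and>
     \<omega>1 \<in> F \<and> \<omega>2 \<in> F \<and> independent_over_prime_field \<omega>1 \<omega>2 \<and>
     \<epsilon>1 \<in> K \<and> \<epsilon>2 \<in> K \<and> reduced_error_term p F vK b \<epsilon>1 \<and> reduced_error_term p F vK b \<epsilon>2 \<and>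
     (\<exists>x1 x2. x1 ^ p - x1 = \<omega>1 ^ p\<^sup>2 * \<beta> + \<epsilon>1 \<and> x2 ^ p - x2 = \<omega>2 ^ p\<^sup>2 * \<beta> + \<epsilon>2 \<and>
        generate_field ring_of_type_algebra (K \<union> {x1, x2}) = UNIV))"


section \<open>The group algebra\<close>

text \<open>
  For a finite group \<open>G\<close>, an element of \<open>F[G]\<close> is its family of coefficients, extended by zero
  outside the carrier of \<open>G\<close>.
\<close>

definition group_algebra :: "'l::field set \<Rightarrow> 'g monoid \<Rightarrow> ('g \<Rightarrow> 'l) ring" where
  "group_algebra F G =
     \<lparr>carrier = {a. (\<forall>g\<in>carrier G. a g \<in> F) \<and> (\<forall>g. g \<notin> carrier G \<longrightarrow> a g = 0)},
      monoid.mult = (\<lambda>a b g. if g \<in> carrier G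
        then \<Sum>h\<in>carrier G. a h * b (inv\<^bsub>G\<^esub> h \<otimes>\<^bsub>G\<^esub> g) else 0),
      one = (\<lambda>g. if g = \<one>\<^bsub>G\<^esub> then 1 else 0),
      ring.zero = (\<lambda>_. 0),
      add = (\<lambda>a b g. a g + b g)\<rparr>"

definition group_element :: "'g \<Rightarrow> 'g \<Rightarrow> 'l::field" where
  "group_element g = (\<lambda>h. if h = g then 1 else 0)"

definition algebra_action :: "('l::field \<Rightarrow> 'l) monoid \<Rightarrow> (('l \<Rightarrow> 'l) \<Rightarrow> 'l) \<Rightarrow> 'l \<Rightarrow> 'l" where
  "algebra_action G a x = (\<Sum>g\<in>carrier G. a g * g x)"

definition augmentation_ideal :: "'l::field set \<Rightarrow> 'g monoid \<Rightarrow> ('g \<Rightarrow> 'l) set" where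
  "augmentation_ideal F G =
     {a \<in> carrier (group_algebra F G). (\<Sum>g\<in>carrier G. a g) = 0}"

definition one_plus_augmentation :: "'l::field set \<Rightarrow> 'g monoid \<Rightarrow> ('g \<Rightarrow> 'l) set" where
  "one_plus_augmentation F G =
     {\<gamma> \<in> carrier (group_algebra F G).
        \<gamma> \<ominus>\<^bsub>group_algebra F G\<^esub> \<one>\<^bsub>group_algebra F G\<^esub> \<in> augmentation_ideal F G}"

definition augmentation_power :: "'l::field set \<Rightarrow> 'g monoid \<Rightarrow> nat \<Rightarrow> ('g \<Rightarrow> 'l) set" where
  "augmentation_power F G k =
     (ideal_prod (group_algebra F G) (augmentation_ideal F G) ^^ k) (carrier (group_algebra F G))"

text \<open>The elements of this ring are cosets, that is, sets of elements of the group algebra.\<close>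

definition truncated_algebra :: "'l::field set \<Rightarrow> 'g monoid \<Rightarrow> nat \<Rightarrow> ('g \<Rightarrow> 'l) set ring" where
  "truncated_algebra F G k = group_algebra F G Quot augmentation_power F G k"

definition truncated_class ::
  "'l::field set \<Rightarrow> 'g monoid \<Rightarrow> nat \<Rightarrow> ('g \<Rightarrow> 'l) \<Rightarrow> ('g \<Rightarrow> 'l) set" where
  "truncated_class F G k \<gamma> = augmentation_power F G k +>\<^bsub>group_algebra F G\<^esub> \<gamma>"

text \<open>
  \<^const>\<open>gbinomial\<close> requires characteristic zero.  In characteristic \<open>p\<close> the following is
  meaningful for \<open>i < p\<close>, where \<open>i!\<close> is invertible.
\<close>

definition field_binomial :: "'l::field \<Rightarrow> nat \<Rightarrow> 'l" where
  "field_binomial \<omega> i = (\<Prod>j<i. \<omega> - of_nat j) / of_nat (fact i)"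

definition truncated_power ::
  "nat \<Rightarrow> 'l::field set \<Rightarrow> 'g monoid \<Rightarrow> ('g \<Rightarrow> 'l) \<Rightarrow> 'l \<Rightarrow> 'g \<Rightarrow> 'l" where
  "truncated_power p F G \<gamma> \<omega> = (\<lambda>g. \<Sum>i<p. field_binomial \<omega> i *
     ((\<gamma> \<ominus>\<^bsub>group_algebra F G\<^esub> \<one>\<^bsub>group_algebra F G\<^esub>) [^]\<^bsub>group_algebra F G\<^esub> i) g)"

text \<open>
  The \<open>F\<close>-span of the image of \<open>G\<close> in the image of \<open>1 + A\<close> in \<open>F[G] / A ^ k\<close>: vector addition is
  multiplication of cosets, and scalar multiplication is induced by the truncated power.
\<close>

inductive_set group_span :: "nat \<Rightarrow> 'l::field set \<Rightarrow> 'g monoid \<Rightarrow> nat \<Rightarrow> ('g \<Rightarrow> 'l) set set"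
  for p F G k where
    base: "g \<in> carrier G \<Longrightarrow> truncated_class F G k (group_element g) \<in> group_span p F G k"
  | mult: "\<lbrakk>c \<in> group_span p F G k; d \<in> group_span p F G k\<rbrakk>
      \<Longrightarrow> c \<otimes>\<^bsub>truncated_algebra F G k\<^esub> d \<in> group_span p F G k"
  | scale: "\<lbrakk>\<gamma> \<in> one_plus_augmentation F G; truncated_class F G k \<gamma> \<in> group_span p F G k; \<omega> \<in> F\<rbrakk>
      \<Longrightarrow> truncated_class F G k (truncated_power p F G \<gamma> \<omega>) \<in> group_span p F G k"


section \<open>Refined breaks\<close>

text \<open>
  In this section \<^const>\<open>Least\<close> and \<^const>\<open>Greatest\<close> denote minimum and maximum of a set of
  values; \<^const>\<open>Min\<close> and \<^const>\<open>Max\<close> are only meaningful for finite sets.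
\<close>

subsection \<open>Via valuation criterion elements\<close>

definition valuation_criterion :: "nat \<Rightarrow> ('l::field \<Rightarrow> int extended) \<Rightarrow> int \<Rightarrow> 'l \<Rightarrow> bool" where
  "valuation_criterion p vL b \<rho> \<longleftrightarrow> (\<exists>n. vL \<rho> = Fin n \<and> n mod (int p)\<^sup>2 = b mod (int p)\<^sup>2)"

definition VC_index ::
  "'l::field set \<Rightarrow> ('l \<Rightarrow> 'l) monoid \<Rightarrow> ('l \<Rightarrow> int extended) \<Rightarrow> 'l \<Rightarrow> (('l \<Rightarrow> 'l) \<Rightarrow> 'l) set \<Rightarrow>
   int extended" where
  "VC_index F G vL \<rho> c = (GREATEST n. \<exists>\<gamma>\<in>c. n =
     vL (algebra_action G (\<gamma> \<ominus>\<^bsub>group_algebra F G\<^esub> \<one>\<^bsub>group_algebra F G\<^esub>) \<rho>))"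

definition VC_set ::
  "nat \<Rightarrow> 'l::field set \<Rightarrow> ('l \<Rightarrow> 'l) monoid \<Rightarrow> ('l \<Rightarrow> int extended) \<Rightarrow> nat \<Rightarrow> 'l \<Rightarrow>
   int extended set" where
  "VC_set p F G vL k \<rho> =
     {VC_index F G vL \<rho> c - vL \<rho> | c. c \<in> group_span p F G k \<and> c \<noteq> \<one>\<^bsub>truncated_algebra F G k\<^esub>}"

definition VC_refined_breaks_defined ::
  "nat \<Rightarrow> 'l::field set \<Rightarrow> ('l \<Rightarrow> 'l) monoid \<Rightarrow> ('l \<Rightarrow> int extended) \<Rightarrow> int \<Rightarrow> nat \<Rightarrow> bool" where
  "VC_refined_breaks_defined p F G vL b k \<longleftrightarrow>
     (\<forall>\<rho> \<rho>'. valuation_criterion p vL b \<rho> \<longrightarrow> valuation_criterion p vL b \<rho>' \<longrightarrow>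
        VC_set p F G vL k \<rho> = VC_set p F G vL k \<rho>')"

text \<open>To be used only when \<^const>\<open>VC_refined_breaks_defined\<close> holds.\<close>

definition VC_refined_breaks ::
  "nat \<Rightarrow> 'l::field set \<Rightarrow> ('l \<Rightarrow> 'l) monoid \<Rightarrow> ('l \<Rightarrow> int extended) \<Rightarrow> int \<Rightarrow> nat \<Rightarrow>
   int extended set" where
  "VC_refined_breaks p F G vL b k =
     (THE B. \<forall>\<rho>. valuation_criterion p vL b \<rho> \<longrightarrow> VC_set p F G vL k \<rho> = B)"

subsection \<open>Via the valuation on the group algebra\<close>

definition algebra_valuation ::
  "('l::field \<Rightarrow> 'l) monoid \<Rightarrow> ('l \<Rightarrow> int extended) \<Rightarrow> (('l \<Rightarrow> 'l) \<Rightarrow> 'l) \<Rightarrow> int extended" where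
  "algebra_valuation G vL \<gamma> = (LEAST n. \<exists>x. x \<noteq> 0 \<and> n = vL (algebra_action G \<gamma> x) - vL x)"

definition coset_valuation ::
  "('l::field \<Rightarrow> 'l) monoid \<Rightarrow> ('l \<Rightarrow> int extended) \<Rightarrow> (('l \<Rightarrow> 'l) \<Rightarrow> 'l) set \<Rightarrow> int extended" where
  "coset_valuation G vL c = (GREATEST n. \<exists>\<gamma>\<in>c. n = algebra_valuation G vL \<gamma>)"

definition SS_filtration ::
  "nat \<Rightarrow> 'l::field set \<Rightarrow> ('l \<Rightarrow> 'l) monoid \<Rightarrow> ('l \<Rightarrow> int extended) \<Rightarrow> nat \<Rightarrow> int \<Rightarrow>
   (('l \<Rightarrow> 'l) \<Rightarrow> 'l) set set" where
  "SS_filtration p F G vL k h =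
     {c \<in> group_span p F G k.
        coset_valuation G vL (c \<ominus>\<^bsub>truncated_algebra F G k\<^esub> \<one>\<^bsub>truncated_algebra F G k\<^esub>) \<ge> Fin h}"

definition SS_refined_breaks ::
  "nat \<Rightarrow> 'l::field set \<Rightarrow> ('l \<Rightarrow> 'l) monoid \<Rightarrow> ('l \<Rightarrow> int extended) \<Rightarrow> nat \<Rightarrow> int set" where
  "SS_refined_breaks p F G vL k =
     {h. h \<ge> 0 \<and> SS_filtration p F G vL k (h + 1) \<noteq> SS_filtration p F G vL k h}"

end

theory Submission
  imports Defs
begin

text \<open>
  Put \<open>s = \<omega>2 ^ p\<close>.  The coordinates \<open>x1, x2\<close> turn elements of \<open>F[G]\<close> into operators on polynomials:
  modulo \<open>A ^ k\<close> with \<open>k \<le> p\<close> a group element is determined by its action on the polynomials of total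
  degree less than \<open>k\<close> in \<open>x1, x2\<close>, where it is a translation.  By Newton's difference formula the
  truncated power scales the translation vector, so the \<open>F\<close>-span of \<open>G\<close> is the plane of all
  translations.

  For the valuations one replaces \<open>x2\<close> by \<open>Z = x2 - s x1 - \<alpha>\<close>, where \<open>\<alpha>\<close> in \<open>K(x1)\<close> approximates
  \<open>\<epsilon>2 ^ (1/p)\<close>: a term \<open>m ^ p \<beta> ^ i\<close> of \<open>\<epsilon>2\<close> contributes \<open>m x1 ^ i\<close>.  Then \<open>v Z = -b\<close>, \<open>v x1 = -bp\<close>, so
  the products of binomial coefficients of \<open>Z\<close> and \<open>x1\<close> form a \<open>K\<close>-basis of \<open>L\<close> whose valuations are
  distinct modulo \<open>p\<^sup>2\<close>.  On it \<open>X2 = \<sigma>2 - 1\<close> raises valuations by \<open>b\<close> and \<open>\<Psi> = \<sigma>1 \<sigma>2 ^ [s] - 1\<close> raises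
  them by the second break \<open>c = b\<^sub>*\<close>, exactly so on elements of valuation congruent to \<open>b\<close>; the defect
  \<open>\<delta>\<close> in \<open>\<sigma>1 Z = Z - s - \<delta>\<close> accounts for the minimum in \<open>b\<^sub>*\<close>.  Finally \<open>A\<^sup>2\<close> lies in \<open>\<Psi> A + X2\<^sup>2 F[X2]\<close> and
  \<open>X2 ^ i\<close> raises valuations by \<open>ib \<noteq> b\<^sub>*\<close>, so no representative of a class does better than the obvious
  one.
\<close>

text \<open>Two bases are needed because \<open>x1\<close> and \<open>x2\<close> have the same
  valuation \<open>-bp\<close>: their binomials are good coordinates modulo \<open>A ^ k\<close> but
  do not separate valuations, while those in \<open>Z\<close> and \<open>x1\<close> do. The two
  numbers in the minimum are two gains of the operator \<open>\<Psi>\<close>: it moves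
  \<open>Z\<close> by \<open>-\<delta>\<close>, which gains \<open>b + v \<delta>\<close>, and
  \<open>x1\<close> by \<open>1\<close>, which gains \<open>bp\<close>; when the first gain is the
  smaller, \<open>v \<delta>\<close> is exactly \<open>(b - e2) p\<close>. Gains are exact at
  valuations congruent to \<open>b\<close> because the basis element with both indices
  \<open>p - 1\<close> has valuation \<open>b - b p^2\<close>, and on it no lowered index becomes
  negative. The delicate point is the maximum over all representatives of a class, since an error
  from \<open>A ^ k\<close> might cancel the leading term. Errors \<open>\<Psi> u\<close> gain at
  least \<open>b + c\<close>; the others are combinations of powers of \<open>X2\<close> with
  coefficients in \<open>F\<close>, so their gain is exactly a multiple of \<open>b\<close> and
  never equals \<open>c\<close>. Both kinds of refined breaks follow from one property of a class,
  \<open>has_jump\<close>: some representative gains \<open>r\<close> on every element, and none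
  gains more on an element of valuation congruent to \<open>b\<close>.\<close>

definition falling :: "'a::comm_ring_1 \<Rightarrow> nat \<Rightarrow> 'a" where
  "falling x n = (\<Prod>j<n. x - of_nat j)"

lemma falling_0 [simp]: "falling x 0 = 1"
  by (simp add: falling_def)

lemma falling_Suc: "falling x (Suc n) = falling x n * (x - of_nat n)"
  by (simp add: falling_def mult.commute)

text \<open>The Vandermonde identity, kept free of division so that it holds in every commutative
  ring; division by \<open>fact n\<close> is postponed to the place where \<open>n < p\<close> makes
  it legitimate.\<close>

lemma falling_add:
  "falling (x + y) n = (\<Sum>m\<le>n. of_nat (n choose m) * falling x m * falling y (n - m))"
proof (induction n)
  case (Suc n)
  let ?g = "\<lambda>m. of_nat (n choose m) * falling x m * falling y (n - m)"
  let ?A = "\<lambda>m. of_nat (n choose m) * falling x (Suc m) * falling y (n - m)"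
  let ?B = "\<lambda>m. of_nat (n choose m) * falling x m * falling y (Suc n - m)"
  have "falling (x + y) (Suc n) = (\<Sum>m\<le>n. ?g m * (x + y - of_nat n))"
    by (simp add: falling_Suc Suc sum_distrib_right)
  also have "\<dots> = (\<Sum>m\<le>n. ?A m + ?B m)"
  proof (rule sum.cong[OF refl])
    fix m assume "m \<in> {..n}"
    then have "Suc n - m = Suc (n - m)" "of_nat n = (of_nat m + of_nat (n - m) :: 'a)"
      by (auto simp flip: of_nat_add)
    \<comment> \<open>The factor splits as \<open>(x - of_nat m) + (y - of_nat (n - m))\<close>; the
      first summand extends \<open>falling x m\<close>, the second
      \<open>falling y (n - m)\<close>.\<close>
    then show "?g m * (x + y - of_nat n) = ?A m + ?B m"
      by (simp add: falling_Suc algebra_simps)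
  qed
  also have "\<dots> = (\<Sum>m\<le>n. ?A m) + (\<Sum>m\<le>n. ?B m)"
    by (simp add: sum.distrib)
  also have "(\<Sum>m\<le>n. ?B m) = (\<Sum>m\<le>Suc n. ?B m)"
    by (simp add: binomial_eq_0)
  also have "\<dots> = ?B 0 + (\<Sum>m\<le>n. ?B (Suc m))"
    by (rule sum.atMost_Suc_shift)
  finally have 1: "falling (x + y) (Suc n) = ?B 0 + (\<Sum>m\<le>n. ?A m + ?B (Suc m))"
    by (simp add: sum.distrib algebra_simps)
  have "(\<Sum>m\<le>Suc n. of_nat (Suc n choose m) * falling x m * falling y (Suc n - m)) =
      ?B 0 + (\<Sum>m\<le>n. of_nat (Suc n choose Suc m) * falling x (Suc m) * falling y (n - m))"
    by (subst sum.atMost_Suc_shift) simp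
  also have "\<dots> = ?B 0 + (\<Sum>m\<le>n. ?A m + ?B (Suc m))"
    by (simp add: algebra_simps)
  finally show ?case
    using 1 by simp
qed simp

lemma field_binomial_eq_falling: "field_binomial x n = falling x n / of_nat (fact n)"
  by (simp add: field_binomial_def falling_def)

lemma field_binomial_0 [simp]: "field_binomial x 0 = 1"
  by (simp add: field_binomial_def)

lemma field_binomial_1 [simp]: "field_binomial x (Suc 0) = x"
  by (simp add: field_binomial_def)

section \<open>Characteristic p: the prime field and binomial coefficients of index below p\<close>

locale prime_char =
  fixes p :: nat and type_of_field :: "'l::field itself"
  assumes prime_p: "Factorial_Ring.prime p" and char_p: "CHAR('l) = p"
begin

lemma p_gt_1: "p > 1" and p_pos: "p > 0"
  using prime_gt_1_nat[OF prime_p] by auto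

lemma of_nat_eq_0_iff: "of_nat n = (0::'l) \<longleftrightarrow> p dvd n"
  using char_p of_nat_eq_0_iff_char_dvd by metis

lemma of_nat_fact_neq_0: "i < p \<Longrightarrow> of_nat (fact i) \<noteq> (0::'l)"
  using prime_p by (auto simp: of_nat_eq_0_iff prime_dvd_fact_iff simp del: of_nat_fact)

lemma of_nat_neq_0: "0 < i \<Longrightarrow> i < p \<Longrightarrow> of_nat i \<noteq> (0::'l)"
  by (simp add: of_nat_eq_0_iff nat_dvd_not_less)

lemma of_nat_p [simp]: "of_nat p = (0::'l)"
  by (simp add: of_nat_eq_0_iff)

lemma freshman: "(x + y) ^ p = x ^ p + (y::'l) ^ p"
  using freshmans_dream prime_p char_p by metis

lemma freshman_diff: "(x - y) ^ p = x ^ p - (y::'l) ^ p"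
  using freshman[of "x - y" y] by (simp add: algebra_simps)

lemma of_nat_power_p: "of_nat n ^ p = (of_nat n :: 'l)"
proof (induction n)
  case 0 show ?case using p_pos by simp
next
  case (Suc n) then show ?case using freshman[of 1 "of_nat n"] by simp
qed

lemma inj_of_nat: "inj_on (of_nat :: nat \<Rightarrow> 'l) {..<p}"
proof (rule linorder_inj_onI')
  fix i j assume ij: "i \<in> {..<p}" "j \<in> {..<p}" "i < j"
  show "of_nat i \<noteq> (of_nat j :: 'l)"
    using of_nat_neq_0[of "j - i"] ij by (simp add: of_nat_diff less_imp_diff_less)
qed

text \<open>The polynomial \<open>X ^ p - X\<close> has at most \<open>p\<close> roots, and the
  images of \<open>0, ..., p - 1\<close> already provide \<open>p\<close> of them.\<close>

lemma artin_schreier_root: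
  assumes "(c::'l) ^ p = c"
  obtains n where "n < p" "c = of_nat n"
proof -
  define q :: "'l poly" where "q = Polynomial.monom 1 p - Polynomial.monom 1 1"
  have q: "poly q x = x ^ p - x" for x
    by (simp add: q_def poly_monom)
  have "coeff q p = 1"
    using p_gt_1 by (simp add: q_def)
  then have "q \<noteq> 0" by auto
  have deg: "degree q \<le> p"
    unfolding q_def using p_gt_1 by (intro degree_diff_le) (auto simp: degree_monom_le[THEN order_trans])
  let ?S = "of_nat ` {..<p} :: 'l set"
  have "?S \<subseteq> {x. poly q x = 0}"
    by (auto simp: q of_nat_power_p)
  moreover have "finite {x. poly q x = 0}" "card {x. poly q x = 0} \<le> p"
    using poly_roots_finite[OF \<open>q \<noteq> 0\<close>] card_poly_roots_bound[OF \<open>q \<noteq> 0\<close>] deg by auto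
  moreover have "card ?S = p"
    using inj_of_nat by (simp add: card_image)
  ultimately have "?S = {x. poly q x = 0}"
    by (metis card_seteq)
  moreover have "c \<in> {x. poly q x = 0}"
    using assms by (simp add: q)
  ultimately have "c \<in> ?S"
    by blast
  then show ?thesis using that by auto
qed

text \<open>For \<open>n < p\<close> the factorials involved are units, so
  \<open>falling_add\<close> may be divided by \<open>fact n\<close>.\<close>

lemma field_binomial_add:
  fixes x y :: 'l
  assumes "n < p"
  shows "field_binomial (x + y) n = (\<Sum>m\<le>n. field_binomial x m * field_binomial y (n - m))"
proof -
  have "of_nat (n choose m) * falling x m * falling y (n - m) / of_nat (fact n) =
      field_binomial x m * field_binomial y (n - m)" if "m \<le> n" for m
  proof -
    have "(of_nat (fact n) :: 'l) = of_nat (n choose m) * of_nat (fact m) * of_nat (fact (n - m))"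
      using binomial_fact_lemma[OF that] by (metis mult.commute mult.left_commute of_nat_mult)
    moreover have "(of_nat (fact n) :: 'l) \<noteq> 0"
      using assms by (rule of_nat_fact_neq_0)
    ultimately show ?thesis
      by (simp add: field_binomial_eq_falling divide_simps del: of_nat_fact)
  qed
  then show ?thesis
    by (simp add: field_binomial_eq_falling[of "x+y"] falling_add sum_divide_distrib del: of_nat_fact)
qed

text \<open>\<open>field_binomial 1 m\<close> vanishes for \<open>m \<ge> 2\<close>, which leaves
  two terms of Vandermonde. In use: \<open>g - 1\<close> lowers the index of a binomial in
  \<open>z\<close> by one whenever \<open>g z = z + 1\<close>.\<close>

lemma field_binomial_pascal:
  fixes x :: 'l
  assumes "Suc n < p"
  shows "field_binomial (x + 1) (Suc n) = field_binomial x (Suc n) + field_binomial x n"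
proof -
  have z: "field_binomial 1 m = (0::'l)" if "m \<ge> 2" for m
    using that by (auto simp: field_binomial_def intro!: prod_zero bexI[of _ 1])
  have "(\<Sum>m\<le>Suc n. field_binomial (1::'l) m * field_binomial x (Suc n - m)) =
      (\<Sum>m\<in>{0,1}. field_binomial (1::'l) m * field_binomial x (Suc n - m))"
  proof (rule sum.mono_neutral_right)
    show "\<forall>m\<in>{..Suc n} - {0, 1}. field_binomial (1::'l) m * field_binomial x (Suc n - m) = 0"
    proof
      fix m assume "m \<in> {..Suc n} - {0, 1}"
      then have "m \<ge> 2" by auto
      then show "field_binomial (1::'l) m * field_binomial x (Suc n - m) = 0"
        by (simp add: z)
    qed
  qed auto
  then show ?thesis
    using field_binomial_add[OF assms, of 1 x] by (simp add: add.commute)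
qed

lemma field_binomial_of_nat: "i < p \<Longrightarrow> field_binomial (of_nat n :: 'l) i = of_nat (n choose i)"
proof (induction n arbitrary: i)
  case 0
  have "field_binomial (0::'l) (Suc j) = 0" for j
  proof -
    have "(\<Prod>m<Suc j. 0 - of_nat m :: 'l) = 0"
      by (rule prod_zero) (auto intro!: bexI[of _ 0])
    then show ?thesis by (simp add: field_binomial_def)
  qed
  then show ?case
    by (cases i) auto
next
  case (Suc n)
  show ?case
  proof (cases i)
    case (Suc j)
    then show ?thesis
      using Suc.IH[of j] Suc.IH[of "Suc j"] Suc.prems field_binomial_pascal[of j "of_nat n"]
      by (simp add: add.commute)
  qed simp
qed

text \<open>The binomial as a polynomial in its upper argument, so that identities can be proved by
  comparing degrees and values on the prime field.\<close>

definition binomial_poly :: "nat \<Rightarrow> 'l poly" where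
  "binomial_poly i = smult (1 / of_nat (fact i)) (\<Prod>j<i. [:- of_nat j, 1:])"

lemma poly_binomial_poly [simp]: "poly (binomial_poly i) x = field_binomial x i"
  by (simp add: binomial_poly_def field_binomial_def poly_prod)

lemma degree_binomial_poly: "degree (binomial_poly i) \<le> i"
proof -
  have "degree (\<Prod>j<i. [:- of_nat j, 1::'l:]) \<le> (\<Sum>j<i. degree [:- of_nat j, 1::'l:])"
    using degree_prod_sum_le[of "{..<i}" "\<lambda>j. [:- of_nat j, 1::'l:]"] by (simp add: o_def)
  then show ?thesis
    unfolding binomial_poly_def using degree_smult_le order_trans by fastforce
qed

text \<open>A nonzero difference would have \<open>p\<close> roots and degree below
  \<open>p\<close>. This carries identities from integer exponents to arbitrary exponents.\<close>

lemma poly_eq_if_eq_on_prime_field: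
  fixes f g :: "'l poly"
  assumes "degree f < p" "degree g < p"
    and "\<And>n. poly f (of_nat n) = poly g (of_nat n)"
  shows "f = g"
proof (rule ccontr)
  assume "f \<noteq> g"
  then have nz: "f - g \<noteq> 0" by simp
  have "of_nat ` {..<p} \<subseteq> {x. poly (f - g) x = 0}"
    using assms(3) by auto
  then have "p \<le> card {x. poly (f - g) x = 0}"
    using card_mono[OF poly_roots_finite[OF nz]] inj_of_nat by (metis card_image card_lessThan)
  also have "\<dots> \<le> degree (f - g)"
    by (rule card_poly_roots_bound[OF nz])
  also have "\<dots> < p"
    using assms(1,2) degree_diff_less by blast
  finally show False by simp
qed

end

text \<open>The binomial theorem for \<open>T = 1 + D\<close> with \<open>D = T - 1\<close>, that
  is, Newton's difference formula; additivity lets \<open>T\<close> pass through the sum.\<close>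

lemma iterate_eq_sum_differences:
  fixes T :: "'l::field \<Rightarrow> 'l"
  assumes add: "\<And>x y. T (x + y) = T x + T y"
  shows "(T ^^ n) y = (\<Sum>i\<le>n. of_nat (n choose i) * ((\<lambda>x. T x - x) ^^ i) y)"
proof (induction n)
  case (Suc n)
  let ?D = "\<lambda>x. T x - x"
  have T0: "T 0 = 0" using add[of 0 0] by (metis add_0 add_cancel_right_right)
  have Tnat: "T (of_nat m * x) = of_nat m * T x" for m x
    by (induction m) (auto simp: add T0 algebra_simps)
  have Tsum: "T (sum f A) = (\<Sum>i\<in>A. T (f i))" for f and A :: "nat set"
    by (induction A rule: infinite_finite_induct) (auto simp: add T0)
  have D: "T x = x + ?D x" for x by simp
  have "(T ^^ Suc n) y = (\<Sum>i\<le>n. of_nat (n choose i) * T ((?D ^^ i) y))"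
    by (simp add: Suc Tsum Tnat)
  also have "\<dots> = (\<Sum>i\<le>n. of_nat (n choose i) * (?D ^^ i) y) + (\<Sum>i\<le>n. of_nat (n choose i) * (?D ^^ Suc i) y)"
    by (simp add: algebra_simps sum_subtractf sum.distrib)
  also have "(\<Sum>i\<le>n. of_nat (n choose i) * (?D ^^ i) y) = (\<Sum>i\<le>Suc n. of_nat (n choose i) * (?D ^^ i) y)"
    by (simp add: binomial_eq_0)
  also have "\<dots> = y + (\<Sum>i\<le>n. of_nat (n choose Suc i) * (?D ^^ Suc i) y)"
    by (subst sum.atMost_Suc_shift) simp
  finally have "(T ^^ Suc n) y = y + (\<Sum>i\<le>n. of_nat (Suc n choose Suc i) * (?D ^^ Suc i) y)"
    by (simp only: binomial_Suc_Suc of_nat_add distrib_right sum.distrib add.assoc add.commute add.left_commute)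
  also have "\<dots> = (\<Sum>i\<le>Suc n. of_nat (Suc n choose i) * (?D ^^ i) y)"
    by (subst sum.atMost_Suc_shift) simp
  finally show ?case .
qed simp

section \<open>Subfields given as carriers, translated to the operations of the type\<close>

lemma ring_of_type_algebra_simps [simp]:
  "carrier ring_of_type_algebra = UNIV"
  "x \<otimes>\<^bsub>ring_of_type_algebra\<^esub> y = x * y"
  "x \<oplus>\<^bsub>ring_of_type_algebra\<^esub> y = x + y"
  "\<one>\<^bsub>ring_of_type_algebra\<^esub> = 1"
  "\<zero>\<^bsub>ring_of_type_algebra\<^esub> = 0"
  by (simp_all add: ring_of_type_algebra_def)

lemma a_inv_ring_of_type_algebra [simp]: "\<ominus>\<^bsub>ring_of_type_algebra\<^esub> x = - (x :: 'l::field)"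
proof -
  interpret R: ring "ring_of_type_algebra :: 'l ring" ..
  show ?thesis
    by (rule R.minus_equality) auto
qed

lemma m_inv_ring_of_type_algebra:
  assumes "x \<noteq> (0 :: 'l::field)"
  shows "inv\<^bsub>ring_of_type_algebra\<^esub> x = inverse x"
proof -
  interpret R: field "ring_of_type_algebra :: 'l ring" ..
  show ?thesis
    using assms by (intro R.comm_inv_char) auto
qed

locale type_subfield =
  fixes K :: "'l::field set"
  assumes subfield: "subfield K ring_of_type_algebra"
begin

lemma zero_in [simp]: "0 \<in> K" and one_in [simp]: "1 \<in> K"
  and add_in: "x \<in> K \<Longrightarrow> y \<in> K \<Longrightarrow> x + y \<in> K"
  and mult_in: "x \<in> K \<Longrightarrow> y \<in> K \<Longrightarrow> x * y \<in> K"
  and uminus_in: "x \<in> K \<Longrightarrow> - x \<in> K"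
  using subringE[OF subfieldE(1)[OF subfield]] by auto

lemma diff_in: "x \<in> K \<Longrightarrow> y \<in> K \<Longrightarrow> x - y \<in> K"
  using add_in[of x "- y"] uminus_in[of y] by simp

lemma inverse_in: "x \<in> K \<Longrightarrow> inverse x \<in> K"
proof (cases "x = 0")
  case False
  interpret R: field "ring_of_type_algebra :: 'l ring" ..
  assume "x \<in> K"
  then show ?thesis
    using R.subfield_m_inv(1)[OF subfield, of x] False m_inv_ring_of_type_algebra[OF False] by auto
qed simp

lemma divide_in: "x \<in> K \<Longrightarrow> y \<in> K \<Longrightarrow> x / y \<in> K"
  by (simp add: divide_inverse mult_in inverse_in)

lemma of_nat_in [simp]: "of_nat n \<in> K"
  by (induction n) (auto intro: add_in)

lemma power_in: "x \<in> K \<Longrightarrow> x ^ n \<in> K"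
  by (induction n) (auto intro: mult_in)

lemma sum_in: "(\<And>i. i \<in> A \<Longrightarrow> f i \<in> K) \<Longrightarrow> sum f A \<in> K"
  by (induction A rule: infinite_finite_induct) (auto intro: add_in)

lemma prod_in: "(\<And>i. i \<in> A \<Longrightarrow> f i \<in> K) \<Longrightarrow> prod f A \<in> K"
  by (induction A rule: infinite_finite_induct) (auto intro: mult_in)

lemma field_binomial_in: "x \<in> K \<Longrightarrow> field_binomial x n \<in> K"
  unfolding field_binomial_def by (intro divide_in prod_in diff_in of_nat_in)

end


section \<open>The group algebra of a finite commutative group\<close>

locale finite_group_algebra = G: comm_group G + F: type_subfield F
  for G :: "'g monoid" (structure) and F :: "'l::field set" +
  assumes finite_G [simp]: "finite (carrier G)"
begin

abbreviation "R \<equiv> group_algebra F G"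

lemma carrier_R: "a \<in> carrier R \<longleftrightarrow> (\<forall>g. (g \<in> carrier G \<longrightarrow> a g \<in> F) \<and> (g \<notin> carrier G \<longrightarrow> a g = 0))"
  by (auto simp: group_algebra_def)

lemma R_closedD: "a \<in> carrier R \<Longrightarrow> a g \<in> F"
  using F.zero_in by (metis carrier_R)

lemma R_outside: "a \<in> carrier R \<Longrightarrow> g \<notin> carrier G \<Longrightarrow> a g = 0"
  by (simp add: carrier_R)

lemma R_simps:
  "\<zero>\<^bsub>R\<^esub> = (\<lambda>_. 0)"
  "\<one>\<^bsub>R\<^esub> = group_element \<one>"
  "a \<oplus>\<^bsub>R\<^esub> b = (\<lambda>g. a g + b g)"
  by (simp_all add: group_algebra_def group_element_def)

lemma R_mult: "a \<otimes>\<^bsub>R\<^esub> b = (\<lambda>g. if g \<in> carrier G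
    then \<Sum>h\<in>carrier G. a h * b (inv h \<otimes> g) else 0)"
  by (simp add: group_algebra_def)

lemma group_element_in: "g \<in> carrier G \<Longrightarrow> group_element g \<in> carrier R"
  by (auto simp: carrier_R group_element_def)

lemma R_mult_closed: "a \<in> carrier R \<Longrightarrow> b \<in> carrier R \<Longrightarrow> a \<otimes>\<^bsub>R\<^esub> b \<in> carrier R"
  by (auto simp: carrier_R R_mult intro!: F.sum_in F.mult_in)

lemma R_add_closed: "a \<in> carrier R \<Longrightarrow> b \<in> carrier R \<Longrightarrow> (\<lambda>g. a g + b g) \<in> carrier R"
  by (auto simp: carrier_R intro!: F.add_in)

text \<open>The substitution sending \<open>h\<close> to \<open>inv h \<otimes> g\<close> is an
  involution of a commutative group and exchanges the two factors of the convolution.\<close>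

lemma R_mult_comm:
  assumes "a \<in> carrier R" "b \<in> carrier R"
  shows "a \<otimes>\<^bsub>R\<^esub> b = b \<otimes>\<^bsub>R\<^esub> a"
proof
  fix g
  have "(\<Sum>h\<in>carrier G. a h * b (inv h \<otimes> g)) = (\<Sum>h\<in>carrier G. b h * a (inv h \<otimes> g))"
    if g: "g \<in> carrier G"
  proof (rule sum.reindex_bij_witness[where i = "\<lambda>h. inv h \<otimes> g" and j = "\<lambda>h. inv h \<otimes> g"])
    fix h assume h: "h \<in> carrier G"
    have "inv (inv h \<otimes> g) \<otimes> g = inv g \<otimes> (h \<otimes> g)"
      using g h by (simp add: G.inv_mult_group G.m_assoc)
    also have "\<dots> = inv g \<otimes> (g \<otimes> h)"
      using g h by (simp only: G.m_comm)
    also have "\<dots> = h"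
      using g h by (simp add: G.m_assoc[symmetric])
    finally have *: "inv (inv h \<otimes> g) \<otimes> g = h" .
    show "inv (inv h \<otimes> g) \<otimes> g = h" "inv (inv h \<otimes> g) \<otimes> g = h" by (rule *)+
    show "inv h \<otimes> g \<in> carrier G" "inv h \<otimes> g \<in> carrier G"
      using g h by auto
    show "b (inv h \<otimes> g) * a (inv (inv h \<otimes> g) \<otimes> g) = a h * b (inv h \<otimes> g)"
      unfolding * by (simp add: mult.commute)
  qed
  then show "(a \<otimes>\<^bsub>R\<^esub> b) g = (b \<otimes>\<^bsub>R\<^esub> a) g"
    by (simp add: R_mult)
qed

lemma R_mult_assoc:
  assumes "a \<in> carrier R" "b \<in> carrier R" "c \<in> carrier R"
  shows "(a \<otimes>\<^bsub>R\<^esub> b) \<otimes>\<^bsub>R\<^esub> c = a \<otimes>\<^bsub>R\<^esub> (b \<otimes>\<^bsub>R\<^esub> c)"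
proof
  fix g
  have "(\<Sum>h\<in>carrier G. (\<Sum>l\<in>carrier G. a l * b (inv l \<otimes> h)) * c (inv h \<otimes> g)) =
      (\<Sum>h\<in>carrier G. a h * (\<Sum>l\<in>carrier G. b l * c (inv l \<otimes> (inv h \<otimes> g))))"
    if g: "g \<in> carrier G"
  proof -
    have "(\<Sum>h\<in>carrier G. (\<Sum>l\<in>carrier G. a l * b (inv l \<otimes> h)) * c (inv h \<otimes> g)) =
        (\<Sum>l\<in>carrier G. \<Sum>h\<in>carrier G. a l * b (inv l \<otimes> h) * c (inv h \<otimes> g))"
      by (subst sum.swap) (simp add: sum_distrib_right)
    also have "\<dots> = (\<Sum>l\<in>carrier G. \<Sum>m\<in>carrier G. a l * b m * c (inv m \<otimes> (inv l \<otimes> g)))"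
    proof (rule sum.cong[OF refl])
      fix l assume l: "l \<in> carrier G"
      show "(\<Sum>h\<in>carrier G. a l * b (inv l \<otimes> h) * c (inv h \<otimes> g)) =
          (\<Sum>m\<in>carrier G. a l * b m * c (inv m \<otimes> (inv l \<otimes> g)))"
      proof (rule sum.reindex_bij_witness[where i = "\<lambda>m. l \<otimes> m" and j = "\<lambda>h. inv l \<otimes> h"])
        fix h assume h: "h \<in> carrier G"
        show "l \<otimes> (inv l \<otimes> h) = h" "inv l \<otimes> (l \<otimes> h) = h"
          using l h by (simp_all add: G.m_assoc[symmetric])
        have "inv (inv l \<otimes> h) \<otimes> (inv l \<otimes> g) = inv h \<otimes> (l \<otimes> (inv l \<otimes> g))"
          using l h g by (simp add: G.inv_mult_group G.m_assoc)
        also have "\<dots> = inv h \<otimes> g"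
          using l h g by (simp add: G.m_assoc[symmetric, of l])
        finally show "a l * b (inv l \<otimes> h) * c (inv (inv l \<otimes> h) \<otimes> (inv l \<otimes> g)) =
            a l * b (inv l \<otimes> h) * c (inv h \<otimes> g)"
          by simp
      qed (use l in auto)
    qed
    also have "\<dots> = (\<Sum>l\<in>carrier G. a l * (\<Sum>m\<in>carrier G. b m * c (inv m \<otimes> (inv l \<otimes> g))))"
      by (simp add: sum_distrib_left mult.assoc)
    finally show ?thesis .
  qed
  then show "((a \<otimes>\<^bsub>R\<^esub> b) \<otimes>\<^bsub>R\<^esub> c) g = (a \<otimes>\<^bsub>R\<^esub> (b \<otimes>\<^bsub>R\<^esub> c)) g"
    by (simp add: R_mult)
qed

lemma R_one_mult: "a \<in> carrier R \<Longrightarrow> group_element \<one> \<otimes>\<^bsub>R\<^esub> a = a"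
proof
  fix g assume a: "a \<in> carrier R"
  have "(\<Sum>h\<in>carrier G. group_element \<one> h * a (inv h \<otimes> g)) = (\<Sum>h\<in>{\<one>}. group_element \<one> h * a (inv h \<otimes> g))"
    by (rule sum.mono_neutral_right) (auto simp: group_element_def)
  then show "(group_element \<one> \<otimes>\<^bsub>R\<^esub> a) g = a g"
    using R_outside[OF a] by (auto simp: R_mult group_element_def)
qed

lemma cring_R: "cring R"
proof (rule cringI)
  show "abelian_group R"
  proof (rule abelian_groupI)
    fix a assume a: "a \<in> carrier R"
    show "\<exists>b\<in>carrier R. b \<oplus>\<^bsub>R\<^esub> a = \<zero>\<^bsub>R\<^esub>"
      using a by (intro bexI[of _ "\<lambda>g. - a g"]) (auto simp: R_simps carrier_R intro: F.uminus_in)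
  qed (auto simp: R_simps R_add_closed ac_simps, simp add: carrier_R)
  show "comm_monoid R"
  proof (rule comm_monoidI)
    show "a \<otimes>\<^bsub>R\<^esub> b = b \<otimes>\<^bsub>R\<^esub> a" if "a \<in> carrier R" "b \<in> carrier R" for a b
      using that by (rule R_mult_comm)
  qed (simp_all add: R_simps(2) R_mult_closed R_mult_assoc group_element_in R_one_mult)
  fix a b c assume abc: "a \<in> carrier R" "b \<in> carrier R" "c \<in> carrier R"
  show "(a \<oplus>\<^bsub>R\<^esub> b) \<otimes>\<^bsub>R\<^esub> c = a \<otimes>\<^bsub>R\<^esub> c \<oplus>\<^bsub>R\<^esub> b \<otimes>\<^bsub>R\<^esub> c"
    by (auto simp: R_simps R_mult distrib_right sum.distrib)
qed

sublocale R: cring R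
  by (rule cring_R)

lemma R_minus: "a \<in> carrier R \<Longrightarrow> \<ominus>\<^bsub>R\<^esub> a = (\<lambda>g. - a g)"
  by (rule R.minus_equality) (auto simp: R_simps carrier_R intro: F.uminus_in)

lemma R_diff: "b \<in> carrier R \<Longrightarrow> a \<ominus>\<^bsub>R\<^esub> b = (\<lambda>g. a g - b g)"
  by (simp add: a_minus_def R_minus R_simps)

lemma R_scale_closed: "c \<in> F \<Longrightarrow> a \<in> carrier R \<Longrightarrow> (\<lambda>g. c * a g) \<in> carrier R"
  by (auto simp: carrier_R intro: F.mult_in)

text \<open>Scaling is multiplication by a multiple of the unit, which is why ideals of the group
  algebra are closed under scaling by \<open>F\<close>.\<close>

lemma R_scale:
  assumes "c \<in> F" "a \<in> carrier R"
  shows "(\<lambda>g. c * a g) = (\<lambda>g. c * group_element \<one> g) \<otimes>\<^bsub>R\<^esub> a"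
proof -
  have "(\<lambda>g. c * group_element \<one> g) \<otimes>\<^bsub>R\<^esub> a = (\<lambda>g. c * (group_element \<one> \<otimes>\<^bsub>R\<^esub> a) g)"
    by (auto simp: R_mult sum_distrib_left mult.assoc)
  then show ?thesis using R_one_mult[OF assms(2)] by simp
qed

lemma R_sum_closed: "(\<And>i. i \<in> A \<Longrightarrow> f i \<in> carrier R) \<Longrightarrow> (\<lambda>g. \<Sum>i\<in>A. f i g) \<in> carrier R"
  by (auto simp: carrier_R intro!: F.sum_in sum.neutral)

lemma ideal_scale_closed:
  assumes "ideal I R" "c \<in> F" "a \<in> I"
  shows "(\<lambda>g. c * a g) \<in> I"
proof -
  interpret I: ideal I R by fact
  have "a \<in> carrier R" using assms I.Icarr by blast
  then show ?thesis
    using R_scale[OF assms(2)] I.I_l_closed[OF assms(3)] R_scale_closed[OF assms(2) group_element_in]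
    by (metis G.one_closed)
qed

lemma ideal_sum_closed:
  assumes "ideal I R" "\<And>i. i \<in> A \<Longrightarrow> f i \<in> I"
  shows "(\<lambda>g. \<Sum>i\<in>A. f i g) \<in> I"
proof -
  interpret I: ideal I R by fact
  show ?thesis
    using assms(2)
  proof (induction A rule: infinite_finite_induct)
    case (insert x A)
    then have "f x \<oplus>\<^bsub>R\<^esub> (\<lambda>g. \<Sum>i\<in>A. f i g) \<in> I"
      by (intro I.a_closed) auto
    then show ?case
      using insert.hyps by (simp add: R_simps)
  qed (use I.zero_closed in \<open>auto simp: R_simps\<close>)
qed

text \<open>For fixed \<open>h\<close> the inner sum runs over a translate of the whole group, so it
  is the full coefficient sum of \<open>b\<close>. Hence the augmentation ideal is an ideal.\<close>

lemma augmentation_mult: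
  assumes "a \<in> carrier R" "b \<in> carrier R"
  shows "(\<Sum>g\<in>carrier G. (a \<otimes>\<^bsub>R\<^esub> b) g) = (\<Sum>g\<in>carrier G. a g) * (\<Sum>g\<in>carrier G. b g)"
proof -
  have "(\<Sum>g\<in>carrier G. (a \<otimes>\<^bsub>R\<^esub> b) g) = (\<Sum>h\<in>carrier G. \<Sum>g\<in>carrier G. a h * b (inv h \<otimes> g))"
    by (subst sum.swap) (simp add: R_mult)
  also have "\<dots> = (\<Sum>h\<in>carrier G. a h * (\<Sum>g\<in>carrier G. b g))"
  proof (rule sum.cong[OF refl])
    fix h assume h: "h \<in> carrier G"
    have "(\<Sum>g\<in>carrier G. a h * b (inv h \<otimes> g)) = (\<Sum>g\<in>carrier G. a h * b g)"
      by (rule sum.reindex_bij_witness[where i = "\<lambda>m. h \<otimes> m" and j = "\<lambda>g. inv h \<otimes> g"])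
        (use h in \<open>auto simp: G.m_assoc[symmetric]\<close>)
    then show "(\<Sum>g\<in>carrier G. a h * b (inv h \<otimes> g)) = a h * (\<Sum>g\<in>carrier G. b g)"
      by (simp add: sum_distrib_left)
  qed
  finally show ?thesis
    by (simp add: sum_distrib_right)
qed

lemma ideal_augmentation: "ideal (augmentation_ideal F G) R"
proof (rule idealI)
  show "ring R" ..
  show "subgroup (augmentation_ideal F G) (add_monoid R)"
  proof (rule R.add.subgroupI)
    show "augmentation_ideal F G \<noteq> {}"
      using R.zero_closed by (auto simp: augmentation_ideal_def R_simps)
    fix a assume a: "a \<in> augmentation_ideal F G"
    show "\<ominus>\<^bsub>R\<^esub> a \<in> augmentation_ideal F G"
      using a R.a_inv_closed[of a] R_minus[of a]
      by (auto simp: augmentation_ideal_def sum_negf)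
  qed (auto simp: augmentation_ideal_def R_simps R_add_closed sum.distrib)
qed (auto simp: augmentation_ideal_def augmentation_mult)

lemma augmentation_power_0: "augmentation_power F G 0 = carrier R"
  by (simp add: augmentation_power_def)

lemma augmentation_power_Suc:
  "augmentation_power F G (Suc k) = ideal_prod R (augmentation_ideal F G) (augmentation_power F G k)"
  by (simp add: augmentation_power_def)

lemma ideal_augmentation_power: "ideal (augmentation_power F G k) R"
proof (induction k)
  case 0 show ?case using R.oneideal by (simp add: augmentation_power_0)
next
  case (Suc k)
  then show ?case
    using R.ideal_prod_is_ideal[OF ideal_augmentation] by (simp add: augmentation_power_Suc)
qed

lemma augmentation_power_antimono:
  assumes "m \<le> n"
  shows "augmentation_power F G n \<subseteq> augmentation_power F G m"
  using assms
proof (rule lift_Suc_antimono_le[rotated])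
  show "augmentation_power F G (Suc k) \<subseteq> augmentation_power F G k" for k
    using R.ideal_prod_inter[OF ideal_augmentation ideal_augmentation_power]
    by (auto simp: augmentation_power_Suc)
qed

lemma truncated_class_mem: "a \<in> carrier R \<Longrightarrow> a \<in> truncated_class F G k a"
proof -
  interpret I: ideal "augmentation_power F G k" R by (rule ideal_augmentation_power)
  show "a \<in> carrier R \<Longrightarrow> a \<in> truncated_class F G k a"
    using I.a_rcos_self by (simp add: truncated_class_def)
qed

lemma truncated_class_iff:
  assumes "a \<in> carrier R"
  shows "x \<in> truncated_class F G k a \<longleftrightarrow>
    x \<in> carrier R \<and> (\<lambda>g. x g - a g) \<in> augmentation_power F G k"
proof -
  interpret I: ideal "augmentation_power F G k" R by (rule ideal_augmentation_power)
  have "x \<oplus>\<^bsub>R\<^esub> \<ominus>\<^bsub>R\<^esub> a = (\<lambda>g. x g - a g)"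
    using assms by (simp add: R_minus R_simps)
  then show ?thesis
    using I.a_rcos_module[OF assms, of x] I.a_elemrcos_carrier[OF assms, of x]
    unfolding truncated_class_def by argo
qed

lemma truncated_class_eq_iff:
  assumes "a \<in> carrier R" "b \<in> carrier R"
  shows "truncated_class F G k a = truncated_class F G k b \<longleftrightarrow>
    (\<lambda>g. a g - b g) \<in> augmentation_power F G k"
proof -
  interpret I: ideal "augmentation_power F G k" R by (rule ideal_augmentation_power)
  show ?thesis
    using truncated_class_mem[OF assms(1), of k] truncated_class_iff[OF assms(2), of a k]
      I.a_repr_independence'[of a b] assms
    unfolding truncated_class_def by auto
qed

lemma truncated_class_mult:
  assumes "a \<in> carrier R" "b \<in> carrier R"
  shows "truncated_class F G k a \<otimes>\<^bsub>truncated_algebra F G k\<^esub> truncated_class F G k b =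
    truncated_class F G k (a \<otimes>\<^bsub>R\<^esub> b)"
proof -
  interpret I: ideal "augmentation_power F G k" R by (rule ideal_augmentation_power)
  show ?thesis
    using I.rcoset_mult_add[OF assms]
    by (simp add: truncated_class_def truncated_algebra_def FactRing_def)
qed

lemma one_truncated_algebra:
  "\<one>\<^bsub>truncated_algebra F G k\<^esub> = truncated_class F G k (group_element \<one>)"
  by (simp add: truncated_class_def truncated_algebra_def FactRing_def R_simps)

lemma truncated_class_diff:
  assumes "a \<in> carrier R" "b \<in> carrier R"
  shows "truncated_class F G k a \<ominus>\<^bsub>truncated_algebra F G k\<^esub> truncated_class F G k b =
    truncated_class F G k (\<lambda>g. a g - b g)"
proof -
  interpret I: ideal "augmentation_power F G k" R by (rule ideal_augmentation_power)
  interpret H: ring_hom_ring R "R Quot augmentation_power F G k" "(+>\<^bsub>R\<^esub>) (augmentation_power F G k)"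
    by (rule I.rcos_ring_hom_ring)
  show ?thesis
    using H.hom_add[OF assms(1) R.a_inv_closed[OF assms(2)]] H.hom_a_inv[OF assms(2)] R_diff[OF assms(2), of a]
    unfolding truncated_class_def truncated_algebra_def a_minus_def by simp
qed

lemma truncated_power_in:
  assumes "a \<in> carrier R" "w \<in> F"
  shows "truncated_power p F G a w \<in> carrier R"
proof -
  have "(\<lambda>g. \<Sum>i<p. (field_binomial w i * ((a \<ominus>\<^bsub>R\<^esub> \<one>\<^bsub>R\<^esub>) [^]\<^bsub>R\<^esub> i) g)) \<in> carrier R"
    using assms by (intro R_sum_closed R_scale_closed F.field_binomial_in) auto
  then show ?thesis by (simp add: truncated_power_def)
qed

end

section \<open>Groups of field automorphisms\<close>

context type_subfield
begin

lemma galois_group_iff: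
  "\<sigma> \<in> carrier (galois_group K) \<longleftrightarrow>
    bij \<sigma> \<and> (\<forall>x y. \<sigma> (x + y) = \<sigma> x + \<sigma> y) \<and> (\<forall>x y. \<sigma> (x * y) = \<sigma> x * \<sigma> y) \<and> (\<forall>x\<in>K. \<sigma> x = x)"
proof -
  have "\<sigma> \<in> ring_iso ring_of_type_algebra ring_of_type_algebra \<longleftrightarrow>
      bij \<sigma> \<and> \<sigma> 1 = 1 \<and> (\<forall>x y. \<sigma> (x + y) = \<sigma> x + \<sigma> y) \<and> (\<forall>x y. \<sigma> (x * y) = \<sigma> x * \<sigma> y)"
    by (simp add: ring_iso_def ring_hom_def all_conj_distrib conj_ac)
  moreover have "\<sigma> 1 = 1" if "\<forall>x\<in>K. \<sigma> x = x"
    using one_in that by blast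
  ultimately show ?thesis
    unfolding galois_group_def by auto
qed

lemma galois_group_mult [simp]: "\<sigma> \<otimes>\<^bsub>galois_group K\<^esub> \<tau> = \<sigma> \<circ> \<tau>"
  and galois_group_one [simp]: "\<one>\<^bsub>galois_group K\<^esub> = id"
  by (simp_all add: galois_group_def)

lemma group_galois_group: "group (galois_group K)"
proof (rule groupI)
  fix \<sigma> assume \<sigma>: "\<sigma> \<in> carrier (galois_group K)"
  then have \<sigma>': "bij \<sigma>" and add: "\<And>x y. \<sigma> (x + y) = \<sigma> x + \<sigma> y"
    and mult: "\<And>x y. \<sigma> (x * y) = \<sigma> x * \<sigma> y" and fix_K: "\<And>x. x \<in> K \<Longrightarrow> \<sigma> x = x"
    by (auto simp: galois_group_iff)
  have inv: "\<sigma> (inv_into UNIV \<sigma> x) = x" "inv_into UNIV \<sigma> (\<sigma> x) = x" for x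
    using \<sigma>' by (simp_all add: bij_is_inj bij_is_surj surj_f_inv_f)
  have "inv_into UNIV \<sigma> \<in> carrier (galois_group K)"
    unfolding galois_group_iff
  proof (intro conjI allI ballI)
    show "bij (inv_into UNIV \<sigma>)"
      using \<sigma>' by (rule bij_imp_bij_inv)
    show "inv_into UNIV \<sigma> (x + y) = inv_into UNIV \<sigma> x + inv_into UNIV \<sigma> y" for x y
      by (metis add inv)
    show "inv_into UNIV \<sigma> (x * y) = inv_into UNIV \<sigma> x * inv_into UNIV \<sigma> y" for x y
      by (metis mult inv)
    show "inv_into UNIV \<sigma> x = x" if "x \<in> K" for x
      by (metis fix_K that inv(2))
  qed
  moreover have "inv_into UNIV \<sigma> \<circ> \<sigma> = id"
    by (auto simp: inv)
  ultimately show "\<exists>\<tau>\<in>carrier (galois_group K). \<tau> \<otimes>\<^bsub>galois_group K\<^esub> \<sigma> = \<one>\<^bsub>galois_group K\<^esub>"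
    by auto
next
  fix \<sigma> \<tau> assume "\<sigma> \<in> carrier (galois_group K)" "\<tau> \<in> carrier (galois_group K)"
  then show "\<sigma> \<otimes>\<^bsub>galois_group K\<^esub> \<tau> \<in> carrier (galois_group K)"
    using bij_comp[of \<tau> \<sigma>] by (simp add: galois_group_iff)
qed (simp_all add: galois_group_iff comp_assoc)

lemma galois_sum:
  assumes "\<sigma> \<in> carrier (galois_group K)"
  shows "\<sigma> (sum f A) = (\<Sum>i\<in>A. \<sigma> (f i))"
  using assms by (induction A rule: infinite_finite_induct) (auto simp: galois_group_iff)

lemma galois_diff:
  assumes "\<sigma> \<in> carrier (galois_group K)"
  shows "\<sigma> (x - y) = \<sigma> x - \<sigma> y"
proof -
  have "\<sigma> (x - y) + \<sigma> y = \<sigma> x"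
    using assms by (metis galois_group_iff diff_add_cancel)
  then show ?thesis by (simp add: algebra_simps)
qed

lemma galois_power:
  assumes "\<sigma> \<in> carrier (galois_group K)"
  shows "\<sigma> (x ^ n) = \<sigma> x ^ n"
  using assms by (induction n) (auto simp: galois_group_iff)

lemma galois_prod:
  assumes "\<sigma> \<in> carrier (galois_group K)"
  shows "\<sigma> (prod f A) = (\<Prod>i\<in>A. \<sigma> (f i))"
  using assms by (induction A rule: infinite_finite_induct) (auto simp: galois_group_iff)

lemma galois_divide:
  assumes "\<sigma> \<in> carrier (galois_group K)"
  shows "\<sigma> (x / y) = \<sigma> x / \<sigma> y"
proof (cases "y = 0")
  case True
  then show ?thesis
    using galois_sum[OF assms, of _ "{}"] by simp
next
  case False
  have "\<sigma> (inverse y) * \<sigma> y = \<sigma> (inverse y * y)"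
    using assms by (simp add: galois_group_iff)
  also have "\<dots> = 1"
    using False assms by (simp add: galois_group_iff)
  finally have "\<sigma> (inverse y) = inverse (\<sigma> y)"
    by (metis inverse_unique mult.commute)
  then show ?thesis
    using assms by (simp add: galois_group_iff divide_inverse)
qed

lemma galois_field_binomial:
  assumes "\<sigma> \<in> carrier (galois_group K)"
  shows "\<sigma> (field_binomial x n) = field_binomial (\<sigma> x) n"
proof -
  have "\<sigma> (of_nat m) = of_nat m" for m
    using assms by (simp add: galois_group_iff)
  then show ?thesis
    by (simp add: field_binomial_def galois_divide[OF assms] galois_prod[OF assms] galois_diff[OF assms]
        del: of_nat_fact)
qed

end

text \<open>Subtracting \<open>h z\<close> times the relation at \<open>y\<close> from the relation
  at \<open>z * y\<close> removes the term of \<open>h\<close>. By induction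
  \<open>a g' * (g' z - h z) = 0\<close>, and \<open>z\<close> is chosen to make the second factor
  nonzero.\<close>

lemma dedekind_independence:
  fixes a :: "('l::field \<Rightarrow> 'l) \<Rightarrow> 'l"
  assumes "finite S" "\<And>g. g \<in> S \<Longrightarrow> g 1 = 1" "\<And>g x y. g \<in> S \<Longrightarrow> g (x * y) = g x * g y"
    and "\<And>y. (\<Sum>g\<in>S. a g * g y) = 0" and "g \<in> S"
  shows "a g = 0"
  using assms
proof (induction S arbitrary: a g rule: finite_induct)
  case (insert h S)
  have S: "a g' = 0" if g': "g' \<in> S" for g'
  proof -
    obtain z where z: "g' z \<noteq> h z"
      using insert.hyps g' by (metis ext)
    have "(\<Sum>g\<in>S. (a g * (g z - h z)) * g y) = 0" for y
    proof -
      have "(\<Sum>g\<in>S. (a g * (g z - h z)) * g y) =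
          (\<Sum>g\<in>insert h S. a g * g (z * y)) - h z * (\<Sum>g\<in>insert h S. a g * g y)"
        using insert.hyps
        by (simp add: insert.prems(2) algebra_simps sum_distrib_left sum_subtractf)
      then show ?thesis using insert.prems(3) by simp
    qed
    then have "a g' * (g' z - h z) = 0"
      using insert.IH[of "\<lambda>g. a g * (g z - h z)" g'] g' insert.prems by auto
    then show ?thesis using z by simp
  qed
  moreover have "a h = 0"
    using insert.prems(3)[of 1] insert.hyps S insert.prems(1)[of h] by simp
  ultimately show ?case
    using insert.prems(4) by blast
qed simp

lemma sum_lessThan_if_le_extend:
  fixes f :: "nat \<Rightarrow> 'a::comm_monoid_add"
  assumes "u < p" "\<And>i. u < i \<Longrightarrow> f i = 0"
  shows "(\<Sum>i\<le>u. f i) = (\<Sum>i<p. f i)"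
  by (rule sum.mono_neutral_left) (use assms in auto)

section \<open>The bicyclic extension and the action of F[G] on L\<close>

locale bicyclic = prime_char p "TYPE('l::field)" + K: type_subfield K + F: type_subfield F
  for p :: nat and K F :: "'l::field set" +
  fixes \<sigma>1 \<sigma>2 :: "'l \<Rightarrow> 'l" and x1 x2 :: 'l
  assumes F_sub_K: "F \<subseteq> K"
    and \<sigma>1: "\<sigma>1 \<in> carrier (galois_group K)" and \<sigma>2: "\<sigma>2 \<in> carrier (galois_group K)"
    and galois_elements: "g \<in> carrier (galois_group K) \<Longrightarrow> \<exists>i<p. \<exists>j<p. g = \<sigma>1 ^^ i \<circ> \<sigma>2 ^^ j"
    and fixed_field: "(\<And>g. g \<in> carrier (galois_group K) \<Longrightarrow> g x = x) \<Longrightarrow> x \<in> K"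
    and \<sigma>_x: "\<sigma>1 x1 = x1 + 1" "\<sigma>1 x2 = x2" "\<sigma>2 x1 = x1" "\<sigma>2 x2 = x2 + 1"
    and \<sigma>_commute: "\<sigma>1 (\<sigma>2 y) = \<sigma>2 (\<sigma>1 y)"
begin

abbreviation "G \<equiv> galois_group K"

lemma \<sigma>_pow_commute: "(\<sigma>1 ^^ i) ((\<sigma>2 ^^ j) y) = (\<sigma>2 ^^ j) ((\<sigma>1 ^^ i) y)"
proof -
  have "\<sigma>1 ((\<sigma>2 ^^ j) y) = (\<sigma>2 ^^ j) (\<sigma>1 y)" for y
    by (induction j arbitrary: y) (auto simp: \<sigma>_commute)
  then show ?thesis
    by (induction i arbitrary: y) auto
qed

sublocale G: comm_group "galois_group K"
proof (intro group.group_comm_groupI K.group_galois_group)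
  fix g h assume "g \<in> carrier G" "h \<in> carrier G"
  then obtain i j i' j' where gh: "g = \<sigma>1 ^^ i \<circ> \<sigma>2 ^^ j" "h = \<sigma>1 ^^ i' \<circ> \<sigma>2 ^^ j'"
    using galois_elements by meson
  have swap: "(f ^^ m) ((f ^^ n) y) = (f ^^ n) ((f ^^ m) y)" for f :: "'l \<Rightarrow> 'l" and m n y
    by (metis add.commute comp_apply funpow_add)
  have "g (h y) = h (g y)" for y
  proof -
    have "g (h y) = (\<sigma>1 ^^ i) ((\<sigma>1 ^^ i') ((\<sigma>2 ^^ j) ((\<sigma>2 ^^ j') y)))"
      by (simp add: gh \<sigma>_pow_commute)
    also have "\<dots> = (\<sigma>1 ^^ i') ((\<sigma>1 ^^ i) ((\<sigma>2 ^^ j') ((\<sigma>2 ^^ j) y)))"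
      by (metis swap)
    also have "\<dots> = h (g y)"
      by (simp add: gh \<sigma>_pow_commute)
    finally show ?thesis .
  qed
  then show "g \<otimes>\<^bsub>G\<^esub> h = h \<otimes>\<^bsub>G\<^esub> g"
    by (simp add: fun_eq_iff)
qed

lemma finite_galois_group: "finite (carrier G)"
proof (rule finite_subset)
  show "carrier G \<subseteq> (\<lambda>(i, j). \<sigma>1 ^^ i \<circ> \<sigma>2 ^^ j) ` ({..<p} \<times> {..<p})"
    using galois_elements by fastforce
qed auto

sublocale finite_group_algebra "galois_group K" F
  by unfold_locales (rule finite_galois_group)

abbreviation "act \<equiv> algebra_action (galois_group K)"

lemma galois_apply:
  assumes "g \<in> carrier G"
  shows "g (x + y) = g x + g y" "g (x * y) = g x * g y" "c \<in> K \<Longrightarrow> g c = c" "c \<in> F \<Longrightarrow> g c = c"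
    "g 0 = 0" "g 1 = 1" "g (of_nat n) = of_nat n"
  using assms F_sub_K by (auto simp: K.galois_group_iff)

lemma act_add: "act a (x + y) = act a x + act a y"
  by (simp add: algebra_action_def galois_apply distrib_left sum.distrib)

lemma act_scale: "c \<in> K \<Longrightarrow> act a (c * y) = c * act a y"
  by (simp add: algebra_action_def galois_apply sum_distrib_left mult_ac)

lemma act_zero [simp]: "act a 0 = 0"
  by (simp add: algebra_action_def galois_apply)

lemma act_sum: "act a (sum f A) = (\<Sum>i\<in>A. act a (f i))"
  by (induction A rule: infinite_finite_induct) (auto simp: act_add)

lemma act_group_element:
  assumes "g \<in> carrier G"
  shows "act (group_element g) y = g y"
proof -
  have "act (group_element g) y = (\<Sum>h\<in>{g}. group_element g h * h y)"
    unfolding algebra_action_def by (rule sum.mono_neutral_right) (use assms in \<open>auto simp: group_element_def\<close>)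
  then show ?thesis by (simp add: group_element_def)
qed

lemma act_one: "act \<one>\<^bsub>R\<^esub> y = y"
  using act_group_element[OF G.one_closed] by (simp add: R_simps)

lemma act_pointwise:
  "act (\<lambda>g. a g + b g) y = act a y + act b y"
  "act (\<lambda>g. a g - b g) y = act a y - act b y"
  "act (\<lambda>g. c * a g) y = c * act a y"
  by (simp_all add: algebra_action_def distrib_right left_diff_distrib sum.distrib sum_subtractf
      sum_distrib_left mult.assoc)

lemma act_pointwise_sum: "act (\<lambda>g. \<Sum>i\<in>A. f i g) y = (\<Sum>i\<in>A. act (f i) y)"
proof (induction A rule: infinite_finite_induct)
  case (insert i A)
  then show ?case by (simp add: act_pointwise)
qed (simp_all add: algebra_action_def)

lemma act_minus_one: "act (a \<ominus>\<^bsub>R\<^esub> \<one>\<^bsub>R\<^esub>) y = act a y - y"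
  using act_one[of y] by (simp add: R_diff act_pointwise)

text \<open>Coefficients in \<open>F \<subseteq> K\<close> are fixed by \<open>G\<close> and pass
  through the automorphisms, so convolution becomes composition of operators.\<close>

lemma act_mult:
  assumes "a \<in> carrier R" "b \<in> carrier R"
  shows "act (a \<otimes>\<^bsub>R\<^esub> b) y = act a (act b y)"
proof -
  have "act (a \<otimes>\<^bsub>R\<^esub> b) y = (\<Sum>h\<in>carrier G. \<Sum>g\<in>carrier G. a h * b (inv\<^bsub>G\<^esub> h \<otimes>\<^bsub>G\<^esub> g) * g y)"
    unfolding algebra_action_def by (subst sum.swap) (simp add: R_mult sum_distrib_right)
  also have "\<dots> = (\<Sum>h\<in>carrier G. \<Sum>g\<in>carrier G. a h * (b g * h (g y)))"
  proof (rule sum.cong[OF refl])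
    fix h assume h: "h \<in> carrier G"
    show "(\<Sum>g\<in>carrier G. a h * b (inv\<^bsub>G\<^esub> h \<otimes>\<^bsub>G\<^esub> g) * g y) = (\<Sum>g\<in>carrier G. a h * (b g * h (g y)))"
    proof (rule sum.reindex_bij_witness[where i = "\<lambda>m. h \<otimes>\<^bsub>G\<^esub> m" and j = "\<lambda>g. inv\<^bsub>G\<^esub> h \<otimes>\<^bsub>G\<^esub> g"])
      fix g assume g: "g \<in> carrier G"
      have "h \<otimes>\<^bsub>G\<^esub> (inv\<^bsub>G\<^esub> h \<otimes>\<^bsub>G\<^esub> g) = g"
        using h g by (simp add: G.m_assoc[symmetric] del: K.galois_group_mult K.galois_group_one)
      then show "h \<otimes>\<^bsub>G\<^esub> (inv\<^bsub>G\<^esub> h \<otimes>\<^bsub>G\<^esub> g) = g"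
        "a h * (b (inv\<^bsub>G\<^esub> h \<otimes>\<^bsub>G\<^esub> g) * h ((inv\<^bsub>G\<^esub> h \<otimes>\<^bsub>G\<^esub> g) y)) = a h * b (inv\<^bsub>G\<^esub> h \<otimes>\<^bsub>G\<^esub> g) * g y"
        by (auto simp: fun_eq_iff)
      show "inv\<^bsub>G\<^esub> h \<otimes>\<^bsub>G\<^esub> (h \<otimes>\<^bsub>G\<^esub> g) = g"
        using h g by (simp add: G.m_assoc[symmetric] del: K.galois_group_mult K.galois_group_one)
      show "inv\<^bsub>G\<^esub> h \<otimes>\<^bsub>G\<^esub> g \<in> carrier G" "h \<otimes>\<^bsub>G\<^esub> g \<in> carrier G"
        using h g by (simp_all del: K.galois_group_mult)
    qed
  qed
  also have "\<dots> = act a (act b y)"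
    unfolding algebra_action_def
    by (intro sum.cong refl)
      (simp add: K.galois_sum galois_apply R_closedD[OF assms(2)] sum_distrib_left)
  finally show ?thesis .
qed

lemma act_pow:
  assumes "a \<in> carrier R"
  shows "act (a [^]\<^bsub>R\<^esub> (n::nat)) y = (act a ^^ n) y"
proof (induction n arbitrary: y)
  case 0 show ?case by (simp add: act_one)
next
  case (Suc n)
  then show ?case
    using assms by (simp add: act_mult funpow_swap1)
qed

lemma act_truncated_power:
  assumes "a \<in> carrier R"
  shows "act (truncated_power p F G a w) y = (\<Sum>i<p. field_binomial w i * ((\<lambda>y. act a y - y) ^^ i) y)"
proof -
  have "act ((a \<ominus>\<^bsub>R\<^esub> \<one>\<^bsub>R\<^esub>) [^]\<^bsub>R\<^esub> i) y = ((\<lambda>y. act a y - y) ^^ i) y" for i :: nat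
  proof -
    have "act (a \<ominus>\<^bsub>R\<^esub> \<one>\<^bsub>R\<^esub>) = (\<lambda>y. act a y - y)"
      by (auto simp: act_minus_one)
    then show ?thesis
      using assms by (simp add: act_pow)
  qed
  then show ?thesis
    unfolding truncated_power_def by (simp add: act_pointwise_sum act_pointwise)
qed

text \<open>Independence of the automorphisms makes the action faithful, so identities in the group
  algebra may be checked as identities of operators.\<close>

lemma act_inj:
  assumes "a \<in> carrier R" "b \<in> carrier R" "\<And>y. act a y = act b y"
  shows "a = b"
proof
  fix g
  show "a g = b g"
  proof (cases "g \<in> carrier G")
    case True
    have "a g - b g = 0"
    proof (rule dedekind_independence[where S = "carrier G" and a = "\<lambda>g. a g - b g"])
      show "(\<Sum>g\<in>carrier G. (a g - b g) * g y) = 0" for y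
        using assms(3)[of y] by (simp add: algebra_action_def left_diff_distrib sum_subtractf)
    qed (use True in \<open>auto simp: galois_apply\<close>)
    then show ?thesis by simp
  qed (simp add: R_outside assms)
qed

definition X1 :: "'l \<Rightarrow> 'l" where "X1 y = \<sigma>1 y - y"
definition X2 :: "'l \<Rightarrow> 'l" where "X2 y = \<sigma>2 y - y"

definition monom_R :: "nat \<Rightarrow> nat \<Rightarrow> ('l \<Rightarrow> 'l) \<Rightarrow> 'l" where
  "monom_R i j = ((group_element \<sigma>1 \<ominus>\<^bsub>R\<^esub> \<one>\<^bsub>R\<^esub>) [^]\<^bsub>R\<^esub> i) \<otimes>\<^bsub>R\<^esub> ((group_element \<sigma>2 \<ominus>\<^bsub>R\<^esub> \<one>\<^bsub>R\<^esub>) [^]\<^bsub>R\<^esub> j)"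

lemma monom_R_in: "monom_R i j \<in> carrier R"
  by (simp add: monom_R_def group_element_in \<sigma>1 \<sigma>2)

lemma act_monom_R: "act (monom_R i j) y = (X1 ^^ i) ((X2 ^^ j) y)"
proof -
  have "act (group_element \<sigma>1 \<ominus>\<^bsub>R\<^esub> \<one>\<^bsub>R\<^esub>) = X1" "act (group_element \<sigma>2 \<ominus>\<^bsub>R\<^esub> \<one>\<^bsub>R\<^esub>) = X2"
    by (auto simp: act_minus_one act_group_element \<sigma>1 \<sigma>2 X1_def X2_def)
  then show ?thesis
    by (simp add: monom_R_def act_mult act_pow group_element_in \<sigma>1 \<sigma>2)
qed

lemma group_element_minus_one_in:
  assumes "g \<in> carrier G"
  shows "group_element g \<ominus>\<^bsub>R\<^esub> \<one>\<^bsub>R\<^esub> \<in> augmentation_ideal F G"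
proof -
  have "(\<Sum>h\<in>carrier G. group_element g h) = (\<Sum>h\<in>{g}. group_element g h :: 'l)" if "g \<in> carrier G" for g
    by (rule sum.mono_neutral_right) (use that in \<open>auto simp: group_element_def\<close>)
  then have s: "(\<Sum>h\<in>carrier G. group_element g h) = (1::'l)" if "g \<in> carrier G" for g
    using that by (simp add: group_element_def)
  have "group_element g \<ominus>\<^bsub>R\<^esub> \<one>\<^bsub>R\<^esub> \<in> carrier R"
    using assms by (simp add: group_element_in)
  then show ?thesis
    using s[OF assms] s[OF G.one_closed] group_element_in[OF G.one_closed]
    by (simp add: augmentation_ideal_def R_diff sum_subtractf R_simps(2))
qed

lemma monom_R_in_power: "monom_R i j \<in> augmentation_power F G (i + j)"
proof (induction i)
  case 0
  show ?case
  proof (induction j)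
    case 0
    show ?case by (simp add: monom_R_def augmentation_power_0)
  next
    case (Suc j)
    let ?a = "group_element \<sigma>2 \<ominus>\<^bsub>R\<^esub> \<one>\<^bsub>R\<^esub>"
    have a: "?a \<in> carrier R" by (simp add: group_element_in \<sigma>2)
    have "monom_R 0 (Suc j) = ?a \<otimes>\<^bsub>R\<^esub> monom_R 0 j"
      using a by (simp add: monom_R_def R.m_comm)
    then show ?case
      using Suc ideal_prod.prod[OF group_element_minus_one_in[OF \<sigma>2]]
      by (simp add: augmentation_power_Suc)
  qed
next
  case (Suc i)
  let ?a = "group_element \<sigma>1 \<ominus>\<^bsub>R\<^esub> \<one>\<^bsub>R\<^esub>"
  have a: "?a \<in> carrier R" "group_element \<sigma>2 \<ominus>\<^bsub>R\<^esub> \<one>\<^bsub>R\<^esub> \<in> carrier R"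
    by (simp_all add: group_element_in \<sigma>1 \<sigma>2)
  have "monom_R (Suc i) j = ?a \<otimes>\<^bsub>R\<^esub> monom_R i j"
    using a by (simp add: monom_R_def R.m_comm R.m_lcomm)
  then show ?case
    using Suc ideal_prod.prod[OF group_element_minus_one_in[OF \<sigma>1]]
    by (simp add: augmentation_power_Suc)
qed

text \<open>Newton's formula for both generators. Since \<open>u, v < p\<close>, the sums can be
  padded with zeros to a common range that does not depend on \<open>u\<close> and
  \<open>v\<close>.\<close>

lemma \<sigma>_pow_eq_sum:
  assumes "u < p" "v < p"
  shows "(\<sigma>1 ^^ u) ((\<sigma>2 ^^ v) y) =
    (\<Sum>i<p. \<Sum>j<p. of_nat (u choose i) * of_nat (v choose j) * (X1 ^^ i) ((X2 ^^ j) y))"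
proof -
  have X: "X1 = (\<lambda>y. \<sigma>1 y - y)" "X2 = (\<lambda>y. \<sigma>2 y - y)"
    by (auto simp: X1_def X2_def)
  have 1: "(\<sigma>1 ^^ u) z = (\<Sum>i<p. of_nat (u choose i) * (X1 ^^ i) z)" for z
    unfolding X
    by (subst iterate_eq_sum_differences)
      (auto simp: galois_apply \<sigma>1 binomial_eq_0 intro!: sum_lessThan_if_le_extend assms)
  have 2: "(\<sigma>2 ^^ v) z = (\<Sum>i<p. of_nat (v choose i) * (X2 ^^ i) z)" for z
    unfolding X
    by (subst iterate_eq_sum_differences)
      (auto simp: galois_apply \<sigma>2 binomial_eq_0 intro!: sum_lessThan_if_le_extend assms)
  have lin: "(X1 ^^ i) (\<Sum>j<n. of_nat (c j) * f j) = (\<Sum>j<n. of_nat (c j) * (X1 ^^ i) (f j))" for i c f n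
  proof -
    have "(X1 ^^ i) y = act (monom_R i 0) y" for y
      by (simp add: act_monom_R)
    then show ?thesis
      by (simp add: act_sum act_scale)
  qed
  show ?thesis
    unfolding 1 2 lin by (simp add: sum_distrib_left mult.assoc)
qed

text \<open>Newton's formula expands each group element in the monomials with integral coefficients,
  and \<open>act_inj\<close> transfers the identity from operators to \<open>F[G]\<close>.\<close>

lemma R_expansion:
  assumes "a \<in> carrier R"
  obtains c where "\<And>i j. c i j \<in> F" "a = (\<lambda>g. \<Sum>i<p. \<Sum>j<p. c i j * monom_R i j g)"
proof -
  obtain u v where uv: "\<And>g. g \<in> carrier G \<Longrightarrow> u g < p \<and> v g < p \<and> g = \<sigma>1 ^^ u g \<circ> \<sigma>2 ^^ v g"
    using galois_elements by metis
  define c where "c i j = (\<Sum>g\<in>carrier G. a g * (of_nat (u g choose i) * of_nat (v g choose j)))" for i j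
  have c: "c i j \<in> F" for i j
    unfolding c_def by (intro F.sum_in F.mult_in F.of_nat_in R_closedD[OF assms])
  moreover have "a = (\<lambda>g. \<Sum>i<p. \<Sum>j<p. c i j * monom_R i j g)"
  proof (rule act_inj[OF assms])
    show "(\<lambda>g. \<Sum>i<p. \<Sum>j<p. c i j * monom_R i j g) \<in> carrier R"
      by (intro R_sum_closed R_scale_closed monom_R_in c)
    fix y
    have "act a y = (\<Sum>g\<in>carrier G. a g * (\<Sum>i<p. \<Sum>j<p. of_nat (u g choose i) * of_nat (v g choose j) * (X1 ^^ i) ((X2 ^^ j) y)))"
      unfolding algebra_action_def
      by (intro sum.cong refl, subst \<sigma>_pow_eq_sum[symmetric]) (use uv in \<open>auto simp: fun_eq_iff\<close>)
    also have "\<dots> = (\<Sum>i<p. \<Sum>j<p. c i j * (X1 ^^ i) ((X2 ^^ j) y))"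
      unfolding c_def sum_distrib_left sum_distrib_right
      by (subst sum.swap, intro sum.cong refl, subst sum.swap) (simp add: mult.assoc)
    finally show "act a y = act (\<lambda>g. \<Sum>i<p. \<Sum>j<p. c i j * monom_R i j g) y"
      by (simp add: act_pointwise_sum act_pointwise act_monom_R)
  qed
  ultimately show ?thesis using that by blast
qed

end

section \<open>Classes as translations\<close>

context bicyclic
begin

definition bin2 :: "nat \<Rightarrow> nat \<Rightarrow> 'l" where
  "bin2 i j = field_binomial x1 i * field_binomial x2 j"

lemma bin2_0_0 [simp]: "bin2 0 0 = 1"
  by (simp add: bin2_def)

lemma X1_bin2: "i < p \<Longrightarrow> X1 (bin2 i j) = (if i = 0 then 0 else bin2 (i - 1) j)"
  using field_binomial_pascal[of "i - 1" x1]
  by (cases i) (auto simp: X1_def bin2_def galois_apply[OF \<sigma>1] K.galois_field_binomial[OF \<sigma>1] \<sigma>_x algebra_simps)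

lemma X2_bin2: "j < p \<Longrightarrow> X2 (bin2 i j) = (if j = 0 then 0 else bin2 i (j - 1))"
  using field_binomial_pascal[of "j - 1" x2]
  by (cases j) (auto simp: X2_def bin2_def galois_apply[OF \<sigma>2] K.galois_field_binomial[OF \<sigma>2] \<sigma>_x algebra_simps)

lemma X_zero [simp]: "X1 0 = 0" "X2 0 = 0"
  by (simp_all add: X1_def X2_def galois_apply[OF \<sigma>1] galois_apply[OF \<sigma>2])

lemma X_add: "X1 (x + y) = X1 x + X1 y" "X2 (x + y) = X2 x + X2 y"
  by (simp_all add: X1_def X2_def galois_apply[OF \<sigma>1] galois_apply[OF \<sigma>2])

lemma X_scale: "c \<in> K \<Longrightarrow> X1 (c * y) = c * X1 y" "c \<in> K \<Longrightarrow> X2 (c * y) = c * X2 y"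
  by (simp_all add: X1_def X2_def galois_apply[OF \<sigma>1] galois_apply[OF \<sigma>2] right_diff_distrib)

text \<open>The monomials act on these products by subtracting exponents. This makes the two
  families dual: on \<open>bin2 i j\<close> the monomial with exponents \<open>(i, j)\<close> gives
  \<open>1\<close>, and it gives \<open>0\<close> when an exponent is too large.\<close>

lemma X_pow_bin2:
  assumes "i < p" "j < p"
  shows "(X1 ^^ a) ((X2 ^^ b) (bin2 i j)) = (if a \<le> i \<and> b \<le> j then bin2 (i - a) (j - b) else 0)"
proof -
  have 2: "(X2 ^^ b) (bin2 i j) = (if b \<le> j then bin2 i (j - b) else 0)" for b
    using assms by (induction b) (auto simp: X2_bin2 diff_Suc split: nat.splits)
  have "(X1 ^^ a) (bin2 i j') = (if a \<le> i then bin2 (i - a) j' else 0)" for a j'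
    using assms by (induction a) (auto simp: X1_bin2 diff_Suc split: nat.splits)
  moreover have "(X1 ^^ a) 0 = 0"
    by (induction a) auto
  ultimately show ?thesis
    by (simp add: 2)
qed

text \<open>For \<open>n \<le> p\<close> this is the space of polynomials over \<open>K\<close> in
  \<open>x1\<close>, \<open>x2\<close> of total degree below \<open>n\<close>; at
  \<open>n = 0\<close> it is zero.\<close>

inductive_set poly_space :: "nat \<Rightarrow> 'l set" for n where
  zero: "0 \<in> poly_space n"
| add: "y \<in> poly_space n \<Longrightarrow> i + j < n \<Longrightarrow> i < p \<Longrightarrow> j < p \<Longrightarrow> c \<in> K \<Longrightarrow> c * bin2 i j + y \<in> poly_space n"

lemma bin2_in_poly_space: "i + j < n \<Longrightarrow> i < p \<Longrightarrow> j < p \<Longrightarrow> bin2 i j \<in> poly_space n"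
  using poly_space.add[OF poly_space.zero, of i j n 1] by simp

lemma poly_space_add: "y \<in> poly_space n \<Longrightarrow> z \<in> poly_space n \<Longrightarrow> y + z \<in> poly_space n"
  by (induction rule: poly_space.induct) (auto simp: add.assoc intro: poly_space.add)

lemma poly_space_scale: "y \<in> poly_space n \<Longrightarrow> c \<in> K \<Longrightarrow> c * y \<in> poly_space n"
  by (induction rule: poly_space.induct)
    (auto simp: distrib_left mult.assoc[symmetric] intro: poly_space.intros K.mult_in)

lemma poly_space_mono: "y \<in> poly_space m \<Longrightarrow> m \<le> n \<Longrightarrow> y \<in> poly_space n"
  by (induction rule: poly_space.induct) (auto intro: poly_space.intros)

lemma poly_space_0: "y \<in> poly_space 0 \<Longrightarrow> y = 0"
  by (induction rule: poly_space.induct) auto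

lemma poly_space_sum: "(\<And>i. i \<in> A \<Longrightarrow> f i \<in> poly_space n) \<Longrightarrow> sum f A \<in> poly_space n"
  by (induction A rule: infinite_finite_induct) (auto intro: poly_space_add poly_space.zero)

lemma X_poly_space:
  assumes "y \<in> poly_space n"
  shows "X1 y \<in> poly_space (n - 1)" "X2 y \<in> poly_space (n - 1)"
proof -
  have "X1 y \<in> poly_space (n - 1) \<and> X2 y \<in> poly_space (n - 1)"
    using assms
  proof (induction rule: poly_space.induct)
    case (add y i j c)
    have "X1 (bin2 i j) \<in> poly_space (n - 1)" "X2 (bin2 i j) \<in> poly_space (n - 1)"
      using add by (auto simp: X1_bin2 X2_bin2 intro!: poly_space.zero bin2_in_poly_space)
    then show ?case
      using add by (simp add: X_add X_scale poly_space_add poly_space_scale)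
  qed (auto intro: poly_space.zero)
  then show "X1 y \<in> poly_space (n - 1)" "X2 y \<in> poly_space (n - 1)"
    by auto
qed

text \<open>The identity \<open>gh - 1 = (g - 1) h + (h - 1)\<close> passes the property to
  compositions, so the generators suffice, and for them it is \<open>X_poly_space\<close>.\<close>

lemma galois_minus_one_poly_space:
  assumes "g \<in> carrier G" "y \<in> poly_space n"
  shows "g y - y \<in> poly_space (n - 1)"
proof -
  define S where "S = {g :: 'l \<Rightarrow> 'l. \<forall>n. \<forall>y\<in>poly_space n. g y - y \<in> poly_space (n - 1)}"
  have comp: "g \<circ> h \<in> S" if g: "g \<in> S" and h: "h \<in> S" for g h
  proof -
    have "g (h y) - y \<in> poly_space (n - 1)" if y: "y \<in> poly_space n" for y n
    proof -
      have hy: "h y - y \<in> poly_space (n - 1)"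
        using h y unfolding S_def by blast
      then have "(h y - y) + y \<in> poly_space n"
        using y poly_space_mono[OF hy, of n] by (intro poly_space_add) auto
      then have "g (h y) - h y \<in> poly_space (n - 1)"
        using g unfolding S_def by auto
      then have "(g (h y) - h y) + (h y - y) \<in> poly_space (n - 1)"
        using hy by (rule poly_space_add)
      then show ?thesis by simp
    qed
    then show ?thesis by (simp add: S_def)
  qed
  have id: "id \<in> S"
    by (simp add: S_def poly_space.zero)
  have "\<sigma>1 \<in> S" "\<sigma>2 \<in> S"
    using X_poly_space by (auto simp: S_def X1_def X2_def)
  then have "\<sigma>1 ^^ i \<in> S" "\<sigma>2 ^^ i \<in> S" for i
    using id comp by (induction i) simp_all
  moreover obtain i j where "g = \<sigma>1 ^^ i \<circ> \<sigma>2 ^^ j"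
    using galois_elements[OF assms(1)] by blast
  ultimately have "g \<in> S"
    by (simp add: comp)
  then show ?thesis
    using assms(2) by (simp add: S_def)
qed

text \<open>An element with coefficient sum zero acts as a combination of the operators
  \<open>g - 1\<close>, each of which lowers the degree.\<close>

lemma augmentation_poly_space:
  assumes "a \<in> augmentation_ideal F G" "y \<in> poly_space n"
  shows "act a y \<in> poly_space (n - 1)"
proof -
  have "act a y = (\<Sum>g\<in>carrier G. a g * (g y - y)) + (\<Sum>g\<in>carrier G. a g) * y"
    by (simp add: algebra_action_def right_diff_distrib sum_subtractf sum_distrib_right)
  also have "\<dots> = (\<Sum>g\<in>carrier G. a g * (g y - y))"
    using assms(1) by (simp add: augmentation_ideal_def)
  also have "\<dots> \<in> poly_space (n - 1)"
    using assms F_sub_K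
    by (intro poly_space_sum poly_space_scale galois_minus_one_poly_space)
      (auto simp: augmentation_ideal_def carrier_R)
  finally show ?thesis .
qed

lemma augmentation_power_poly_space:
  "a \<in> augmentation_power F G k \<Longrightarrow> y \<in> poly_space n \<Longrightarrow> act a y \<in> poly_space (n - k)"
proof (induction k arbitrary: a y)
  case 0
  then show ?case
  proof -
    have "act a y = (\<Sum>g\<in>carrier G. a g * ((g y - y) + y))"
      by (simp add: algebra_action_def)
    also have "\<dots> \<in> poly_space n"
    proof (intro poly_space_sum poly_space_scale)
      fix g assume g: "g \<in> carrier G"
      show "g y - y + y \<in> poly_space n"
        using poly_space_mono[OF galois_minus_one_poly_space[OF g 0(2)], of n] 0(2)
        by (intro poly_space_add) auto
      show "a g \<in> K"
        using 0(1) F_sub_K R_closedD by (auto simp: augmentation_power_0)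
    qed
    finally show ?thesis by simp
  qed
next
  case (Suc k)
  from Suc.prems(1) show ?case
    unfolding augmentation_power_Suc
  proof (induction rule: ideal_prod.induct)
    case (prod i j)
    have "i \<in> carrier R" "j \<in> carrier R"
      using ideal.Icarr[OF ideal_augmentation prod(1)] ideal.Icarr[OF ideal_augmentation_power prod(2)] by auto
    then have "act (i \<otimes>\<^bsub>R\<^esub> j) y = act i (act j y)"
      by (rule act_mult)
    also have "\<dots> \<in> poly_space (n - k - 1)"
      by (rule augmentation_poly_space[OF prod(1) Suc.IH[OF prod(2) Suc.prems(2)]])
    finally show ?case by simp
  next
    case (sum s1 s2)
    then show ?case by (simp add: R_simps act_pointwise poly_space_add)
  qed
qed

text \<open>Each of the \<open>k\<close> factors lowers the degree bound by one, so the bound drops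
  from \<open>k\<close> to \<open>0\<close>.\<close>

lemma augmentation_power_kills:
  assumes "a \<in> augmentation_power F G k" "k \<le> p" "i + j < k"
  shows "act a (bin2 i j) = 0"
  using augmentation_power_poly_space[OF assms(1) bin2_in_poly_space[of i j k]] assms(2,3) poly_space_0
  by auto

text \<open>Duality of monomials and \<open>bin2\<close>, by induction on the total degree: applied
  to \<open>bin2 i j\<close>, monomials with smaller exponents already have coefficient zero and
  those with a larger exponent give zero, so the value is \<open>c i j\<close>.\<close>

lemma kills_expansion:
  assumes "a \<in> carrier R" "k \<le> p" "\<And>i j. i + j < k \<Longrightarrow> act a (bin2 i j) = 0"
  obtains c where "\<And>i j. c i j \<in> F" "\<And>i j. i + j < k \<Longrightarrow> c i j = 0"
    "a = (\<lambda>g. \<Sum>i<p. \<Sum>j<p. c i j * monom_R i j g)"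
proof -
  obtain c where c: "\<And>i j. c i j \<in> F" and a: "a = (\<lambda>g. \<Sum>i<p. \<Sum>j<p. c i j * monom_R i j g)"
    using R_expansion[OF assms(1)] by blast
  have "c i j = 0" if "i + j < k" for i j
    using that
  proof (induction "i + j" arbitrary: i j rule: less_induct)
    case less
    then have ij: "i < p" "j < p"
      using assms(2) by auto
    have "0 = act a (bin2 i j)"
      using assms(3) less by simp
    also have "\<dots> = (\<Sum>i'<p. \<Sum>j'<p. if i' = i \<and> j' = j then c i' j' else 0)"
      unfolding a act_pointwise_sum act_pointwise act_monom_R X_pow_bin2[OF ij]
    proof (intro sum.cong refl)
      fix i' j'
      have "c i' j' = 0" if "i' \<le> i" "j' \<le> j" "\<not> (i' = i \<and> j' = j)"
        using less.hyps[of i' j'] less.prems that by auto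
      then show "c i' j' * (if i' \<le> i \<and> j' \<le> j then bin2 (i - i') (j - j') else 0) =
          (if i' = i \<and> j' = j then c i' j' else 0)"
        by auto
    qed
    also have "\<dots> = (\<Sum>i'<p. if i' = i then (\<Sum>j'<p. if j' = j then c i' j' else 0) else 0)"
      by (intro sum.cong refl) auto
    also have "\<dots> = c i j"
      using ij by (simp add: sum.delta)
    finally show ?case by simp
  qed
  then show ?thesis
    using that c a by blast
qed

text \<open>Converse of \<open>augmentation_power_kills\<close>: only monomials of total degree at
  least \<open>k\<close> survive in the expansion. Together they identify \<open>A ^ k\<close> with
  the annihilator of the polynomials of degree below \<open>k\<close>.\<close>

lemma kills_imp_augmentation_power:
  assumes "a \<in> carrier R" "k \<le> p" "\<And>i j. i + j < k \<Longrightarrow> act a (bin2 i j) = 0"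
  shows "a \<in> augmentation_power F G k"
proof -
  obtain c where c: "\<And>i j. c i j \<in> F" "\<And>i j. i + j < k \<Longrightarrow> c i j = 0"
    and a: "a = (\<lambda>g. \<Sum>i<p. \<Sum>j<p. c i j * monom_R i j g)"
    using kills_expansion[OF assms] by blast
  have "(\<lambda>g. c i j * monom_R i j g) \<in> augmentation_power F G k" for i j
  proof (cases "i + j < k")
    case True
    interpret I: ideal "augmentation_power F G k" R by (rule ideal_augmentation_power)
    show ?thesis
      using I.zero_closed c(2)[OF True] by (simp add: R_simps)
  next
    case False
    then have "monom_R i j \<in> augmentation_power F G k"
      using monom_R_in_power[of i j] augmentation_power_antimono[of k "i + j"] by auto
    then show ?thesis
      by (rule ideal_scale_closed[OF ideal_augmentation_power c(1)])
  qed
  then show ?thesis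
    unfolding a by (intro ideal_sum_closed[OF ideal_augmentation_power])
qed

text \<open>The element acts on polynomials of degree below \<open>k\<close> like the substitution
  of \<open>x1 + c\<close> and \<open>x2 + d\<close>. The pair \<open>(c, d)\<close> serves as the
  coordinate vector of a class in the span of \<open>G\<close>.\<close>

definition translates :: "nat \<Rightarrow> (('l \<Rightarrow> 'l) \<Rightarrow> 'l) \<Rightarrow> 'l \<Rightarrow> 'l \<Rightarrow> bool" where
  "translates k a c d \<longleftrightarrow>
    (\<forall>i j. i + j < k \<longrightarrow> act a (bin2 i j) = field_binomial (x1 + c) i * field_binomial (x2 + d) j)"

lemma translates_cong:
  assumes "a \<in> carrier R" "b \<in> carrier R" "k \<le> p"
    and "truncated_class F G k a = truncated_class F G k b"
  shows "translates k a c d \<longleftrightarrow> translates k b c d"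
proof -
  have "(\<lambda>g. a g - b g) \<in> augmentation_power F G k"
    using truncated_class_eq_iff[OF assms(1,2)] assms(4) by simp
  then have "act (\<lambda>g. a g - b g) (bin2 i j) = 0" if "i + j < k" for i j
    using augmentation_power_kills[OF _ assms(3) that] by simp
  then have "act a (bin2 i j) = act b (bin2 i j)" if "i + j < k" for i j
    using that by (simp add: act_pointwise)
  then show ?thesis
    by (auto simp: translates_def)
qed

text \<open>The difference of the two elements kills all polynomials of degree below
  \<open>k\<close>, so a class is determined by its vector.\<close>

lemma translates_unique:
  assumes "a \<in> carrier R" "b \<in> carrier R" "k \<le> p" "translates k a c d" "translates k b c d"
  shows "truncated_class F G k a = truncated_class F G k b"
proof -
  have "(\<lambda>g. a g - b g) \<in> carrier R"
    using R.minus_closed[OF assms(1,2)] R_diff[OF assms(2), of a] by simp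
  then have "(\<lambda>g. a g - b g) \<in> augmentation_power F G k"
    by (rule kills_imp_augmentation_power[OF _ assms(3)])
      (use assms(4,5) in \<open>simp add: act_pointwise translates_def\<close>)
  then show ?thesis
    using truncated_class_eq_iff[OF assms(1,2)] by simp
qed

lemma translates_group_element:
  assumes "g \<in> carrier G" "g x1 = x1 + c" "g x2 = x2 + d"
  shows "translates k (group_element g) c d"
  using assms
  by (simp add: translates_def act_group_element bin2_def galois_apply K.galois_field_binomial)

text \<open>Vandermonde writes the shifted product as a combination of \<open>bin2\<close> with
  coefficients in \<open>K\<close>, and the action is linear over \<open>K\<close>. Thus
  translations compose additively.\<close>

lemma translates_bin2_K:
  assumes "translates k a c d" "k \<le> p" "i + j < k" "c' \<in> K" "d' \<in> K"
  shows "act a (field_binomial (x1 + c') i * field_binomial (x2 + d') j) =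
    field_binomial (x1 + c + c') i * field_binomial (x2 + d + d') j"
proof -
  have ij: "i < p" "j < p"
    using assms by auto
  have expand: "field_binomial (u + c') i * field_binomial (v + d') j =
     (\<Sum>m\<le>i. \<Sum>l\<le>j. (field_binomial c' m * field_binomial d' l) * (field_binomial u (i - m) * field_binomial v (j - l)))"
    for u v
  proof -
    have "field_binomial (u + c') i = (\<Sum>m\<le>i. field_binomial c' m * field_binomial u (i - m))"
      "field_binomial (v + d') j = (\<Sum>m\<le>j. field_binomial d' m * field_binomial v (j - m))"
      using field_binomial_add[OF ij(1), of c' u] field_binomial_add[OF ij(2), of d' v]
      by (simp_all only: add.commute)
    then show ?thesis
      by (simp only: sum_product mult.assoc mult.left_commute)
  qed
  have "act a (field_binomial (x1 + c') i * field_binomial (x2 + d') j) =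
      (\<Sum>m\<le>i. \<Sum>l\<le>j. (field_binomial c' m * field_binomial d' l) * act a (bin2 (i - m) (j - l)))"
    unfolding expand act_sum bin2_def
    by (intro sum.cong refl act_scale K.mult_in K.field_binomial_in assms)
  also have "\<dots> = (\<Sum>m\<le>i. \<Sum>l\<le>j. (field_binomial c' m * field_binomial d' l) *
      (field_binomial (x1 + c) (i - m) * field_binomial (x2 + d) (j - l)))"
    by (intro sum.cong refl) (use assms in \<open>auto simp: translates_def\<close>)
  finally show ?thesis
    by (simp only: expand[symmetric])
qed

lemma translates_mult:
  assumes "a \<in> carrier R" "b \<in> carrier R" "k \<le> p" "translates k a c d" "translates k b c' d'"
    and "c' \<in> K" "d' \<in> K"
  shows "translates k (a \<otimes>\<^bsub>R\<^esub> b) (c + c') (d + d')"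
  using assms translates_bin2_K[OF assms(4,3) _ assms(6,7)]
  by (simp add: translates_def act_mult add.assoc)

text \<open>Both sides are polynomials in the exponent \<open>w\<close> of degree below
  \<open>p\<close>: one by the truncation, the other because \<open>i + j < k \<le> p\<close>. At an
  integer exponent both are the iterated action, by Newton's formula, so they coincide.\<close>

lemma translates_truncated_power:
  assumes "a \<in> carrier R" "k \<le> p" "translates k a c d" "c \<in> K" "d \<in> K"
  shows "translates k (truncated_power p F G a w) (w * c) (w * d)"
  unfolding translates_def
proof (intro allI impI)
  fix i j assume ij: "i + j < k"
  let ?y = "\<lambda>r. ((\<lambda>y. act a y - y) ^^ r) (bin2 i j)"
  define f where "f = (\<Sum>r<p. smult (?y r) (binomial_poly r))"
  define g where "g = pcompose (binomial_poly i) [:x1, c:] * pcompose (binomial_poly j) [:x2, d:]"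
  have f: "poly f u = (\<Sum>r<p. field_binomial u r * ?y r)" for u
    by (simp add: f_def poly_sum mult.commute)
  have g: "poly g u = field_binomial (x1 + u * c) i * field_binomial (x2 + u * d) j" for u
    by (simp add: g_def poly_pcompose mult.commute)
  have "f = g"
  proof (rule poly_eq_if_eq_on_prime_field)
    have "degree (smult (?y r) (binomial_poly r)) \<le> p - 1" if "r \<in> {..<p}" for r
      using degree_smult_le[of "?y r" "binomial_poly r"] degree_binomial_poly[of r] that by auto
    then have "degree f \<le> p - 1"
      unfolding f_def by (intro degree_sum_le) auto
    then show "degree f < p"
      using p_pos by auto
    have "degree (pcompose (binomial_poly m) [:u, v:]) \<le> m" for m and u v :: 'l
      using degree_pcompose_le[of "binomial_poly m" "[:u, v:]"] degree_binomial_poly[of m]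
      by (auto intro: order_trans split: if_splits)
    then have "degree g \<le> i + j"
      unfolding g_def by (meson add_mono degree_mult_le order_trans)
    then show "degree g < p"
      using ij assms(2) by auto
    have iter: "(act a ^^ n) (bin2 i j) = field_binomial (x1 + of_nat n * c) i * field_binomial (x2 + of_nat n * d) j" for n
    proof (induction n)
      case 0 show ?case by (simp add: bin2_def)
    next
      case (Suc n)
      then show ?case
        using translates_bin2_K[OF assms(3,2) ij, of "of_nat n * c" "of_nat n * d"] assms(4,5)
        by (simp add: K.mult_in algebra_simps)
    qed
    show "poly f (of_nat n) = poly g (of_nat n)" for n
    proof -
      \<comment> \<open>Newton's formula for \<open>n\<close> needs differences up to order
        \<open>n\<close>; reducing \<open>n\<close> modulo \<open>p\<close> keeps them inside the
        truncation and does not change \<open>of_nat n\<close>.\<close>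
      have "poly f (of_nat (n mod p)) = (\<Sum>r\<le>n mod p. of_nat (n mod p choose r) * ?y r)"
        unfolding f
        by (subst sum_lessThan_if_le_extend[where p = p])
          (use p_pos in \<open>auto simp: field_binomial_of_nat binomial_eq_0\<close>)
      also have "\<dots> = (act a ^^ (n mod p)) (bin2 i j)"
        by (rule iterate_eq_sum_differences[symmetric]) (rule act_add)
      also have "\<dots> = poly g (of_nat (n mod p))"
        by (simp add: iter g)
      finally have *: "poly f (of_nat (n mod p)) = poly g (of_nat (n mod p))" .
      have "(of_nat n :: 'l) = of_nat p * of_nat (n div p) + of_nat (n mod p)"
        by (metis mult_div_mod_eq of_nat_add of_nat_mult)
      then have "(of_nat n :: 'l) = of_nat (n mod p)"
        by simp
      then show ?thesis using * by metis
    qed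
  qed
  then show "act (truncated_power p F G a w) (bin2 i j) =
      field_binomial (x1 + w * c) i * field_binomial (x2 + w * d) j"
    using f[of w] g[of w] by (simp add: act_truncated_power[OF assms(1)])
qed

lemma one_plus_augmentation_carrier: "a \<in> one_plus_augmentation F G \<Longrightarrow> a \<in> carrier R"
  by (simp add: one_plus_augmentation_def)

lemma galois_element_apply:
  assumes "g = \<sigma>1 ^^ i \<circ> \<sigma>2 ^^ j"
  shows "g x1 = x1 + of_nat i" "g x2 = x2 + of_nat j"
proof -
  have 1: "(\<sigma>1 ^^ i) x1 = x1 + of_nat i" "(\<sigma>1 ^^ i) x2 = x2" for i
    by (induction i) (auto simp: \<sigma>_x galois_apply[OF \<sigma>1] add_ac)
  have 2: "(\<sigma>2 ^^ i) x2 = x2 + of_nat i" "(\<sigma>2 ^^ i) x1 = x1" for i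
    by (induction i) (auto simp: \<sigma>_x galois_apply[OF \<sigma>2] add_ac)
  have "g x1 = (\<sigma>1 ^^ i) ((\<sigma>2 ^^ j) x1)" "g x2 = (\<sigma>2 ^^ j) ((\<sigma>1 ^^ i) x2)"
    by (simp_all only: assms comp_apply \<sigma>_pow_commute)
  then show "g x1 = x1 + of_nat i" "g x2 = x2 + of_nat j"
    by (simp_all only: 1 2)
qed

lemma galois_translation:
  assumes "g \<in> carrier G"
  obtains m n where "g x1 = x1 + of_nat m" "g x2 = x2 + of_nat n"
  using galois_elements[OF assms] galois_element_apply that by metis

text \<open>Rule induction: products add vectors and truncated powers scale them. In the scaling
  rule \<open>\<gamma>\<close> is an arbitrary representative, so \<open>translates_cong\<close>
  first carries the vector over to it.\<close>

lemma group_span_translates: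
  assumes "C \<in> group_span p F G k" "k \<le> p"
  shows "\<exists>a\<in>carrier R. \<exists>c\<in>F. \<exists>d\<in>F. C = truncated_class F G k a \<and> translates k a c d"
  using assms(1)
proof (induction rule: group_span.induct)
  case (base g)
  then obtain m n where "g x1 = x1 + of_nat m" "g x2 = x2 + of_nat n"
    using galois_translation by blast
  then have "translates k (group_element g) (of_nat m) (of_nat n)"
    by (rule translates_group_element[OF base])
  then show ?case
    using group_element_in[OF base] F.of_nat_in by blast
next
  case (mult C D)
  then obtain a c d b c' d' where
    ab: "a \<in> carrier R" "b \<in> carrier R" "C = truncated_class F G k a" "D = truncated_class F G k b"
    and cd: "c \<in> F" "d \<in> F" "c' \<in> F" "d' \<in> F" "translates k a c d" "translates k b c' d'"
    by blast
  then have "translates k (a \<otimes>\<^bsub>R\<^esub> b) (c + c') (d + d')"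
    using F_sub_K assms(2) by (intro translates_mult) auto
  then show ?case
    using ab cd(1-4)
    by (intro bexI[of _ "a \<otimes>\<^bsub>R\<^esub> b"] bexI[of _ "c + c'"] bexI[of _ "d + d'"])
      (auto simp: truncated_class_mult F.add_in)
next
  case (scale \<gamma> \<omega>)
  then obtain a c d where
    a: "a \<in> carrier R" "truncated_class F G k \<gamma> = truncated_class F G k a"
    and cd: "c \<in> F" "d \<in> F" "translates k a c d"
    by blast
  have \<gamma>: "\<gamma> \<in> carrier R"
    using scale one_plus_augmentation_carrier by blast
  then have "translates k \<gamma> c d"
    using cd(3) translates_cong[OF \<gamma> a(1) assms(2) a(2)] by simp
  then have "translates k (truncated_power p F G \<gamma> \<omega>) (\<omega> * c) (\<omega> * d)"
    using F_sub_K cd(1,2) by (intro translates_truncated_power[OF \<gamma> assms(2)]) auto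
  then show ?case
    using truncated_power_in[OF \<gamma> scale.hyps(3)] F.mult_in[OF scale.hyps(3)] cd(1,2) by blast
qed

end

section \<open>Bases\<close>

context type_subfield
begin

lemma combine_eq_sum:
  "length Ks = length Us \<Longrightarrow>
    ring.combine ring_of_type_algebra Ks Us = (\<Sum>i<length Us. Ks ! i * (Us ! i :: 'l))"
proof -
  interpret R: ring "ring_of_type_algebra :: 'l ring" ..
  show "length Ks = length Us \<Longrightarrow> R.combine Ks Us = (\<Sum>i<length Us. Ks ! i * Us ! i)"
  proof (induction Ks Us rule: list_induct2)
    case (Cons k Ks u Us)
    have "(\<Sum>i<Suc (length Us). (k # Ks) ! i * (u # Us) ! i) = k * u + (\<Sum>i<length Us. Ks ! i * Us ! i)"
      by (subst sum.lessThan_Suc_shift) simp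
    then show ?case using Cons by simp
  qed simp
qed

lemma Span_iff:
  "y \<in> ring.Span ring_of_type_algebra K Us \<longleftrightarrow>
    (\<exists>c. (\<forall>i<length Us. c i \<in> K) \<and> y = (\<Sum>i<length Us. c i * (Us ! i :: 'l)))"
proof -
  interpret R: ring "ring_of_type_algebra :: 'l ring" ..
  have "R.Span K Us = {R.combine Ks Us | Ks. length Ks = length Us \<and> set Ks \<subseteq> K}"
    using R.Span_eq_combine_set_length_version[OF subfield, of Us] by auto
  then have "y \<in> R.Span K Us \<longleftrightarrow> (\<exists>Ks. length Ks = length Us \<and> set Ks \<subseteq> K \<and> y = (\<Sum>i<length Us. Ks ! i * Us ! i))"
    by (auto simp: combine_eq_sum)
  also have "\<dots> \<longleftrightarrow> (\<exists>c. (\<forall>i<length Us. c i \<in> K) \<and> y = (\<Sum>i<length Us. c i * Us ! i))"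
  proof
    assume "\<exists>Ks. length Ks = length Us \<and> set Ks \<subseteq> K \<and> y = (\<Sum>i<length Us. Ks ! i * Us ! i)"
    then obtain Ks where "length Ks = length Us" "set Ks \<subseteq> K" "y = (\<Sum>i<length Us. Ks ! i * Us ! i)"
      by blast
    then show "\<exists>c. (\<forall>i<length Us. c i \<in> K) \<and> y = (\<Sum>i<length Us. c i * Us ! i)"
      by (intro exI[of _ "\<lambda>i. Ks ! i"]) (auto simp: subset_iff)
  next
    assume "\<exists>c. (\<forall>i<length Us. c i \<in> K) \<and> y = (\<Sum>i<length Us. c i * Us ! i)"
    then obtain c where "\<forall>i<length Us. c i \<in> K" "y = (\<Sum>i<length Us. c i * Us ! i)"
      by blast
    then show "\<exists>Ks. length Ks = length Us \<and> set Ks \<subseteq> K \<and> y = (\<Sum>i<length Us. Ks ! i * Us ! i)"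
      by (intro exI[of _ "map c [0..<length Us]"]) auto
  qed
  finally show ?thesis .
qed

text \<open>Families indexed by any set replace the lists of the algebra library, since the bases
  used later are indexed by pairs; an enumeration of the index set translates between the
  two.\<close>

definition lin_indep :: "'i set \<Rightarrow> ('i \<Rightarrow> 'l) \<Rightarrow> bool" where
  "lin_indep I w \<longleftrightarrow> (\<forall>c. (\<forall>i\<in>I. c i \<in> K) \<longrightarrow> (\<Sum>i\<in>I. c i * w i) = 0 \<longrightarrow> (\<forall>i\<in>I. c i = 0))"

definition spanning :: "'i set \<Rightarrow> ('i \<Rightarrow> 'l) \<Rightarrow> bool" where
  "spanning I w \<longleftrightarrow> (\<forall>y. \<exists>c. (\<forall>i\<in>I. c i \<in> K) \<and> y = (\<Sum>i\<in>I. c i * w i))"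

context
  fixes I :: "'i set" and w :: "'i \<Rightarrow> 'l" and h :: "nat \<Rightarrow> 'i" and Us
  assumes h: "bij_betw h {0..<card I} I"
  defines "Us \<equiv> map (w \<circ> h) [0..<card I]"
begin

lemma length_Us: "length Us = card I"
  by (simp add: Us_def)

lemma sum_Us: "(\<Sum>i<length Us. c (h i) * Us ! i) = (\<Sum>i\<in>I. c i * w i)"
proof -
  have "(\<Sum>i<length Us. c (h i) * Us ! i) = (\<Sum>i\<in>{0..<card I}. c (h i) * w (h i))"
    by (intro sum.cong) (auto simp: Us_def)
  also have "\<dots> = (\<Sum>i\<in>I. c i * w i)"
    using sum.reindex_bij_betw[OF h, of "\<lambda>i. c i * w i"] by simp
  finally show ?thesis .
qed

lemma sum_Us': "(\<Sum>i<length Us. c i * Us ! i) = (\<Sum>i\<in>I. c (inv_into {0..<card I} h i) * w i)"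
proof -
  have "c (inv_into {0..<card I} h (h i)) = c i" if "i < card I" for i
    using h that by (simp add: bij_betw_def)
  then have "(\<Sum>i<length Us. c i * Us ! i) = (\<Sum>i<length Us. c (inv_into {0..<card I} h (h i)) * Us ! i)"
    by (intro sum.cong) (auto simp: length_Us)
  then show ?thesis
    using sum_Us[of "\<lambda>i. c (inv_into {0..<card I} h i)"] by simp
qed

lemma Us_independent:
  assumes "lin_indep I w"
  shows "ring.independent ring_of_type_algebra K Us"
proof -
  interpret R: ring "ring_of_type_algebra :: 'l ring" ..
  show ?thesis
  proof (rule R.trivial_combine_imp_independent[OF subfield])
    fix Ks assume Ks: "set Ks \<subseteq> K" "R.combine Ks Us = \<zero>\<^bsub>ring_of_type_algebra\<^esub>"
    \<comment> \<open>\<open>combine\<close> ignores the excess of the longer list, so the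
      coefficients are cut or padded with zeros to the length of \<open>Us\<close>.\<close>
    define Ks' where "Ks' = take (length Us) Ks @ replicate (length Us - length Ks) 0"
    have len: "length Ks' = length Us"
      by (simp add: Ks'_def)
    have "R.combine Ks' Us = 0"
      using R.combine_take[of Us Ks] Ks(2)
        R.combine_append_replicate[of Us "take (length Us) Ks" "length Us - length Ks"]
      by (simp add: Ks'_def del: R.combine.simps)
    then have "(\<Sum>i\<in>I. Ks' ! (inv_into {0..<card I} h i) * w i) = 0"
      using combine_eq_sum[OF len] sum_Us'[of "(!) Ks'"] by simp
    moreover have inv: "inv_into {0..<card I} h i < card I" if "i \<in> I" for i
      using bij_betw_inv_into[OF h] that by (auto simp: bij_betw_def)
    moreover have "Ks' ! i \<in> K" if "i < card I" for i
    proof -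
      have "Ks' ! i \<in> set Ks'"
        using that len length_Us by simp
      also have "set Ks' \<subseteq> K"
        using Ks(1) set_take_subset[of "length Us" Ks] by (auto simp: Ks'_def)
      finally show ?thesis .
    qed
    ultimately have 0: "Ks' ! (inv_into {0..<card I} h i) = 0" if "i \<in> I" for i
      using assms[unfolded lin_indep_def, rule_format, of "\<lambda>i. Ks' ! (inv_into {0..<card I} h i)" i] that
      by auto
    have "Ks' ! i = 0" if "i < card I" for i
      using 0[of "h i"] bij_betwE[OF h] h that by (auto simp: bij_betw_def)
    then have "set Ks' \<subseteq> {0}"
      using len length_Us by (auto simp: in_set_conv_nth)
    then show "set (take (length Us) Ks) \<subseteq> {\<zero>\<^bsub>ring_of_type_algebra\<^esub>}"
      by (auto simp: Ks'_def)
  qed simp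
qed

lemma Us_Span: "ring.Span ring_of_type_algebra K Us = UNIV \<longleftrightarrow> spanning I w"
proof -
  have "(\<exists>c. (\<forall>i<length Us. c i \<in> K) \<and> y = (\<Sum>i<length Us. c i * (Us ! i))) \<longleftrightarrow>
      (\<exists>c. (\<forall>i\<in>I. c i \<in> K) \<and> y = (\<Sum>i\<in>I. c i * w i))" for y
  proof
    assume "\<exists>c. (\<forall>i<length Us. c i \<in> K) \<and> y = (\<Sum>i<length Us. c i * (Us ! i))"
    then obtain c where "\<forall>i<length Us. c i \<in> K" "y = (\<Sum>i<length Us. c i * (Us ! i))"
      by blast
    then show "\<exists>c. (\<forall>i\<in>I. c i \<in> K) \<and> y = (\<Sum>i\<in>I. c i * w i)"
      using bij_betwE[OF bij_betw_inv_into[OF h]] sum_Us'[of c]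
      by (intro exI[of _ "\<lambda>i. c (inv_into {0..<card I} h i)"]) (auto simp: length_Us)
  next
    assume "\<exists>c. (\<forall>i\<in>I. c i \<in> K) \<and> y = (\<Sum>i\<in>I. c i * w i)"
    then obtain c where "\<forall>i\<in>I. c i \<in> K" "y = (\<Sum>i\<in>I. c i * w i)"
      by blast
    then show "\<exists>c. (\<forall>i<length Us. c i \<in> K) \<and> y = (\<Sum>i<length Us. c i * (Us ! i))"
      using h sum_Us[of c] by (intro exI[of _ "\<lambda>i. c (h i)"]) (auto simp: length_Us bij_betw_def)
  qed
  then show ?thesis
    by (simp add: set_eq_iff Span_iff spanning_def)
qed

end

lemma dim_eq_card_basis:
  assumes "finite I" "lin_indep I w" "spanning I w"
  shows "ring.dim ring_of_type_algebra K (UNIV :: 'l set) = card I"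
proof -
  interpret R: ring "ring_of_type_algebra :: 'l ring" ..
  obtain h where h: "bij_betw h {0..<card I} I"
    using ex_bij_betw_nat_finite[OF assms(1)] by blast
  have "R.dimension (length (map (w \<circ> h) [0..<card I])) K UNIV"
    by (rule R.dimensionI[OF subfield Us_independent[OF h assms(2)]]) (rule Us_Span[OF h, THEN iffD2, OF assms(3)])
  then show ?thesis
    using R.dimI[OF subfield] by (simp add: over_def)
qed

lemma spanning_if_card_eq_dim:
  assumes "ring.finite_dimension ring_of_type_algebra K (UNIV :: 'l set)"
    and "finite I" "lin_indep I w" "card I = ring.dim ring_of_type_algebra K (UNIV :: 'l set)"
  shows "spanning I w"
proof -
  interpret R: ring "ring_of_type_algebra :: 'l ring" ..
  obtain h where h: "bij_betw h {0..<card I} I"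
    using ex_bij_betw_nat_finite[OF assms(2)] by blast
  have "R.dimension (card I) K UNIV"
    using R.finite_dimensionE[OF subfield assms(1)] assms(4) by (simp add: over_def)
  then have "R.Span K (map (w \<circ> h) [0..<card I]) = UNIV"
    using R.independent_length_eq_dimension[OF subfield _ Us_independent[OF h assms(3)], of "card I" UNIV] by simp
  then show ?thesis
    by (rule Us_Span[OF h, THEN iffD1])
qed

end

section \<open>Binomial bases of L over K and the degree of the extension\<close>

context bicyclic
begin

lemma pow_in_galois: "g \<in> carrier G \<Longrightarrow> g ^^ n \<in> carrier G"
proof (induction n)
  case 0 show ?case using G.one_closed by (simp only: funpow.simps K.galois_group_one)
next
  case (Suc n)
  then show ?case using G.m_closed[of g "g ^^ n"] by (simp add: comp_def)
qed

lemma galois_eq_id: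
  assumes "g \<in> carrier G" "g x1 = x1" "g x2 = x2"
  shows "g = id"
proof -
  obtain i j where ij: "i < p" "j < p" "g = \<sigma>1 ^^ i \<circ> \<sigma>2 ^^ j"
    using galois_elements[OF assms(1)] by blast
  then have "of_nat i = (0::'l)" "of_nat j = (0::'l)"
    using galois_element_apply[OF ij(3)] assms(2,3) by simp_all
  then have "i = 0" "j = 0"
    using of_nat_neq_0 ij by auto
  then show ?thesis
    by (simp add: ij(3))
qed

lemma galois_pow_p: "g \<in> carrier G \<Longrightarrow> g ^^ p = id"
proof (rule galois_eq_id[OF pow_in_galois])
  assume g: "g \<in> carrier G"
  then obtain m n where mn: "g x1 = x1 + of_nat m" "g x2 = x2 + of_nat n"
    using galois_translation by blast
  have "(g ^^ i) x1 = x1 + of_nat i * of_nat m" "(g ^^ i) x2 = x2 + of_nat i * of_nat n" for i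
    by (induction i; simp add: mn galois_apply[OF g] algebra_simps)+
  then show "(g ^^ p) x1 = x1" "(g ^^ p) x2 = x2"
    by simp_all
qed

text \<open>In characteristic \<open>p\<close> the middle binomial coefficients vanish, so
  \<open>(g - 1) ^ p = g ^ p - 1 = 0\<close>.\<close>

lemma galois_minus_one_pow_p:
  assumes "g \<in> carrier G"
  shows "((\<lambda>y. g y - y) ^^ p) y = 0"
proof -
  let ?D = "\<lambda>y. g y - y"
  have "y = (g ^^ p) y"
    using galois_pow_p[OF assms] by simp
  also have "\<dots> = (\<Sum>i\<le>p. of_nat (p choose i) * (?D ^^ i) y)"
    by (rule iterate_eq_sum_differences) (simp add: galois_apply[OF assms])
  also have "\<dots> = (\<Sum>i\<in>{0, p}. of_nat (p choose i) * (?D ^^ i) y)"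
  proof (rule sum.mono_neutral_right)
    show "\<forall>i\<in>{..p} - {0, p}. of_nat (p choose i) * (?D ^^ i) y = 0"
    proof
      fix i assume "i \<in> {..p} - {0, p}"
      then have "p dvd p choose i"
        using dvd_choose_prime[of i p] prime_p by auto
      then show "of_nat (p choose i) * (?D ^^ i) y = 0"
        by (simp add: of_nat_eq_0_iff)
    qed
  qed auto
  also have "\<dots> = y + (?D ^^ p) y"
    using p_pos by simp
  finally show ?thesis by simp
qed

text \<open>
  This replaces Artin's theorem on \<open>[L : K]\<close>: if \<open>(g - 1) ^ (n + 1)\<close> kills \<open>y\<close>, then \<open>(g - 1) ^ n y\<close> is
  fixed by \<open>g\<close> and is the top coefficient of \<open>y\<close>.
\<close>

lemma binomial_expansion:
  assumes g: "g \<in> carrier G" and z: "g z = z + 1"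
    and M_diff: "\<And>x y. x \<in> M \<Longrightarrow> y \<in> M \<Longrightarrow> x - y \<in> M"
    and M_g: "\<And>x. x \<in> M \<Longrightarrow> g x \<in> M"
    and M_mult: "\<And>x n. x \<in> M \<Longrightarrow> x * field_binomial z n \<in> M"
    and "y \<in> M"
  shows "\<exists>c. (\<forall>i<p. c i \<in> M \<and> g (c i) = c i) \<and> y = (\<Sum>i<p. c i * field_binomial z i)"
proof -
  let ?D = "\<lambda>y. g y - y"
  have D_M: "(?D ^^ n) x \<in> M" if "x \<in> M" for n x
    using that by (induction n) (auto intro: M_diff M_g)
  have D_diff: "(?D ^^ n) (x - y) = (?D ^^ n) x - (?D ^^ n) y" for n x y
    by (induction n) (auto simp: K.galois_diff[OF g])
  have D_binomial: "(?D ^^ n) (c * field_binomial z n) = c" if "g c = c" "n < p" for n c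
    using that(2)
  proof (induction n)
    case (Suc n)
    have "(?D ^^ Suc n) (c * field_binomial z (Suc n)) = (?D ^^ n) (?D (c * field_binomial z (Suc n)))"
      by (simp only: funpow_Suc_right comp_apply)
    also have "?D (c * field_binomial z (Suc n)) = c * field_binomial z n"
      using field_binomial_pascal[OF Suc.prems, of z]
      by (simp add: galois_apply[OF g] K.galois_field_binomial[OF g] z that(1) algebra_simps)
    finally show ?case
      using Suc by simp
  qed simp
  have "n \<le> p \<Longrightarrow> y \<in> M \<Longrightarrow> (?D ^^ n) y = 0 \<Longrightarrow>
      \<exists>c. (\<forall>i<n. c i \<in> M \<and> g (c i) = c i) \<and> y = (\<Sum>i<n. c i * field_binomial z i)" for n y
  proof (induction n arbitrary: y)
    case (Suc n)
    define d where "d = (?D ^^ n) y"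
    have "?D d = 0"
      using Suc.prems(3) by (simp add: d_def)
    then have d: "d \<in> M" "g d = d"
      using D_M[OF Suc.prems(2)] by (auto simp: d_def)
    have "(?D ^^ n) (y - d * field_binomial z n) = 0"
      using D_binomial[OF d(2), of n] Suc.prems(1) by (simp add: D_diff d_def[symmetric])
    then obtain c where c: "\<forall>i<n. c i \<in> M \<and> g (c i) = c i"
      "y - d * field_binomial z n = (\<Sum>i<n. c i * field_binomial z i)"
      using Suc.IH[of "y - d * field_binomial z n"] Suc.prems M_diff[OF Suc.prems(2) M_mult[OF d(1)]] by auto
    show ?case
    proof (intro exI[of _ "c(n := d)"] conjI)
      show "y = (\<Sum>i<Suc n. (c(n := d)) i * field_binomial z i)"
        using c(2) by (simp add: algebra_simps)
      show "\<forall>i<Suc n. (c(n := d)) i \<in> M \<and> g ((c(n := d)) i) = (c(n := d)) i"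
        using c(1) d by (auto simp: less_Suc_eq)
    qed
  qed simp
  from this[of p y] show ?thesis
    using galois_minus_one_pow_p[OF g] assms(6) by blast
qed

text \<open>Expanding in \<open>z\<close> over the fixed field of \<open>\<sigma>2\<close>, and then
  the coefficients in \<open>x1\<close> inside that field, leaves coefficients fixed by all of
  \<open>G\<close>. Only the action of \<open>\<sigma>2\<close> on \<open>z\<close> enters, so the
  lemma serves both \<open>x2\<close> and the later generator \<open>Z\<close>.\<close>

lemma double_binomial_spanning:
  assumes z: "\<sigma>2 z = z + 1"
  shows "K.spanning ({..<p} \<times> {..<p}) (\<lambda>(i, j). field_binomial z i * field_binomial x1 j)"
  unfolding K.spanning_def
proof
  fix y
  let ?M = "{y. \<sigma>2 y = y}"
  obtain c where c: "\<forall>i<p. \<sigma>2 (c i) = c i" "y = (\<Sum>i<p. c i * field_binomial z i)"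
    using binomial_expansion[OF \<sigma>2 z, of UNIV y] by auto
  have "\<exists>d. (\<forall>j<p. d j \<in> ?M \<and> \<sigma>1 (d j) = d j) \<and> c i = (\<Sum>j<p. d j * field_binomial x1 j)" if "i < p" for i
  proof (rule binomial_expansion[OF \<sigma>1 \<sigma>_x(1)])
    show "x - y \<in> ?M" if "x \<in> ?M" "y \<in> ?M" for x y
      using that by (simp add: K.galois_diff[OF \<sigma>2])
    show "\<sigma>1 x \<in> ?M" if "x \<in> ?M" for x
      using that \<sigma>_commute[of x] by simp
    show "x * field_binomial x1 n \<in> ?M" if "x \<in> ?M" for x n
      using that by (simp add: galois_apply[OF \<sigma>2] K.galois_field_binomial[OF \<sigma>2] \<sigma>_x)
    show "c i \<in> ?M"
      using c that by simp
  qed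
  then obtain d where d: "\<And>i j. i < p \<Longrightarrow> j < p \<Longrightarrow> \<sigma>2 (d i j) = d i j \<and> \<sigma>1 (d i j) = d i j"
      "\<And>i. i < p \<Longrightarrow> c i = (\<Sum>j<p. d i j * field_binomial x1 j)"
    by (simp add: choice_iff') metis
  have "d i j \<in> K" if "i < p" "j < p" for i j
  proof (rule fixed_field)
    fix g assume "g \<in> carrier G"
    then obtain m n where "g = \<sigma>1 ^^ m \<circ> \<sigma>2 ^^ n"
      using galois_elements by blast
    moreover have "(\<sigma>1 ^^ m) (d i j) = d i j" "(\<sigma>2 ^^ m) (d i j) = d i j" for m
      by (induction m; simp add: d(1)[OF that])+
    ultimately show "g (d i j) = d i j"
      by simp
  qed
  moreover have "y = (\<Sum>(i, j)\<in>{..<p} \<times> {..<p}. d i j * (field_binomial z i * field_binomial x1 j))"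
    unfolding sum.cartesian_product[symmetric] c(2)
    by (intro sum.cong refl) (simp add: d(2) sum_distrib_left sum_distrib_right mult_ac)
  ultimately show "\<exists>c. (\<forall>i\<in>{..<p} \<times> {..<p}. c i \<in> K) \<and>
      y = (\<Sum>i\<in>{..<p} \<times> {..<p}. c i * (case i of (i, j) \<Rightarrow> field_binomial z i * field_binomial x1 j))"
    by (intro exI[of _ "\<lambda>(i, j). d i j"]) (auto simp: case_prod_unfold)
qed

text \<open>To isolate \<open>c (a, b)\<close>, the monomial operator lowering the indices of
  \<open>x2\<close> and \<open>x1\<close> by \<open>a\<close> and \<open>b\<close> is applied: it
  kills terms with a smaller index, and terms with larger ones vanish by downward induction on
  \<open>a + b\<close>.\<close>

lemma double_binomial_lin_indep:
  "K.lin_indep ({..<p} \<times> {..<p}) (\<lambda>(i, j). field_binomial x2 i * field_binomial x1 j)"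
  unfolding K.lin_indep_def
proof (intro allI impI)
  fix c assume c: "\<forall>i\<in>{..<p} \<times> {..<p}. c i \<in> K"
    and 0: "(\<Sum>i\<in>{..<p} \<times> {..<p}. c i * (case i of (i, j) \<Rightarrow> field_binomial x2 i * field_binomial x1 j)) = 0"
  have sum0: "(\<Sum>i<p. \<Sum>j<p. c (i, j) * bin2 j i) = 0"
    using 0 by (simp add: sum.cartesian_product bin2_def case_prod_unfold mult_ac)
  have "c (a, b) = 0" if "a < p" "b < p" for a b
    using that
  proof (induction "2 * p - (a + b)" arbitrary: a b rule: less_induct)
    case less
    have "0 = act (monom_R b a) (\<Sum>i<p. \<Sum>j<p. c (i, j) * bin2 j i)"
      by (simp add: sum0)
    also have "\<dots> = (\<Sum>i<p. \<Sum>j<p. if i = a \<and> j = b then c (i, j) else 0)"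
      unfolding act_sum
    proof (intro sum.cong refl)
      fix i j assume ij: "i \<in> {..<p}" "j \<in> {..<p}"
      have "c (i, j) = 0" if "a \<le> i" "b \<le> j" "\<not> (i = a \<and> j = b)"
        using less.hyps[of i j] less.prems ij that by auto
      moreover have "act (monom_R b a) (c (i, j) * bin2 j i) = c (i, j) * (X1 ^^ b) ((X2 ^^ a) (bin2 j i))"
        using c ij by (simp only: act_monom_R[symmetric]) (rule act_scale, auto)
      ultimately show "act (monom_R b a) (c (i, j) * bin2 j i) = (if i = a \<and> j = b then c (i, j) else 0)"
        using ij by (auto simp: X_pow_bin2)
    qed
    also have "\<dots> = (\<Sum>i<p. if i = a then (\<Sum>j<p. if j = b then c (i, j) else 0) else 0)"
      by (intro sum.cong refl) auto
    also have "\<dots> = c (a, b)"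
      using less.prems by (simp add: sum.delta)
    finally show ?case by simp
  qed
  then show "\<forall>i\<in>{..<p} \<times> {..<p}. c i = 0"
    by auto
qed

text \<open>The degree is needed twice: as the ramification index in
  \<open>totally_ramified\<close>, and to turn an independent family of \<open>p^2\<close> elements
  into a basis.\<close>

lemma dim_eq: "ring.dim ring_of_type_algebra K (UNIV :: 'l set) = p\<^sup>2"
  using K.dim_eq_card_basis[OF _ double_binomial_lin_indep double_binomial_spanning[OF \<sigma>_x(4)]]
  by (simp add: card_cartesian_product power2_eq_square)

end

section \<open>Valuations\<close>

locale valued =
  fixes v :: "'l::field \<Rightarrow> int extended"
  assumes normalized: "normalized_valuation UNIV v"
begin

lemma v_eq_Pinf_iff [simp]: "v x = Pinf \<longleftrightarrow> x = 0"
  and v_neq_Minf [simp]: "v x \<noteq> Minf"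
  and v_mult: "v (x * y) = v x + v y"
  and v_add_min: "v (x + y) \<ge> min (v x) (v y)"
  and v_surj: "\<exists>x. v x = Fin n"
  using normalized by (simp_all add: normalized_valuation_def)

lemma v_zero [simp]: "v 0 = Pinf"
  by simp

lemma v_Fin: "x \<noteq> 0 \<Longrightarrow> \<exists>n. v x = Fin n"
  by (cases "v x") auto

lemma v_mult_Fin: "v x = Fin m \<Longrightarrow> v y = Fin n \<Longrightarrow> v (x * y) = Fin (m + n)"
  by (simp add: v_mult)

lemma v_one [simp]: "v 1 = Fin 0"
proof -
  obtain n where n: "v 1 = Fin n"
    using v_Fin[of 1] by auto
  then show ?thesis
    using v_mult[of 1 1] by simp
qed

lemma v_power: "v x = Fin n \<Longrightarrow> v (x ^ k) = Fin (int k * n)"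
  by (induction k) (simp_all add: v_mult_Fin algebra_simps)

lemma v_uminus [simp]: "v (- x) = v x"
proof (cases "x = 0")
  case False
  obtain n where n: "v (-1) = Fin n"
    using v_Fin[of "-1"] by auto
  then have "n = 0"
    using v_mult[of "-1" "-1"] by simp
  then show ?thesis
    using n v_mult[of "-1" x] by (cases "v x") auto
qed simp

lemma v_ge_cases: "v x \<ge> Fin n \<longleftrightarrow> x = 0 \<or> (\<exists>m. v x = Fin m \<and> m \<ge> n)"
  using v_Fin[of x] by (cases "x = 0") auto

lemma v_add: "v x \<ge> n \<Longrightarrow> v y \<ge> n \<Longrightarrow> v (x + y) \<ge> n"
  using v_add_min[of x y] by (meson min.bounded_iff order_trans)

lemma v_diff: "v x \<ge> n \<Longrightarrow> v y \<ge> n \<Longrightarrow> v (x - y) \<ge> n"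
  using v_add[of n x "- y"] by simp

lemma v_mono: "v x \<ge> Fin n \<Longrightarrow> m \<le> n \<Longrightarrow> v x \<ge> Fin m"
  by (metis less_eq_extended.simps(1) order_trans)

lemma v_mult_ge: "v x \<ge> Fin m \<Longrightarrow> v y \<ge> Fin n \<Longrightarrow> v (x * y) \<ge> Fin (m + n)"
  by (auto simp: v_ge_cases v_mult)

lemma v_sum: "(\<And>i. i \<in> A \<Longrightarrow> v (f i) \<ge> n) \<Longrightarrow> v (sum f A) \<ge> n"
  by (induction A rule: infinite_finite_induct) (auto intro: v_add)

lemma v_add_eq: "v x = Fin n \<Longrightarrow> v y \<ge> Fin (n + 1) \<Longrightarrow> v (x + y) = Fin n"
proof -
  assume x: "v x = Fin n" and y: "v y \<ge> Fin (n + 1)"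
  have "v (x + y) \<ge> Fin n"
    using x v_mono[OF y] by (intro v_add) auto
  moreover have "\<not> v (x + y) \<ge> Fin (n + 1)"
    using v_diff[OF _ y, of "x + y"] x by auto
  ultimately show ?thesis
    by (auto simp: v_ge_cases)
qed

lemma v_add_eq_right: "v y = Fin n \<Longrightarrow> v x \<ge> Fin (n + 1) \<Longrightarrow> v (x + y) = Fin n"
  using v_add_eq[of y n x] by (simp add: add.commute)

lemma v_inverse: "v x = Fin n \<Longrightarrow> v (inverse x) = Fin (- n)"
proof -
  assume x: "v x = Fin n"
  then have "x \<noteq> 0" by auto
  then obtain m where m: "v (inverse x) = Fin m"
    using v_Fin[of "inverse x"] by auto
  have "v (x * inverse x) = Fin (n + m)"
    using x m by (rule v_mult_Fin)
  then show ?thesis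
    using \<open>x \<noteq> 0\<close> m by simp
qed

lemma v_divide: "v x = Fin m \<Longrightarrow> v y = Fin n \<Longrightarrow> v (x / y) = Fin (m - n)"
  using v_mult_Fin[OF _ v_inverse] by (simp add: divide_inverse)

lemma v_finite_order:
  assumes "x ^ m = x" "m > 1" "x \<noteq> 0"
  shows "v x = Fin 0"
proof -
  obtain n where n: "v x = Fin n"
    using v_Fin assms by blast
  have "Fin (int m * n) = Fin n"
    using v_power[OF n, of m] assms n by simp
  then show ?thesis
    using assms n by simp
qed

text \<open>The term of least valuation dominates all others strictly. Zero terms may share the
  value \<open>Pinf\<close>, hence the restriction to \<open>t i \<noteq> 0\<close>.\<close>

lemma v_sum_distinct:
  assumes "finite I" "I \<noteq> {}" "\<And>i j. i \<in> I \<Longrightarrow> j \<in> I \<Longrightarrow> i \<noteq> j \<Longrightarrow> t i \<noteq> 0 \<Longrightarrow> v (t i) \<noteq> v (t j)"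
  obtains i where "i \<in> I" "v (sum t I) = v (t i)" "\<And>j. j \<in> I \<Longrightarrow> v (t i) \<le> v (t j)"
proof -
  have "Min ((\<lambda>i. v (t i)) ` I) \<in> (\<lambda>i. v (t i)) ` I"
    using assms by (intro Min_in) auto
  then obtain i where i: "i \<in> I" "v (t i) = Min ((\<lambda>i. v (t i)) ` I)"
    by auto
  have min: "v (t i) \<le> v (t j)" if "j \<in> I" for j
    unfolding i(2) using assms that by (intro Min_le) auto
  have "v (sum t I) = v (t i)"
  proof (cases "t i = 0")
    case True
    then have "t j = 0" if "j \<in> I" for j
      using min[OF that] True by simp
    then show ?thesis
      using i by simp
  next
    case False
    then obtain n where n: "v (t i) = Fin n"
      using v_Fin by blast
    have "v (sum t (I - {i})) \<ge> Fin (n + 1)"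
    proof (rule v_sum)
      fix j assume j: "j \<in> I - {i}"
      then have "v (t j) \<noteq> Fin n" "v (t j) \<ge> Fin n"
        using assms(3)[of i j] False i min[of j] n by auto
      then show "v (t j) \<ge> Fin (n + 1)"
        by (auto simp: v_ge_cases)
    qed
    then have "v (t i + sum t (I - {i})) = Fin n"
      by (rule v_add_eq[OF n])
    then show ?thesis
      using assms(1) i(1) n by (simp add: sum.remove)
  qed
  then show ?thesis
    using that i(1) min by blast
qed

text \<open>Finite thresholds instead of \<open>v (T y) \<ge> v y + r\<close> cover
  \<open>y = 0\<close> and avoid arithmetic with \<open>Pinf\<close>.\<close>

definition raises :: "int \<Rightarrow> ('l \<Rightarrow> 'l) \<Rightarrow> bool" where
  "raises r T \<longleftrightarrow> (\<forall>n y. v y \<ge> Fin n \<longrightarrow> v (T y) \<ge> Fin (n + r))"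

lemma raisesD: "raises r T \<Longrightarrow> v y \<ge> Fin n \<Longrightarrow> v (T y) \<ge> Fin (n + r)"
  by (simp add: raises_def)

lemma raises_mono: "raises r T \<Longrightarrow> s \<le> r \<Longrightarrow> raises s T"
  unfolding raises_def by (meson add_left_mono v_mono)

lemma raises_comp: "raises r T \<Longrightarrow> raises s U \<Longrightarrow> raises (r + s) (\<lambda>y. T (U y))"
proof -
  assume T: "raises r T" and U: "raises s U"
  have "v (T (U y)) \<ge> Fin (n + (r + s))" if "v y \<ge> Fin n" for n y
    using raisesD[OF T raisesD[OF U that]] by (simp add: algebra_simps)
  then show ?thesis by (simp add: raises_def)
qed

lemma raises_add: "raises r T \<Longrightarrow> raises r U \<Longrightarrow> raises r (\<lambda>y. T y + U y)"
  by (simp add: raises_def v_add)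

lemma raises_sum: "(\<And>i. i \<in> A \<Longrightarrow> raises r (T i)) \<Longrightarrow> raises r (\<lambda>y. \<Sum>i\<in>A. T i y)"
  by (simp add: raises_def v_sum)

lemma raises_scale: "v c \<ge> Fin 0 \<Longrightarrow> raises r T \<Longrightarrow> raises r (\<lambda>y. c * T y)"
proof -
  assume c: "v c \<ge> Fin 0" and T: "raises r T"
  have "v (c * T y) \<ge> Fin (n + r)" if "v y \<ge> Fin n" for n y
    using v_mult_ge[OF c raisesD[OF T that]] by simp
  then show ?thesis by (simp add: raises_def)
qed

lemma raises_pow: "raises r T \<Longrightarrow> raises (int i * r) (T ^^ i)"
proof (induction i)
  case 0 show ?case by (simp add: raises_def)
next
  case (Suc i)
  then show ?case
    using raises_comp[of r T "int i * r" "T ^^ i"] by (simp add: comp_def algebra_simps)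
qed

end

section \<open>K-linear operators and bases whose valuations are distinct modulo the ramification
  index\<close>

locale totally_ramified_over = valued v + K: type_subfield K
  for v :: "'l::field \<Rightarrow> int extended" and K :: "'l set" +
  fixes N :: int
  assumes N_pos: "N > 0" and v_K: "c \<in> K \<Longrightarrow> c \<noteq> 0 \<Longrightarrow> \<exists>m. v c = Fin (N * m)"
begin

definition K_linear :: "('l \<Rightarrow> 'l) \<Rightarrow> bool" where
  "K_linear T \<longleftrightarrow> (\<forall>x y. T (x + y) = T x + T y) \<and> (\<forall>c\<in>K. \<forall>y. T (c * y) = c * T y)"

lemma K_linear_sum: "K_linear T \<Longrightarrow> T (sum f A) = (\<Sum>i\<in>A. T (f i))"
proof -
  assume T: "K_linear T"
  then have "T 0 = 0"
    using K.zero_in unfolding K_linear_def by (metis mult_zero_left)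
  then show ?thesis
    using T by (induction A rule: infinite_finite_induct) (auto simp: K_linear_def)
qed

text \<open>Coefficients from \<open>K\<close> change valuations only by multiples of
  \<open>N\<close>, so distinct residues modulo \<open>N\<close> exclude any cancellation in a
  \<open>K\<close>-linear combination.\<close>

definition valued_family :: "'i set \<Rightarrow> ('i \<Rightarrow> 'l) \<Rightarrow> ('i \<Rightarrow> int) \<Rightarrow> bool" where
  "valued_family I w e \<longleftrightarrow> finite I \<and> (\<forall>i\<in>I. v (w i) = Fin (e i)) \<and> inj_on (\<lambda>i. e i mod N) I"

lemma v_term:
  assumes "valued_family I w e" "i \<in> I" "c \<in> K" "c \<noteq> 0"
  obtains m where "v c = Fin (N * m)" "v (c * w i) = Fin (N * m + e i)"
proof -
  obtain m where m: "v c = Fin (N * m)"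
    using v_K[OF assms(3,4)] by blast
  moreover have "v (w i) = Fin (e i)"
    using assms by (simp add: valued_family_def)
  ultimately show ?thesis
    using that v_mult_Fin by blast
qed

lemma valued_terms_distinct:
  assumes "valued_family I w e" "i \<in> I" "j \<in> I" "i \<noteq> j" "c \<in> K" "d \<in> K" "c * w i \<noteq> 0"
  shows "v (c * w i) \<noteq> v (d * w j)"
proof
  assume eq: "v (c * w i) = v (d * w j)"
  have "d \<noteq> 0" "c \<noteq> 0"
    using assms(7) eq v_eq_Pinf_iff[of "c * w i"] by auto
  obtain m where m: "v (c * w i) = Fin (N * m + e i)"
    using v_term[OF assms(1,2,5) \<open>c \<noteq> 0\<close>] by blast
  obtain n where n: "v (d * w j) = Fin (N * n + e j)"
    using v_term[OF assms(1,3,6) \<open>d \<noteq> 0\<close>] by blast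
  have "(N * m + e i) mod N = (N * n + e j) mod N"
    using m n eq by simp
  then have "e i mod N = e j mod N"
    by simp
  then show False
    using assms by (auto simp: valued_family_def inj_on_def)
qed

lemma valued_family_sum:
  assumes "valued_family I w e" "I \<noteq> {}" "\<And>i. i \<in> I \<Longrightarrow> c i \<in> K"
  obtains i where "i \<in> I" "v (\<Sum>i\<in>I. c i * w i) = v (c i * w i)"
    "\<And>j. j \<in> I \<Longrightarrow> v (c i * w i) \<le> v (c j * w j)"
proof -
  have "finite I"
    using assms(1) by (simp add: valued_family_def)
  moreover have "v (c i * w i) \<noteq> v (c j * w j)" if "i \<in> I" "j \<in> I" "i \<noteq> j" "c i * w i \<noteq> 0" for i j
    by (rule valued_terms_distinct[OF assms(1) that(1-3) assms(3)[OF that(1)] assms(3)[OF that(2)] that(4)])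
  ultimately obtain i where "i \<in> I" "v (\<Sum>i\<in>I. c i * w i) = v (c i * w i)"
    "\<And>j. j \<in> I \<Longrightarrow> v (c i * w i) \<le> v (c j * w j)"
    using v_sum_distinct[of I "\<lambda>i. c i * w i", OF _ assms(2)] by auto
  then show ?thesis
    by (rule that)
qed

lemma valued_family_lin_indep:
  assumes "valued_family I w e"
  shows "K.lin_indep I w"
  unfolding K.lin_indep_def
proof (intro allI impI ballI)
  fix c i assume c: "\<forall>i\<in>I. c i \<in> K" "(\<Sum>i\<in>I. c i * w i) = 0" and i: "i \<in> I"
  then have "I \<noteq> {}" by auto
  obtain j where j: "j \<in> I" "v (\<Sum>i\<in>I. c i * w i) = v (c j * w j)"
    "\<And>l. l \<in> I \<Longrightarrow> v (c j * w j) \<le> v (c l * w l)"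
    using valued_family_sum[OF assms \<open>I \<noteq> {}\<close>, of c] c(1) by blast
  then have "v (c i * w i) = Pinf"
    using c(2) j(3)[OF i] by simp
  moreover have "w i \<noteq> 0"
    using assms i by (auto simp: valued_family_def)
  ultimately show "c i = 0"
    by simp
qed

text \<open>Without cancellation every term \<open>c i * w i\<close> of \<open>y\<close> has
  valuation at least that of \<open>y\<close>, so the bound may be checked term by term.\<close>

lemma raises_if_raises_basis:
  assumes w: "valued_family I w e" "K.spanning I w" and T: "K_linear T"
    and "\<And>i. i \<in> I \<Longrightarrow> v (T (w i)) \<ge> Fin (e i + r)"
  shows "raises r T"
  unfolding raises_def
proof (intro allI impI)
  fix n y assume y: "v y \<ge> Fin n"
  obtain c where c: "\<forall>i\<in>I. c i \<in> K" "y = (\<Sum>i\<in>I. c i * w i)"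
    using w(2) unfolding K.spanning_def by blast
  show "v (T y) \<ge> Fin (n + r)"
  proof (cases "I = {}")
    case True
    then show ?thesis
      using c K_linear_sum[OF T, of "\<lambda>_. 0" "{}"] by simp
  next
    case False
    have Ty: "T y = (\<Sum>i\<in>I. c i * T (w i))"
      unfolding c(2) K_linear_sum[OF T] using T c(1) by (simp add: K_linear_def)
    show ?thesis
      unfolding Ty
    proof (rule v_sum)
      fix i assume i: "i \<in> I"
      obtain j where j: "j \<in> I" "v y = v (c j * w j)" "\<And>l. l \<in> I \<Longrightarrow> v (c j * w j) \<le> v (c l * w l)"
        using valued_family_sum[OF w(1) False, of c] c by blast
      have ci: "v (c i * w i) \<ge> Fin n"
        using y j(2) j(3)[OF i] by simp
      show "v (c i * T (w i)) \<ge> Fin (n + r)"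
      proof (cases "c i = 0")
        case False
        obtain m where m: "v (c i) = Fin (N * m)" "v (c i * w i) = Fin (N * m + e i)"
          using v_term[OF w(1) i _ False] c(1) i by blast
        have "v (c i * T (w i)) \<ge> Fin (N * m + (e i + r))"
          using m(1) assms(4)[OF i] by (intro v_mult_ge) auto
        then show ?thesis
          using m(2) ci by (auto elim!: v_mono)
      qed simp
    qed
  qed
qed

text \<open>The residue of \<open>n\<close> modulo \<open>N\<close> decides which basis element
  carries the leading term.\<close>

lemma leading_term:
  assumes w: "valued_family I w e" "K.spanning I w"
    and y: "v y = Fin n" and i: "i \<in> I" "n mod N = e i mod N"
  obtains c where "c \<in> K" "v (c * w i) = Fin n" "v (y - c * w i) \<ge> Fin (n + 1)"
proof -
  obtain c where c: "\<forall>i\<in>I. c i \<in> K" "y = (\<Sum>i\<in>I. c i * w i)"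
    using w(2) unfolding K.spanning_def by blast
  have fin: "finite I"
    using w(1) by (simp add: valued_family_def)
  have "I \<noteq> {}" using i by auto
  then obtain j where j: "j \<in> I" "v y = v (c j * w j)" "\<And>l. l \<in> I \<Longrightarrow> v (c j * w j) \<le> v (c l * w l)"
    using valued_family_sum[OF w(1), of c] c by blast
  have "c j \<noteq> 0"
    using j(2) y by auto
  then obtain m where "v (c j * w j) = Fin (N * m + e j)"
    using v_term[OF w(1) j(1)] c(1) j(1) by blast
  then have "n = N * m + e j"
    using j(2) y by simp
  then have "e j mod N = e i mod N"
    using i(2) by simp
  then have "j = i"
    using w(1) i(1) j(1) by (auto simp: valued_family_def inj_on_def)
  have "y - c i * w i = (\<Sum>l\<in>I - {i}. c l * w l)"
    unfolding c(2) using fin i(1) by (simp add: sum.remove)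
  moreover have "v (\<Sum>l\<in>I - {i}. c l * w l) \<ge> Fin (n + 1)"
  proof (rule v_sum)
    fix l assume l: "l \<in> I - {i}"
    have "c i * w i \<noteq> 0"
      using j(2) y \<open>j = i\<close> by auto
    then have "v (c i * w i) \<noteq> v (c l * w l)"
      using valued_terms_distinct[OF w(1), of i l "c i" "c l"] l i c(1) by auto
    then show "v (c l * w l) \<ge> Fin (n + 1)"
      using j(3)[of l] l y j(2) \<open>j = i\<close> by (auto simp: v_ge_cases)
  qed
  ultimately show ?thesis
    using that[of "c i"] c(1) i(1) j(2) y \<open>j = i\<close> by simp
qed

text \<open>Only the image of the leading term matters: the remainder starts at valuation
  \<open>n + 1\<close> and gains at least \<open>r\<close> as well. One exact value on the basis
  thus settles a whole residue class.\<close>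

lemma raises_exact:
  assumes w: "valued_family I w e" "K.spanning I w" and T: "K_linear T" "raises r T"
    and i: "i \<in> I" "v (T (w i)) = Fin (e i + r)"
    and y: "v y = Fin n" "n mod N = e i mod N"
  shows "v (T y) = Fin (n + r)"
proof -
  obtain c where c: "c \<in> K" "v (c * w i) = Fin n" "v (y - c * w i) \<ge> Fin (n + 1)"
    using leading_term[OF w y(1) i(1) y(2)] by blast
  then have "c \<noteq> 0" by auto
  obtain m where m: "v c = Fin (N * m)" "v (c * w i) = Fin (N * m + e i)"
    using v_term[OF w(1) i(1) c(1) \<open>c \<noteq> 0\<close>] by blast
  have "v (c * T (w i)) = Fin (n + r)"
    using v_mult_Fin[OF m(1) i(2)] m(2) c(2) by (simp add: algebra_simps)
  moreover have "v (T (y - c * w i)) \<ge> Fin (n + r + 1)"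
    using raisesD[OF T(2) c(3)] by (simp add: algebra_simps)
  moreover have "T y = c * T (w i) + T (y - c * w i)"
  proof -
    have "T ((y - c * w i) + c * w i) = T (y - c * w i) + T (c * w i)"
      using T(1) unfolding K_linear_def by blast
    then show ?thesis
      using T(1) c(1) unfolding K_linear_def by (simp add: add.commute)
  qed
  ultimately show ?thesis
    using v_add_eq by simp
qed

end

section \<open>The valuation on the bicyclic extension; the break is prime to p\<close>

locale ramified_bicyclic = bicyclic p K F \<sigma>1 \<sigma>2 x1 x2 + totally_ramified_over v K "(int p)\<^sup>2"
  for p :: nat and K F :: "'l::field set" and \<sigma>1 \<sigma>2 :: "'l \<Rightarrow> 'l" and x1 x2 :: 'l
    and v :: "'l \<Rightarrow> int extended" +
  assumes finite_dim: "ring.finite_dimension ring_of_type_algebra K (UNIV :: 'l set)"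
    and v_F: "c \<in> F \<Longrightarrow> c \<noteq> 0 \<Longrightarrow> v c = Fin 0"
begin

lemma v_of_nat: "\<not> p dvd n \<Longrightarrow> v (of_nat n) = Fin 0"
  by (rule v_finite_order[of _ p]) (use p_gt_1 of_nat_power_p of_nat_eq_0_iff in auto)

lemma v_F_ge: "c \<in> F \<Longrightarrow> v c \<ge> Fin 0"
  using v_F by (cases "c = 0") auto

lemma galois_K_linear: "g \<in> carrier G \<Longrightarrow> K_linear (\<lambda>y. g y - y)"
  by (simp add: K_linear_def galois_apply right_diff_distrib)

text \<open>
  If \<open>p\<close> divided \<open>b\<close>, then \<open>(g - 1) ^ i\<close> would raise the valuation of a uniformizer by exactly \<open>ib\<close> for
  all \<open>i\<close>, although \<open>(g - 1) ^ p = 0\<close>.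
\<close>

lemma break_not_dvd:
  fixes b :: int
  assumes b: "b > 0" and g: "g \<in> ramification_group K v b" "g \<notin> ramification_group K v (b + 1)"
  shows "\<not> int p dvd b"
proof
  assume dvd: "int p dvd b"
  have gG: "g \<in> carrier G"
    using g(1) by (simp add: ramification_group_def)
  let ?D = "\<lambda>y. g y - y"
  obtain \<pi> where \<pi>: "v \<pi> = Fin 1"
    using v_surj by blast
  \<comment> \<open>Powers of a uniformizer represent every residue modulo \<open>p^2\<close> once,
    so by \<open>dim_eq\<close> they form a \<open>K\<close>-basis.\<close>
  let ?I = "{..<p\<^sup>2}" and ?w = "\<lambda>j. \<pi> ^ j" and ?e = "\<lambda>j. int j"
  have fam: "valued_family ?I ?w ?e"
    unfolding valued_family_def
  proof (intro conjI ballI)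
    show "v (\<pi> ^ j) = Fin (int j)" for j
      using v_power[OF \<pi>] by simp
    show "inj_on (\<lambda>i. int i mod (int p)\<^sup>2) ?I"
    proof (rule inj_onI)
      fix i j assume ij: "i \<in> ?I" "j \<in> ?I" "int i mod (int p)\<^sup>2 = int j mod (int p)\<^sup>2"
      then have "int i < (int p)\<^sup>2" "int j < (int p)\<^sup>2"
        by (auto simp: of_nat_less_iff[symmetric] simp del: of_nat_less_iff)
      then show "i = j"
        using ij by simp
    qed
  qed simp
  have span: "K.spanning ?I ?w"
    by (rule K.spanning_if_card_eq_dim[OF finite_dim _ valued_family_lin_indep[OF fam]]) (simp_all add: dim_eq)
  have D_pi: "v (?D \<pi>) \<ge> Fin (b + 1)"
    using g(1) \<pi> by (simp add: ramification_group_def zero_extended_def)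
  have g_pi: "v (g \<pi>) = Fin 1"
    using v_add_eq[OF \<pi>, of "?D \<pi>"] v_mono[OF D_pi, of 2] b by simp
  have D_pow: "?D (\<pi> ^ j) = ?D \<pi> * (\<Sum>l<j. \<pi> ^ (j - Suc l) * g \<pi> ^ l)" for j
    using power_diff_sumr2[of "g \<pi>" j \<pi>] by (simp add: K.galois_power[OF gG])
  have term_ge: "v (\<pi> ^ (j - Suc l) * g \<pi> ^ l) \<ge> Fin (int j - 1)" if "l < j" for j l
    using v_mult_Fin[OF v_power[OF \<pi>, of "j - Suc l"] v_power[OF g_pi, of l]] that
    by (simp add: of_nat_diff)
  have D_pow_ge: "v (?D (\<pi> ^ j)) \<ge> Fin (r + (int j - 1))" if "v (?D \<pi>) \<ge> Fin r" for j r
    unfolding D_pow by (intro v_mult_ge that v_sum term_ge) simp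
  \<comment> \<open>A larger value would move every integral element by at least
    \<open>b + 2\<close> and put \<open>g\<close> into the next ramification group.\<close>
  have D_pi_eq: "v (?D \<pi>) = Fin (b + 1)"
  proof (rule ccontr)
    assume "v (?D \<pi>) \<noteq> Fin (b + 1)"
    then have ge2: "v (?D \<pi>) \<ge> Fin (b + 2)"
      using D_pi by (auto simp: v_ge_cases)
    have "v (?D y) \<ge> Fin (b + 1 + 1)" if y: "v y \<ge> Fin 0" for y
    proof -
      obtain c where c: "\<forall>i\<in>?I. c i \<in> K" "y = (\<Sum>i\<in>?I. c i * ?w i)"
        using span unfolding K.spanning_def by blast
      have "0 \<in> ?I"
        using p_pos by simp
      then have "?I \<noteq> {}"
        by blast
      then obtain i where i: "i \<in> ?I" "v y = v (c i * ?w i)"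
        "\<And>l. l \<in> ?I \<Longrightarrow> v (c i * ?w i) \<le> v (c l * ?w l)"
        using valued_family_sum[OF fam, of c] c by blast
      have Dy: "?D y = (\<Sum>i\<in>?I. c i * ?D (?w i))"
        using K_linear_sum[OF galois_K_linear[OF gG], of "\<lambda>i. c i * ?w i" ?I] c
          galois_K_linear[OF gG] by (simp add: K_linear_def)
      show ?thesis
        unfolding Dy
      proof (rule v_sum)
        fix j assume j: "j \<in> ?I"
        show "v (c j * ?D (?w j)) \<ge> Fin (b + 1 + 1)"
        proof (cases "c j = 0 \<or> j = 0")
          case False
          then have "c j \<noteq> 0" by simp
          then obtain m where m: "v (c j) = Fin ((int p)\<^sup>2 * m)" "v (c j * ?w j) = Fin ((int p)\<^sup>2 * m + int j)"
            using v_term[OF fam j] c(1) j by blast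
          have "(int p)\<^sup>2 * m + int j \<ge> 0"
            using i(2) i(3)[OF j] y m(2) by (metis less_eq_extended.simps(1) order_trans)
          moreover have "int j < (int p)\<^sup>2"
            using j by (auto simp: of_nat_less_iff[symmetric] simp del: of_nat_less_iff)
          ultimately have "(int p)\<^sup>2 * m > - (int p)\<^sup>2"
            by linarith
          then have "(int p)\<^sup>2 * m > (int p)\<^sup>2 * (-1)"
            by simp
          then have "m \<ge> 0"
            using p_pos by (simp only: mult_less_cancel_left_pos zero_less_power of_nat_0_less_iff)
          then have "v (c j) \<ge> Fin 0"
            using m(1) by simp
          then have "v (c j * ?D (?w j)) \<ge> Fin (0 + (b + 2 + (int j - 1)))"
            by (intro v_mult_ge D_pow_ge ge2)
          then show ?thesis
            by (rule v_mono) (use False in auto)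
        qed (auto simp: galois_apply[OF gG])
      qed
    qed
    then have "g \<in> ramification_group K v (b + 1)"
      using gG by (auto simp: ramification_group_def zero_extended_def)
    then show False
      using g(2) by contradiction
  qed
  have raise: "raises b ?D"
    by (rule raises_if_raises_basis[OF fam span galois_K_linear[OF gG]])
      (use D_pow_ge[OF D_pi] in \<open>simp add: algebra_simps\<close>)
  \<comment> \<open>\<open>D (\<pi> ^ j)\<close> is \<open>D \<pi>\<close> times a sum of
    \<open>j\<close> products, each equal to \<open>\<pi> ^ (j - 1)\<close> up to terms of larger
    valuation; \<open>j\<close> is a unit when \<open>p\<close> does not divide it.\<close>
  have exact: "v (?D (\<pi> ^ j)) = Fin (int j + b)" if "\<not> p dvd j" for j
  proof -
    have "j \<noteq> 0"
      using that by (cases j) auto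
    have "(\<Sum>l<j. \<pi> ^ (j - Suc l) * g \<pi> ^ l) = (\<Sum>l<j. \<pi> ^ (j - Suc l) * (\<pi> ^ l + ?D (\<pi> ^ l)))"
      by (simp add: K.galois_power[OF gG])
    also have "\<dots> = (\<Sum>l<j. \<pi> ^ (j - 1) + \<pi> ^ (j - Suc l) * ?D (\<pi> ^ l))"
    proof (intro sum.cong refl)
      fix l assume "l \<in> {..<j}"
      then have "\<pi> ^ (j - Suc l) * \<pi> ^ l = \<pi> ^ (j - 1)"
        by (simp flip: power_add)
      then show "\<pi> ^ (j - Suc l) * (\<pi> ^ l + ?D (\<pi> ^ l)) = \<pi> ^ (j - 1) + \<pi> ^ (j - Suc l) * ?D (\<pi> ^ l)"
        by (simp only: distrib_left)
    qed
    also have "\<dots> = of_nat j * \<pi> ^ (j - 1) + (\<Sum>l<j. \<pi> ^ (j - Suc l) * ?D (\<pi> ^ l))"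
      by (simp only: sum.distrib) simp
    finally have sum_eq: "(\<Sum>l<j. \<pi> ^ (j - Suc l) * g \<pi> ^ l) = \<dots>" .
    have "v (of_nat j * \<pi> ^ (j - 1)) = Fin (0 + int (j - 1))"
      using v_power[OF \<pi>, of "j - 1"] by (intro v_mult_Fin v_of_nat that) simp
    moreover have "v (\<Sum>l<j. \<pi> ^ (j - Suc l) * ?D (\<pi> ^ l)) \<ge> Fin (0 + int (j - 1) + 1)"
    proof (rule v_sum)
      fix l assume l: "l \<in> {..<j}"
      have "v (\<pi> ^ (j - Suc l) * ?D (\<pi> ^ l)) \<ge> Fin (int (j - Suc l) + (b + 1 + (int l - 1)))"
        using v_power[OF \<pi>, of "j - Suc l"] by (intro v_mult_ge D_pow_ge D_pi) simp
      then show "v (\<pi> ^ (j - Suc l) * ?D (\<pi> ^ l)) \<ge> Fin (0 + int (j - 1) + 1)"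
        by (rule v_mono) (use l b in \<open>auto simp: of_nat_diff\<close>)
    qed
    ultimately have "v (\<Sum>l<j. \<pi> ^ (j - Suc l) * g \<pi> ^ l) = Fin (0 + int (j - 1))"
      unfolding sum_eq by (rule v_add_eq)
    then have "v (?D (\<pi> ^ j)) = Fin (b + 1 + (0 + int (j - 1)))"
      unfolding D_pow by (intro v_mult_Fin D_pi_eq)
    then show ?thesis
      using \<open>j \<noteq> 0\<close> by (simp add: of_nat_diff)
  qed
  have step: "v (?D y) = Fin (n + b)" if y: "v y = Fin n" and n: "\<not> int p dvd n" for y n
  proof -
    define j where "j = nat (n mod (int p)\<^sup>2)"
    have j: "int j = n mod (int p)\<^sup>2"
      using p_pos by (simp add: j_def)
    have "int p dvd (int p)\<^sup>2"
      by (simp add: power2_eq_square)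
    then have "int p dvd int j \<longleftrightarrow> int p dvd n"
      unfolding j by (rule dvd_mod_iff)
    then have "\<not> p dvd j"
      using n by (simp add: int_dvd_int_iff)
    moreover have "int j < (int p)\<^sup>2"
      using p_pos by (simp add: j)
    then have "j \<in> ?I"
      by (auto simp: of_nat_less_iff[symmetric] simp del: of_nat_less_iff)
    ultimately show ?thesis
      using raises_exact[OF fam span galois_K_linear[OF gG] raise _ exact y] by (simp add: j)
  qed
  have "v ((?D ^^ i) \<pi>) = Fin (1 + int i * b)" for i
  proof (induction i)
    case 0 show ?case using \<pi> by simp
  next
    case (Suc i)
    have "\<not> int p dvd 1 + int i * b"
    proof
      assume "int p dvd 1 + int i * b"
      then have "int p dvd 1"
        using dvd by (metis dvd_add_left_iff dvd_mult)
      then show False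
        using p_gt_1 by simp
    qed
    then show ?case
      using step[OF Suc] by (simp add: algebra_simps)
  qed
  then have "v 0 = Fin (1 + int p * b)"
    using galois_minus_one_pow_p[OF gG, of \<pi>] by metis
  then show False by simp
qed

end

section \<open>A generator of valuation \<open>-b\<close>\<close>

text \<open>Everything is measured by the valuation of \<open>L\<close>, so values from
  \<open>K\<close> appear multiplied by \<open>p^2\<close>. Independence of \<open>1\<close> and
  \<open>\<omega>\<close> over the prime field takes the form
  \<open>\<omega> ^ p \<noteq> \<omega>\<close>.\<close>

locale artin_schreier_tower = ramified_bicyclic p K F \<sigma>1 \<sigma>2 x1 x2 v
  for p :: nat and K F :: "'l::field set" and \<sigma>1 \<sigma>2 :: "'l \<Rightarrow> 'l" and x1 x2 :: 'l
    and v :: "'l \<Rightarrow> int extended" +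
  fixes b :: int and \<beta> \<omega> \<epsilon> :: 'l
  assumes b_pos: "b > 0" and b_not_dvd: "\<not> int p dvd b"
    and \<beta>: "\<beta> \<in> K" "v \<beta> = Fin (- b * (int p)\<^sup>2)"
    and \<omega>: "\<omega> \<in> F" "\<omega> ^ p \<noteq> \<omega>" and \<epsilon>_in: "\<epsilon> \<in> K"
    and x1_eq: "x1 ^ p - x1 = \<beta>" and x2_eq: "x2 ^ p - x2 = \<omega> ^ p\<^sup>2 * \<beta> + \<epsilon>"
    and residue: "\<And>y. y \<in> K \<Longrightarrow> v y \<ge> Fin 0 \<Longrightarrow> \<exists>a\<in>F. v (y - a) \<ge> Fin 1"
    and perfect: "\<And>a. a \<in> F \<Longrightarrow> \<exists>c\<in>F. c ^ p = a"
    and v_K_surj: "\<And>n. \<exists>t\<in>K. v t = Fin ((int p)\<^sup>2 * n)"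
begin

text \<open>An integral \<open>z\<close> would make \<open>z ^ p - z\<close> integral; so
  \<open>v z < 0\<close>, and then \<open>z ^ p\<close> dominates \<open>z\<close>.\<close>

lemma v_artin_schreier:
  assumes "v (z ^ p - z) = Fin (- (c * int p))" "c > 0"
  shows "v z = Fin (- c)"
proof -
  have "z \<noteq> 0"
  proof
    assume "z = 0"
    then show False
      using assms(1) by (simp add: zero_power[OF p_pos])
  qed
  then obtain n where n: "v z = Fin n"
    using v_Fin by blast
  have zp: "v (z ^ p) = Fin (int p * n)"
    using n by (rule v_power)
  have "n < 0"
  proof (rule ccontr)
    assume "\<not> n < 0"
    then have "v (z ^ p - z) \<ge> Fin 0"
      using n zp by (intro v_diff) auto
    then have "c * int p \<le> 0"
      using assms(1) by simp
    moreover have "c * int p > 0"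
      using assms(2) p_pos by simp
    ultimately show False by simp
  qed
  then have "int p * n < 1 * n"
    using p_gt_1 by (intro mult_strict_right_mono_neg) auto
  then have "v (z ^ p + - z) = Fin (int p * n)"
    using zp n by (intro v_add_eq) auto
  then have "int p * n = int p * (- c)"
    using assms(1) by (simp add: mult.commute)
  then have "n = - c"
    using p_pos by (simp only: mult_cancel_left of_nat_eq_0_iff) simp
  then show ?thesis
    using n by simp
qed

lemma v_x1: "v x1 = Fin (- (b * int p))"
  by (rule v_artin_schreier) (use x1_eq \<beta>(2) b_pos p_pos in \<open>simp_all add: power2_eq_square\<close>)

lemma bp_pos: "b * int p > 0"
  using b_pos p_pos by simp

text \<open>The leading term is \<open>of_nat i * x1 ^ (i - 1)\<close>, because lower powers of
  \<open>x1\<close> have larger valuation. The first claim later yields the exact valuation for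
  \<open>i\<close> prime to \<open>p\<close>; the second is the bound for all
  \<open>i > 0\<close>.\<close>

lemma v_x1_power_diff:
  assumes "i > 0"
  shows "v ((x1 + 1) ^ i - x1 ^ i - of_nat i * x1 ^ (i - 1)) \<ge> Fin (- (b * int p) * int (i - 1) + 1)"
    and "v ((x1 + 1) ^ i - x1 ^ i) \<ge> Fin (- (b * int p) * int (i - 1))"
proof -
  let ?f = "\<lambda>i. (x1 + 1) ^ i - x1 ^ i"
  have of_nat_ge: "v (of_nat j) \<ge> Fin 0" for j
    using v_F_ge F.of_nat_in by blast
  have weak: "v (?f i) \<ge> Fin (- (b * int p) * int (i - 1))"
    if "v (?f i - of_nat i * x1 ^ (i - 1)) \<ge> Fin (- (b * int p) * int (i - 1) + 1)" for i
  proof -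
    have "v (of_nat i * x1 ^ (i - 1)) \<ge> Fin (0 + int (i - 1) * (- (b * int p)))"
      using v_power[OF v_x1, of "i - 1"] by (intro v_mult_ge of_nat_ge) simp
    then have "v (of_nat i * x1 ^ (i - 1)) \<ge> Fin (- (b * int p) * int (i - 1))"
      by (simp add: mult.commute)
    then have "v ((?f i - of_nat i * x1 ^ (i - 1)) + of_nat i * x1 ^ (i - 1)) \<ge> Fin (- (b * int p) * int (i - 1))"
      by (intro v_add v_mono[OF that]) simp_all
    then show ?thesis by simp
  qed
  show main: "v (?f i - of_nat i * x1 ^ (i - 1)) \<ge> Fin (- (b * int p) * int (i - 1) + 1)"
    using assms
  proof (induction i rule: nat_induct_non_zero)
    case 1 show ?case by simp
  next
    case (Suc n)
    obtain m where m: "n = Suc m"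
      using Suc.hyps by (cases n) auto
    have eq: "?f (Suc n) - of_nat (Suc n) * x1 ^ (Suc n - 1) = x1 * (?f n - of_nat n * x1 ^ (n - 1)) + ?f n"
      by (simp add: m algebra_simps)
    have "v (x1 * (?f n - of_nat n * x1 ^ (n - 1))) \<ge> Fin (- (b * int p) + (- (b * int p) * int (n - 1) + 1))"
      using v_x1 Suc.IH by (intro v_mult_ge) auto
    moreover have "- (b * int p) + (- (b * int p) * int (n - 1) + 1) = - (b * int p) * int (Suc n - 1) + 1"
      by (simp add: m algebra_simps)
    ultimately have "v (x1 * (?f n - of_nat n * x1 ^ (n - 1))) \<ge> Fin (- (b * int p) * int (Suc n - 1) + 1)"
      by (simp only:)
    moreover have "v (?f n) \<ge> Fin (- (b * int p) * int (Suc n - 1) + 1)"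
      by (rule v_mono[OF weak[OF Suc.IH]]) (use bp_pos in \<open>simp add: m algebra_simps\<close>)
    ultimately show ?case
      unfolding eq by (rule v_add)
  qed
  show "v (?f i) \<ge> Fin (- (b * int p) * int (i - 1))"
    by (rule weak[OF main])
qed

lemma coprime_b_p: "coprime b (int p)"
proof -
  have "Factorial_Ring.prime (int p)"
    using prime_p by simp
  then have "coprime (int p) b"
    using b_not_dvd by (rule prime_imp_coprime)
  then show ?thesis
    by (simp add: coprime_commute)
qed

text \<open>Since \<open>b\<close> is invertible modulo \<open>p\<close>, every \<open>-M\<close> is
  the valuation in \<open>K\<close> of some \<open>t ^ p * \<beta> ^ i\<close> with
  \<open>i < p\<close>, where \<open>t\<close> has valuation \<open>r\<close>.\<close>

lemma exists_residue_index:
  obtains i r where "i < p" "int p * r = b * int i - M"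
proof -
  obtain u w where "u * b + w * int p = gcd b (int p)"
    using bezout_int by blast
  then have uw: "u * b + w * int p = 1"
    using coprime_b_p by simp
  define q where "q = (u * M) div int p"
  define i where "i = nat ((u * M) mod int p)"
  have i: "int i = u * M - int p * q" "i < p"
    using p_pos by (auto simp: i_def q_def nat_less_iff minus_mult_div_eq_mod)
  have "b * int i - M = (u * b + w * int p) * M - M - int p * (w * M + b * q)"
    by (simp add: i(1) algebra_simps)
  then have "int p * (- (w * M + b * q)) = b * int i - M"
    unfolding uw by (simp add: algebra_simps)
  then show ?thesis
    using that i(2) by blast
qed

text \<open>Induction on a bound \<open>m\<close> for the pole order of \<open>e\<close>. A leading
  term \<open>\<mu> ^ p * \<beta> ^ i\<close> is matched by \<open>\<mu> * x1 ^ i\<close>, since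
  \<open>x1 ^ p = x1 + \<beta>\<close>. Under \<open>\<sigma>1 - 1\<close> this becomes
  \<open>i * \<mu> * x1 ^ (i - 1)\<close> to leading order, of valuation \<open>p (b - m)\<close>,
  and contributions of smaller pole order have larger valuation. The exact value requires
  \<open>i \<noteq> 0\<close>, that is, \<open>m\<close> prime to \<open>p\<close>.\<close>

lemma approximate_p_th_root:
  assumes "e \<in> K" "v e \<ge> Fin (- ((int p)\<^sup>2 * int m))" "int m < b"
  shows "\<exists>\<alpha>. \<sigma>2 \<alpha> = \<alpha> \<and> v \<alpha> \<ge> Fin (- (int p * int m)) \<and> v (\<alpha> ^ p - e) \<ge> Fin (- (b * int p) + 1) \<and>
    v (\<sigma>1 \<alpha> - \<alpha>) \<ge> Fin (int p * (b - int m)) \<and>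
    (v e = Fin (- ((int p)\<^sup>2 * int m)) \<and> \<not> p dvd m \<longrightarrow> v (\<sigma>1 \<alpha> - \<alpha>) = Fin (int p * (b - int m)))"
  using assms
proof (induction m arbitrary: e)
  case 0
  \<comment> \<open>Without a pole the approximation is \<open>0\<close>; the exactness clause is
    void because \<open>p\<close> divides \<open>0\<close>.\<close>
  then have "v (0 ^ p - e) \<ge> Fin (- (b * int p) + 1)"
    using bp_pos v_mono[of 0 e "- (b * int p) + 1"] by (simp add: zero_power[OF p_pos])
  then show ?case
    by (intro exI[of _ 0]) (simp add: galois_apply[OF \<sigma>1] galois_apply[OF \<sigma>2])
next
  case (Suc m)
  show ?case
  proof (cases "v e \<ge> Fin (- ((int p)\<^sup>2 * int m))")
    case True
    then obtain \<alpha> where \<alpha>: "\<sigma>2 \<alpha> = \<alpha>" "v \<alpha> \<ge> Fin (- (int p * int m))" "v (\<alpha> ^ p - e) \<ge> Fin (- (b * int p) + 1)"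
      "v (\<sigma>1 \<alpha> - \<alpha>) \<ge> Fin (int p * (b - int m))"
      using Suc by auto
    have "(int p)\<^sup>2 > 0"
      using p_pos by simp
    then have "v e \<noteq> Fin (- ((int p)\<^sup>2 * int (Suc m)))"
      using True by (auto simp: algebra_simps)
    moreover have "v \<alpha> \<ge> Fin (- (int p * int (Suc m)))"
      by (rule v_mono[OF \<alpha>(2)]) (simp add: algebra_simps)
    moreover have "v (\<sigma>1 \<alpha> - \<alpha>) \<ge> Fin (int p * (b - int (Suc m)))"
      by (rule v_mono[OF \<alpha>(4)]) (simp add: algebra_simps)
    ultimately show ?thesis
      using \<alpha> by blast
  next
    case False
    define M where "M = int (Suc m)"
    have M: "M > 0" "M < b" "int m = M - 1"
      using Suc.prems by (auto simp: M_def)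
    have "e \<noteq> 0"
      using False by auto
    then obtain n where n: "v e = Fin ((int p)\<^sup>2 * n)"
      using v_K Suc.prems by blast
    have p2: "(int p)\<^sup>2 > 0"
      using p_pos by simp
    have "(int p)\<^sup>2 * (- M) \<le> (int p)\<^sup>2 * n" "(int p)\<^sup>2 * n < (int p)\<^sup>2 * (- (M - 1))"
      using n Suc.prems(2) False by (auto simp: M_def algebra_simps)
    then have "n = - M"
      using p2 by (simp only: mult_le_cancel_left_pos mult_less_cancel_left_pos)
    then have ve: "v e = Fin (- ((int p)\<^sup>2 * M))"
      using n by simp
    obtain i r where ir: "i < p" "int p * r = b * int i - M"
      using exists_residue_index by blast
    obtain t where t: "t \<in> K" "v t = Fin ((int p)\<^sup>2 * r)"
      using v_K_surj by blast
    \<comment> \<open>\<open>h\<close> has the valuation of \<open>e\<close>, so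
      \<open>e / h\<close> is a unit; the \<open>p\<close>-th root \<open>c\<close> of its residue
      absorbs into \<open>t\<close>, and \<open>\<mu> = c * t\<close> gives the leading term of
      \<open>e\<close>.\<close>
    define h where "h = t ^ p * \<beta> ^ i"
    have "v h = Fin (int p * ((int p)\<^sup>2 * r) + int i * (- b * (int p)\<^sup>2))"
      unfolding h_def by (intro v_mult_Fin v_power t \<beta>)
    also have "int p * ((int p)\<^sup>2 * r) + int i * (- b * (int p)\<^sup>2) = (int p)\<^sup>2 * (int p * r - b * int i)"
      by (simp add: algebra_simps)
    also have "\<dots> = - ((int p)\<^sup>2 * M)"
      by (simp add: ir(2))
    finally have vh: "v h = Fin (- ((int p)\<^sup>2 * M))" .
    then have "h \<noteq> 0" by auto
    have hK: "h \<in> K"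
      unfolding h_def by (intro K.mult_in K.power_in t \<beta>)
    have vq: "v (e / h) = Fin 0"
      using v_divide[OF ve vh] by simp
    obtain a where a: "a \<in> F" "v (e / h - a) \<ge> Fin 1"
      using residue[of "e / h"] vq K.divide_in[OF Suc.prems(1) hK] by auto
    obtain c where c: "c \<in> F" "c ^ p = a"
      using perfect[OF a(1)] by blast
    have "c \<noteq> 0"
    proof
      assume "c = 0"
      then have "a = 0"
        using c(2)[symmetric] by (simp add: zero_power[OF p_pos])
      then show False
        using a(2) vq by simp
    qed
    then have vc: "v c = Fin 0"
      using v_F c(1) by blast
    define \<mu> where "\<mu> = c * t"
    have \<mu>: "v \<mu> = Fin ((int p)\<^sup>2 * r)" "\<mu> \<in> K"
      using v_mult_Fin[OF vc t(2)] c(1) t(1) F_sub_K by (auto simp: \<mu>_def intro: K.mult_in)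
    define e' where "e' = e - \<mu> ^ p * \<beta> ^ i"
    have e'_eq: "e' = (e / h - a) * h"
      using \<open>h \<noteq> 0\<close> by (simp add: e'_def \<mu>_def h_def c(2)[symmetric] power_mult_distrib algebra_simps)
    have e'K: "e' \<in> K"
      unfolding e'_def by (intro K.diff_in K.mult_in K.power_in Suc.prems \<mu> \<beta>)
    have ve'_gt: "v e' \<ge> Fin (1 + - ((int p)\<^sup>2 * M))"
      unfolding e'_eq using a(2) vh by (intro v_mult_ge) auto
    \<comment> \<open>Valuations from \<open>K\<close> are multiples of \<open>p^2\<close>, so
      exceeding \<open>-M p^2\<close> means being at least \<open>-(M - 1) p^2\<close>.\<close>
    have "v e' \<ge> Fin (- ((int p)\<^sup>2 * int m))"
    proof (cases "e' = 0")
      case False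
      then obtain n' where n': "v e' = Fin ((int p)\<^sup>2 * n')"
        using v_K e'K by blast
      then have "(int p)\<^sup>2 * (- M) < (int p)\<^sup>2 * n'"
        using ve'_gt by simp
      then have "- M < n'"
        using p2 by (simp only: mult_less_cancel_left_pos)
      then have "(int p)\<^sup>2 * (- int m) \<le> (int p)\<^sup>2 * n'"
        using p2 M by (intro mult_left_mono) auto
      then show ?thesis
        using n' by simp
    qed simp
    then obtain \<alpha>' where \<alpha>': "\<sigma>2 \<alpha>' = \<alpha>'" "v \<alpha>' \<ge> Fin (- (int p * int m))"
        "v (\<alpha>' ^ p - e') \<ge> Fin (- (b * int p) + 1)" "v (\<sigma>1 \<alpha>' - \<alpha>') \<ge> Fin (int p * (b - int m))"
      using Suc.IH[OF e'K] Suc.prems(3) by auto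
    define \<alpha> where "\<alpha> = \<alpha>' + \<mu> * x1 ^ i"
    have v\<mu>x: "v (\<mu> * x1 ^ i) = Fin (- (int p * M))"
    proof -
      have "v (\<mu> * x1 ^ i) = Fin ((int p)\<^sup>2 * r + int i * (- (b * int p)))"
        by (intro v_mult_Fin \<mu> v_power v_x1)
      also have "(int p)\<^sup>2 * r + int i * (- (b * int p)) = int p * (int p * r - b * int i)"
        by (simp add: algebra_simps power2_eq_square)
      also have "\<dots> = - (int p * M)"
        by (simp add: ir(2))
      finally show ?thesis .
    qed
    have "v \<alpha> \<ge> Fin (- (int p * M))"
      unfolding \<alpha>_def using v\<mu>x M p_pos by (intro v_add v_mono[OF \<alpha>'(2)]) auto
    moreover have "\<sigma>2 \<alpha> = \<alpha>"
      by (simp add: \<alpha>_def galois_apply[OF \<sigma>2] K.galois_power[OF \<sigma>2] \<sigma>_x \<alpha>'(1) \<mu>(2))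
    moreover have "v (\<alpha> ^ p - e) \<ge> Fin (- (b * int p) + 1)"
    proof -
      have x1p: "x1 ^ p = x1 + \<beta>"
        using x1_eq by (simp add: algebra_simps)
      \<comment> \<open>Taking \<open>p\<close>-th powers is additive, so the only new error is the
        difference between \<open>(x1 + \<beta>) ^ i\<close> and \<open>\<beta> ^ i\<close>, which
        contains the factor \<open>x1\<close>.\<close>
      have eq: "\<alpha> ^ p - e = (\<alpha>' ^ p - e') + \<mu> ^ p * ((x1 ^ p) ^ i - \<beta> ^ i)"
        by (simp add: \<alpha>_def freshman e'_def algebra_simps power_mult_distrib flip: power_mult)
      have "v (\<mu> ^ p * ((x1 ^ p) ^ i - \<beta> ^ i)) \<ge> Fin (- (b * int p) + 1)"
      proof (cases "i = 0")
        case False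
        have vxp: "v (x1 ^ p) = Fin (- b * (int p)\<^sup>2)"
          using v_power[OF v_x1, of p] by (simp add: power2_eq_square algebra_simps)
        have "(x1 ^ p) ^ i - \<beta> ^ i = x1 * (\<Sum>l<i. \<beta> ^ (i - Suc l) * (x1 ^ p) ^ l)"
          using power_diff_sumr2[of "x1 ^ p" i \<beta>] x1p by simp
        moreover have "v (x1 * (\<Sum>l<i. \<beta> ^ (i - Suc l) * (x1 ^ p) ^ l)) \<ge>
            Fin (- (b * int p) + (int i - 1) * (- b * (int p)\<^sup>2))"
        proof (intro v_mult_ge v_sum)
          fix l assume "l \<in> {..<i}"
          then have "int (i - Suc l) * (- b * (int p)\<^sup>2) + int l * (- b * (int p)\<^sup>2) = (int i - 1) * (- b * (int p)\<^sup>2)"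
            by (simp add: of_nat_diff algebra_simps)
          then show "v (\<beta> ^ (i - Suc l) * (x1 ^ p) ^ l) \<ge> Fin ((int i - 1) * (- b * (int p)\<^sup>2))"
            using v_mult_Fin[OF v_power[OF \<beta>(2), of "i - Suc l"] v_power[OF vxp, of l]] by simp
        qed (simp add: v_x1)
        ultimately have "v (\<mu> ^ p * ((x1 ^ p) ^ i - \<beta> ^ i)) \<ge>
            Fin (int p * ((int p)\<^sup>2 * r) + (- (b * int p) + (int i - 1) * (- b * (int p)\<^sup>2)))"
          using v_power[OF \<mu>(1), of p] by (intro v_mult_ge) auto
        moreover have "int p * ((int p)\<^sup>2 * r) + (- (b * int p) + (int i - 1) * (- b * (int p)\<^sup>2)) =
            (int p)\<^sup>2 * (int p * r - b * int i) + b * (int p)\<^sup>2 - b * int p"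
          by (simp add: algebra_simps)
        moreover have "\<dots> = (int p)\<^sup>2 * (b - M) - b * int p"
        proof -
          have "int p * r - b * int i = - M"
            using ir(2) by simp
          then show ?thesis
            by (simp only:) (simp add: algebra_simps)
        qed
        \<comment> \<open>Here \<open>M < b\<close> places the new error strictly above
          \<open>-bp\<close>.\<close>
        moreover have "(int p)\<^sup>2 * (b - M) \<ge> 1 * 1"
          using p2 M by (intro mult_mono) auto
        ultimately show ?thesis
          by (auto elim!: v_mono)
      qed simp
      then show ?thesis
        unfolding eq by (intro v_add \<alpha>'(3))
    qed
    moreover have D_eq: "\<sigma>1 \<alpha> - \<alpha> = \<mu> * ((x1 + 1) ^ i - x1 ^ i) + (\<sigma>1 \<alpha>' - \<alpha>')"
      by (simp add: \<alpha>_def galois_apply[OF \<sigma>1] K.galois_power[OF \<sigma>1] \<sigma>_x \<mu>(2) algebra_simps)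
    have D'_ge: "v (\<sigma>1 \<alpha>' - \<alpha>') \<ge> Fin (int p * (b - M) + 1)"
      by (rule v_mono[OF \<alpha>'(4)]) (use p_pos in \<open>simp add: M(3) algebra_simps\<close>)
    have exponent: "(int p)\<^sup>2 * r + - (b * int p) * int (i - 1) = int p * (b - M)" if "i > 0"
    proof -
      have "(int p)\<^sup>2 * r + - (b * int p) * int (i - 1) = int p * (int p * r - b * int i + b)"
        using that by (simp add: of_nat_diff algebra_simps power2_eq_square)
      then show ?thesis by (simp add: ir(2))
    qed
    have "v (\<mu> * ((x1 + 1) ^ i - x1 ^ i)) \<ge> Fin (int p * (b - M))"
    proof (cases "i = 0")
      case False
      then have "v (\<mu> * ((x1 + 1) ^ i - x1 ^ i)) \<ge> Fin ((int p)\<^sup>2 * r + - (b * int p) * int (i - 1))"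
        using \<mu>(1) by (intro v_mult_ge v_x1_power_diff) auto
      then show ?thesis
        using False exponent by simp
    qed simp
    then have "v (\<sigma>1 \<alpha> - \<alpha>) \<ge> Fin (int p * (b - M))"
      unfolding D_eq by (intro v_add v_mono[OF D'_ge]) auto
    moreover have "v (\<sigma>1 \<alpha> - \<alpha>) = Fin (int p * (b - M))" if "\<not> p dvd Suc m"
    proof -
      have "i \<noteq> 0"
      proof
        assume "i = 0"
        then have "int p dvd M"
          using ir(2) by (metis add.inverse_inverse diff_0 dvd_minus_iff dvd_triv_left mult_zero_right of_nat_0)
        then show False
          using that by (simp only: M_def int_dvd_int_iff)
      qed
      have "v (of_nat i * x1 ^ (i - 1)) = Fin (0 + int (i - 1) * - (b * int p))"
        using \<open>i \<noteq> 0\<close> ir(1) by (intro v_mult_Fin v_of_nat v_power v_x1) (simp add: nat_dvd_not_less)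
      then have "v (of_nat i * x1 ^ (i - 1) + ((x1 + 1) ^ i - x1 ^ i - of_nat i * x1 ^ (i - 1))) =
          Fin (0 + int (i - 1) * - (b * int p))"
        using v_x1_power_diff(1)[of i] \<open>i \<noteq> 0\<close> by (intro v_add_eq) (auto simp: mult.commute)
      then have "v ((x1 + 1) ^ i - x1 ^ i) = Fin (- (b * int p) * int (i - 1))"
        by (simp add: mult.commute)
      then have "v (\<mu> * ((x1 + 1) ^ i - x1 ^ i)) = Fin (int p * (b - M))"
        using v_mult_Fin[OF \<mu>(1)] exponent \<open>i \<noteq> 0\<close> by simp
      then show ?thesis
        unfolding D_eq using D'_ge by (rule v_add_eq)
    qed
    ultimately show ?thesis
      unfolding M_def by blast
  qed
qed

text \<open>\<open>m\<close> stands for the pole order of \<open>\<epsilon>\<close>, or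
  \<open>0\<close>. Up to terms of valuation above \<open>-bp\<close>, \<open>Z ^ p - Z\<close> is
  \<open>(s - s ^ p) * x1\<close> with \<open>s = \<omega> ^ p\<close>, and
  \<open>s - s ^ p = (\<omega> - \<omega> ^ p) ^ p\<close> is a unit; this gives \<open>v Z\<close>.
  The defect \<open>\<delta> = \<sigma>1 \<alpha> - \<alpha>\<close> has valuation at least
  \<open>p (b - m)\<close>. For \<open>pm > b\<close> it determines \<open>c\<close> and must be
  known exactly; for \<open>pm < b\<close> it is negligible against the gain \<open>bp\<close> from
  \<open>x1\<close>; \<open>pm = b\<close> is impossible.\<close>

lemma exists_generator:
  assumes "v \<epsilon> \<ge> Fin (- ((int p)\<^sup>2 * int m))" "int m < b"
    and "int p * int m > b \<Longrightarrow> v \<epsilon> = Fin (- ((int p)\<^sup>2 * int m)) \<and> \<not> p dvd m"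
    and "c = min ((b - int m) * int p + b) (b * int p)"
  obtains Z \<delta> where "v Z = Fin (- b)" "\<sigma>2 Z = Z + 1" "\<sigma>1 Z = Z - \<omega> ^ p - \<delta>"
    "(v \<delta> = Fin (c - b) \<and> c < b * int p) \<or> (v \<delta> \<ge> Fin (c - b + 1) \<and> c = b * int p)"
    "c > b" "\<And>i. i < p \<Longrightarrow> c \<noteq> b * int i"
proof -
  obtain \<alpha> where \<alpha>: "\<sigma>2 \<alpha> = \<alpha>" "v \<alpha> \<ge> Fin (- (int p * int m))" "v (\<alpha> ^ p - \<epsilon>) \<ge> Fin (- (b * int p) + 1)"
    "v (\<sigma>1 \<alpha> - \<alpha>) \<ge> Fin (int p * (b - int m))"
    "v \<epsilon> = Fin (- ((int p)\<^sup>2 * int m)) \<and> \<not> p dvd m \<longrightarrow> v (\<sigma>1 \<alpha> - \<alpha>) = Fin (int p * (b - int m))"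
    using approximate_p_th_root[OF \<epsilon>_in assms(1,2)] by blast
  define s where "s = \<omega> ^ p"
  define Z where "Z = x2 - s * x1 - \<alpha>"
  have s: "s \<in> F" "s \<in> K" "s ^ p = \<omega> ^ p\<^sup>2"
    using F_sub_K F.power_in[OF \<omega>(1)] by (auto simp: s_def power2_eq_square simp flip: power_mult)
  have "s - s ^ p \<noteq> 0"
  proof
    assume "s - s ^ p = 0"
    then have "(\<omega> - \<omega> ^ p) ^ p = 0"
      by (simp add: freshman_diff s_def)
    then show False
      using \<omega>(2) p_pos by simp
  qed
  then have vs: "v (s - s ^ p) = Fin 0"
    by (intro v_F F.diff_in F.power_in s)
  have Z_eq: "Z ^ p - Z = (s - s ^ p) * x1 + (\<alpha> - (\<alpha> ^ p - \<epsilon>))"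
  proof -
    have "x1 ^ p = x1 + \<beta>" "x2 ^ p = x2 + (s ^ p * \<beta> + \<epsilon>)"
      using x1_eq x2_eq by (simp_all add: s(3) algebra_simps)
    then show ?thesis
      by (simp add: Z_def freshman freshman_diff power_mult_distrib algebra_simps)
  qed
  have "v (Z ^ p - Z) = Fin (0 + - (b * int p))"
    unfolding Z_eq
  proof (rule v_add_eq)
    show "v ((s - s ^ p) * x1) = Fin (0 + - (b * int p))"
      by (intro v_mult_Fin vs v_x1)
    have "int p * int m + 1 \<le> b * int p"
    proof -
      have "int p * (int m + 1) \<le> int p * b"
        using assms(2) by (intro mult_left_mono) auto
      then show ?thesis
        using p_pos by (simp add: algebra_simps)
    qed
    then show "v (\<alpha> - (\<alpha> ^ p - \<epsilon>)) \<ge> Fin (0 + - (b * int p) + 1)"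
      using \<alpha>(3) by (intro v_diff[of _ \<alpha>] v_mono[OF \<alpha>(2)]) auto
  qed
  then have 1: "v Z = Fin (- b)"
    using v_artin_schreier[OF _ b_pos, of Z] by simp
  have 2: "\<sigma>2 Z = Z + 1"
    by (simp add: Z_def K.galois_diff[OF \<sigma>2] galois_apply[OF \<sigma>2] s \<sigma>_x \<alpha>(1))
  have 3: "\<sigma>1 Z = Z - \<omega> ^ p - (\<sigma>1 \<alpha> - \<alpha>)"
    by (simp add: Z_def K.galois_diff[OF \<sigma>1] galois_apply[OF \<sigma>1] s(2) \<sigma>_x s_def[symmetric] algebra_simps)
  have "int p * int m \<noteq> b"
    using b_not_dvd by auto
  have p1: "b * int p > b * 1"
    using b_pos p_gt_1 by (intro mult_strict_left_mono) auto
  show ?thesis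
  proof (cases "int p * int m > b")
    case True
    then have "(b - int m) * int p + b < b * int p"
      by (simp add: algebra_simps)
    then have c: "c = (b - int m) * int p + b" "c < b * int p"
      using assms(4) by simp_all
    have "v (\<sigma>1 \<alpha> - \<alpha>) = Fin (c - b)"
      using \<alpha>(5) assms(3)[OF True] by (simp add: c(1) mult.commute)
    moreover have "c > b"
      using c(1) assms(2) p_pos by simp
    moreover have "c \<noteq> b * int i" if "i < p" for i
    proof
      assume "c = b * int i"
      then have "(b - int m) * int p = b * (int i - 1)"
        using c(1) by (simp add: right_diff_distrib)
      \<comment> \<open>As \<open>b\<close> is prime to \<open>p\<close>, it would divide
        \<open>b - m\<close>, which lies strictly between \<open>0\<close> and
        \<open>b\<close>.\<close>
      then have "b dvd (b - int m) * int p"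
        by (metis dvd_triv_left)
      then have "b dvd b - int m"
        by (simp add: coprime_dvd_mult_left_iff[OF coprime_b_p])
      then have "b \<le> b - int m"
        using assms(2) by (intro zdvd_imp_le) auto
      then have "m = 0" by simp
      then show False
        using True b_pos by simp
    qed
    ultimately show ?thesis
      using that[OF 1 2 3] c(2) by blast
  next
    case False
    then have lt: "int p * int m < b"
      using \<open>int p * int m \<noteq> b\<close> by simp
    then have "(b - int m) * int p + b > b * int p"
      by (simp add: algebra_simps)
    then have c: "c = b * int p"
      using assms(4) by simp
    have "v (\<sigma>1 \<alpha> - \<alpha>) \<ge> Fin (c - b + 1)"
      by (rule v_mono[OF \<alpha>(4)]) (use lt in \<open>simp add: c right_diff_distrib mult.commute\<close>)
    moreover have "c \<noteq> b * int i" if "i < p" for i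
      using that b_pos c by simp
    ultimately show ?thesis
      using that[OF 1 2 3] c p1 by (metis mult_1_right)
  qed
qed

end

section \<open>Refined breaks\<close>

text \<open>The alternatives for \<open>\<delta>\<close> are the two regimes of the minimum: either
  \<open>\<delta>\<close> is known exactly and produces \<open>c < bp\<close>, or it is negligible
  and \<open>c = bp\<close> comes from \<open>x1\<close>. The last condition keeps \<open>c\<close>
  apart from the gains of the powers of \<open>X2\<close>.\<close>

locale scaffold = ramified_bicyclic p K F \<sigma>1 \<sigma>2 x1 x2 v
  for p :: nat and K F :: "'l::field set" and \<sigma>1 \<sigma>2 :: "'l \<Rightarrow> 'l" and x1 x2 :: 'l
    and v :: "'l \<Rightarrow> int extended" +
  fixes b c :: int and Z \<delta> s :: 'l
  assumes b_pos: "b > 0" and b_not_dvd: "\<not> int p dvd b"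
    and v_x1: "v x1 = Fin (- (b * int p))" and v_Z: "v Z = Fin (- b)"
    and s_in: "s \<in> F" and \<sigma>_Z: "\<sigma>2 Z = Z + 1" "\<sigma>1 Z = Z - s - \<delta>"
    and v_\<delta>: "(v \<delta> = Fin (c - b) \<and> c < b * int p) \<or> (v \<delta> \<ge> Fin (c - b + 1) \<and> c = b * int p)"
    and c_gt_b: "c > b" and c_neq: "\<And>i. i < p \<Longrightarrow> c \<noteq> b * int i"
begin

lemma c_le: "c \<le> b * int p"
  using v_\<delta> by auto

lemma v_\<delta>_ge: "v \<delta> \<ge> Fin (c - b)"
  using v_\<delta> by (auto elim: v_mono)

lemma v_fact: "i < p \<Longrightarrow> v (of_nat (fact i)) = Fin 0"
  using prime_p by (intro v_of_nat) (simp add: prime_dvd_fact_iff)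

lemma v_field_binomial:
  assumes "v z = Fin (- n)" "n > 0" "i < p"
  shows "v (field_binomial z i) = Fin (- (n * int i))"
proof -
  have "v (\<Prod>j<i. z - of_nat j) = Fin (- (n * int i))" for i
  proof (induction i)
    case (Suc i)
    have "v (z + - of_nat i) = Fin (- n)"
      using assms(1,2) v_F_ge[OF F.uminus_in[OF F.of_nat_in[of i]]] by (intro v_add_eq) (auto elim: v_mono)
    then show ?case
      using v_mult_Fin[OF Suc, of "z - of_nat i" "- n"] by (simp add: algebra_simps)
  qed simp
  then show ?thesis
    using v_divide[OF _ v_fact[OF assms(3)]] by (simp add: field_binomial_def del: of_nat_fact)
qed

text \<open>The factor with \<open>j = 0\<close> contributes \<open>r\<close>; the other factors and
  the inverse factorial are integral.\<close>

lemma v_field_binomial_ge: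
  assumes "v z \<ge> Fin r" "r \<ge> 0" "0 < i" "i < p"
  shows "v (field_binomial z i) \<ge> Fin r"
proof -
  obtain i' where i': "i = Suc i'"
    using assms(3) by (cases i) auto
  have "v (\<Prod>j<Suc i. z - of_nat j) \<ge> Fin r" for i
  proof (induction i)
    case 0 then show ?case using assms(1) by simp
  next
    case (Suc i)
    have "v (z - of_nat (Suc i)) \<ge> Fin 0"
      using assms(2) v_F_ge[OF F.of_nat_in[of "Suc i"]] by (intro v_diff v_mono[OF assms(1)])
    then show ?case
      using v_mult_ge[OF Suc, of 0 "z - of_nat (Suc i)"] by (simp add: mult.commute)
  qed
  then have "v ((\<Prod>j<i. z - of_nat j) * inverse (of_nat (fact i))) \<ge> Fin (r + 0)"
    unfolding i' using v_inverse[OF v_fact[OF assms(4)]] by (intro v_mult_ge) (auto simp: i' simp del: of_nat_fact)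
  then show ?thesis
    by (simp add: field_binomial_def divide_inverse del: of_nat_fact)
qed

text \<open>In the Vandermonde expansion the term of index \<open>m\<close> lowers the index of the
  binomial in \<open>Z\<close> by \<open>m\<close> and so gains at least \<open>b m + r\<close>; the
  term \<open>m = 1\<close> dominates.\<close>

lemma v_shift:
  assumes "v \<eta> \<ge> Fin r" "r \<ge> 0" "i < p"
  shows "v (field_binomial (Z + \<eta>) i - field_binomial Z i) \<ge> Fin (- (b * int i) + b + r)"
    and "0 < i \<Longrightarrow> v \<eta> = Fin r \<Longrightarrow>
      v (field_binomial (Z + \<eta>) i - field_binomial Z i) = Fin (- (b * int i) + b + r)"
proof -
  let ?t = "\<lambda>m. field_binomial \<eta> m * field_binomial Z (i - m)"
  have eq: "field_binomial (Z + \<eta>) i - field_binomial Z i = (\<Sum>m\<in>{1..i}. ?t m)"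
  proof -
    have "field_binomial (\<eta> + Z) i = (\<Sum>m\<in>insert 0 {1..i}. ?t m)"
      unfolding field_binomial_add[OF assms(3)] by (rule sum.cong) auto
    then show ?thesis
      by (simp add: add.commute)
  qed
  have t: "v (?t m) \<ge> Fin (- (b * int i) + b * int m + r)" if "1 \<le> m" "m \<le> i" for m
  proof -
    have "v (?t m) \<ge> Fin (r + (- (b * int (i - m))))"
    proof (rule v_mult_ge)
      show "v (field_binomial \<eta> m) \<ge> Fin r"
        by (rule v_field_binomial_ge[OF assms(1,2)]) (use that assms(3) in auto)
      show "v (field_binomial Z (i - m)) \<ge> Fin (- (b * int (i - m)))"
        using v_field_binomial[OF v_Z b_pos, of "i - m"] assms(3) by simp
    qed
    then show ?thesis
      using that by (simp add: of_nat_diff algebra_simps)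
  qed
  have b_mult: "b * int m \<ge> b * j" if "int m \<ge> j" for m j
    using b_pos that by (intro mult_left_mono) auto
  show "v (field_binomial (Z + \<eta>) i - field_binomial Z i) \<ge> Fin (- (b * int i) + b + r)"
    unfolding eq
  proof (rule v_sum)
    fix m assume m: "m \<in> {1..i}"
    then show "v (?t m) \<ge> Fin (- (b * int i) + b + r)"
      using b_mult[of 1 m] by (intro v_mono[OF t]) auto
  qed
  show "v (field_binomial (Z + \<eta>) i - field_binomial Z i) = Fin (- (b * int i) + b + r)"
    if "0 < i" "v \<eta> = Fin r"
  proof -
    have "v (?t 1) = Fin (r + (- (b * int (i - 1))))"
      using that assms(3) v_field_binomial[OF v_Z b_pos, of "i - 1"] by (intro v_mult_Fin) auto
    then have 1: "v (?t 1) = Fin (- (b * int i) + b + r)"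
      using that by (simp add: of_nat_diff algebra_simps)
    have "v (\<Sum>m\<in>{2..i}. ?t m) \<ge> Fin (- (b * int i) + b + r + 1)"
    proof (rule v_sum)
      fix m assume m: "m \<in> {2..i}"
      then have "b * 2 \<le> b * int m"
        by (intro b_mult) auto
      then have le: "b + 1 \<le> b * int m"
        using b_pos by linarith
      show "v (?t m) \<ge> Fin (- (b * int i) + b + r + 1)"
      proof (rule v_mono[OF t])
        show "- (b * int i) + b + r + 1 \<le> - (b * int i) + b * int m + r"
          using le by linarith
      qed (use m in auto)
    qed
    then have "v (?t 1 + (\<Sum>m\<in>{2..i}. ?t m)) = Fin (- (b * int i) + b + r)"
      by (rule v_add_eq[OF 1])
    moreover have "(\<Sum>m\<in>{1..i}. ?t m) = ?t 1 + (\<Sum>m\<in>{2..i}. ?t m)"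
      using that by (subst sum.atLeast_Suc_atMost) (auto simp: numeral_2_eq_2)
    ultimately show ?thesis
      by (simp only: eq)
  qed
qed

section \<open>The basis adapted to the valuation\<close>

definition basis :: "nat \<times> nat \<Rightarrow> 'l" where
  "basis = (\<lambda>(i, j). field_binomial Z i * field_binomial x1 j)"

definition weight :: "nat \<times> nat \<Rightarrow> int" where
  "weight = (\<lambda>(i, j). - (b * (int i + int p * int j)))"

abbreviation "index \<equiv> {..<p} \<times> {..<p}"

lemma bp_pos: "b * int p > 0"
  using b_pos p_pos by simp

lemma v_basis: "i < p \<Longrightarrow> j < p \<Longrightarrow> v (basis (i, j)) = Fin (weight (i, j))"
  using v_mult_Fin[OF v_field_binomial[OF v_Z b_pos] v_field_binomial[OF v_x1 bp_pos]]
  by (simp add: basis_def weight_def algebra_simps)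

lemma coprime_b_p2: "coprime b ((int p)\<^sup>2)"
proof -
  have "Factorial_Ring.prime (int p)"
    using prime_p by simp
  then have "coprime (int p) b"
    using b_not_dvd by (rule prime_imp_coprime)
  then show ?thesis
    by (simp add: coprime_commute)
qed

text \<open>\<open>i + p j\<close> is a base \<open>p\<close> expansion and runs through the
  residues modulo \<open>p^2\<close>, on which multiplication by \<open>b\<close> is
  injective.\<close>

lemma weight_inj: "inj_on (\<lambda>i. weight i mod (int p)\<^sup>2) index"
proof (rule inj_onI)
  fix a a' assume "a \<in> index" "a' \<in> index" and eq: "weight a mod (int p)\<^sup>2 = weight a' mod (int p)\<^sup>2"
  then obtain i j i' j' where a: "a = (i, j)" "a' = (i', j')" and lt: "i < p" "j < p" "i' < p" "j' < p"
    by auto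
  have "(int p)\<^sup>2 dvd weight a' - weight a"
    using eq by (metis mod_eq_dvd_iff)
  also have "weight a' - weight a = b * ((int i + int p * int j) - (int i' + int p * int j'))"
    by (simp add: a weight_def algebra_simps)
  finally have "(int p)\<^sup>2 dvd (int i + int p * int j) - (int i' + int p * int j')"
    using coprime_b_p2 by (simp add: coprime_dvd_mult_right_iff coprime_commute)
  then have "(int i + int p * int j) mod (int p)\<^sup>2 = (int i' + int p * int j') mod (int p)\<^sup>2"
    by (simp add: mod_eq_dvd_iff)
  moreover have "int i + int p * int j < (int p)\<^sup>2" if "i < p" "j < p" for i j
  proof -
    have "int p * (int j + 1) \<le> int p * int p"
      using that by (intro mult_left_mono) auto
    then show ?thesis
      using that by (simp add: power2_eq_square algebra_simps)
  qed
  ultimately have "int i + int p * int j = int i' + int p * int j'"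
    using lt by simp
  then have eq': "i + p * j = i' + p * j'"
    by (metis of_nat_add of_nat_eq_iff of_nat_mult)
  have "i = (i + p * j) mod p" "j = (i + p * j) div p"
    using lt by auto
  moreover have "i' = (i' + p * j') mod p" "j' = (i' + p * j') div p"
    using lt by auto
  ultimately show "a = a'"
    unfolding a eq' by simp
qed

lemma basis_family: "valued_family index basis weight"
  unfolding valued_family_def using v_basis weight_inj by auto

lemma basis_spanning: "K.spanning index basis"
  using double_binomial_spanning[OF \<sigma>_Z(1)] by (simp add: basis_def)

lemma top_index: "(p - 1, p - 1) \<in> index"
  using p_pos by auto

text \<open>The top weight is \<open>-b (p^2 - 1)\<close>, congruent to \<open>b\<close>. So a
  valuation criterion element has the top basis element as leading term, and there every operator
  attains its minimal gain.\<close>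

lemma top_weight: "n mod (int p)\<^sup>2 = b mod (int p)\<^sup>2 \<Longrightarrow> n mod (int p)\<^sup>2 = weight (p - 1, p - 1) mod (int p)\<^sup>2"
proof -
  assume n: "n mod (int p)\<^sup>2 = b mod (int p)\<^sup>2"
  have "b - weight (p - 1, p - 1) = (int p)\<^sup>2 * b"
    using p_pos by (simp add: weight_def of_nat_diff algebra_simps power2_eq_square)
  then have "b mod (int p)\<^sup>2 = weight (p - 1, p - 1) mod (int p)\<^sup>2"
    by (simp add: mod_eq_dvd_iff)
  then show ?thesis
    using n by simp
qed

lemma act_K_linear: "K_linear (act a)" "K_linear (\<lambda>y. act a y - y)"
  by (simp_all add: K_linear_def act_add act_scale right_diff_distrib)

lemmas raises_by_basis = raises_if_raises_basis[OF basis_family basis_spanning]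
lemmas exact_by_top = raises_exact[OF basis_family basis_spanning _ _ top_index _ _ top_weight]

lemma X_K_linear: "K_linear X1" "K_linear X2"
  by (simp_all add: K_linear_def X_add X_scale)

text \<open>The change is \<open>?A + ?B\<close>: \<open>?A\<close> comes from moving
  \<open>Z\<close> and gains \<open>b + r\<close>, exactly so when \<open>i > 0\<close> and
  \<open>\<eta>\<close> is known exactly; \<open>?B\<close> comes from moving \<open>x1\<close> by
  \<open>1\<close> and gains \<open>bp\<close>, exactly so when \<open>j > 0\<close>. The two exact
  claims are the cases where \<open>?A\<close>, respectively \<open>?B\<close>, dominates.\<close>

lemma v_basis_shift:
  assumes "v \<eta> \<ge> Fin r" "r \<ge> 0" "i < p" "j < p" "r + b \<le> b * int p"
  shows "v (field_binomial (Z + \<eta>) i * field_binomial (x1 + 1) j - basis (i, j)) \<ge> Fin (weight (i, j) + (b + r))"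
    and "0 < i \<Longrightarrow> v \<eta> = Fin r \<Longrightarrow> r + b < b * int p \<Longrightarrow>
      v (field_binomial (Z + \<eta>) i * field_binomial (x1 + 1) j - basis (i, j)) = Fin (weight (i, j) + (b + r))"
    and "0 < j \<Longrightarrow> v \<eta> \<ge> Fin (b * int p - b + 1) \<Longrightarrow>
      v (field_binomial (Z + \<eta>) i * field_binomial (x1 + 1) j - basis (i, j)) = Fin (weight (i, j) + b * int p)"
proof -
  have v1: "v (x1 + 1) = Fin (- (b * int p))"
    using v_x1 bp_pos by (intro v_add_eq) auto
  have vb1: "v (field_binomial (x1 + 1) j) = Fin (- (b * int p * int j))"
    by (rule v_field_binomial[OF v1 bp_pos assms(4)])
  have vZ: "v (field_binomial Z i) = Fin (- (b * int i))"
    by (rule v_field_binomial[OF v_Z b_pos assms(3)])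
  let ?A = "(field_binomial (Z + \<eta>) i - field_binomial Z i) * field_binomial (x1 + 1) j"
  let ?B = "field_binomial Z i * (field_binomial (x1 + 1) j - field_binomial x1 j)"
  have eq: "field_binomial (Z + \<eta>) i * field_binomial (x1 + 1) j - basis (i, j) = ?A + ?B"
    by (simp add: basis_def algebra_simps)
  have w: "weight (i, j) = - (b * int i) + - (b * int p * int j)"
    by (simp add: weight_def algebra_simps)
  have A: "v ?A \<ge> Fin (weight (i, j) + (b + r'))" if "v \<eta> \<ge> Fin r'" "r' \<ge> 0" for r'
  proof -
    have "v ?A \<ge> Fin ((- (b * int i) + b + r') + - (b * int p * int j))"
      using vb1 by (intro v_mult_ge v_shift that assms) simp
    then show ?thesis
      by (simp add: w algebra_simps)
  qed
  have diff: "field_binomial (x1 + 1) j - field_binomial x1 j = (if j = 0 then 0 else field_binomial x1 (j - 1))"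
    using field_binomial_pascal[of "j - 1" x1] assms(4) by (cases j) auto
  have B_exact: "v ?B = Fin (weight (i, j) + b * int p)" if "0 < j"
  proof -
    have "v (field_binomial x1 (j - 1)) = Fin (- (b * int p * int (j - 1)))"
      by (rule v_field_binomial[OF v_x1 bp_pos]) (use assms in auto)
    then have "v ?B = Fin (- (b * int i) + - (b * int p * int (j - 1)))"
      unfolding diff using that by (simp add: v_mult_Fin[OF vZ])
    then show ?thesis
      using that by (simp add: w of_nat_diff algebra_simps)
  qed
  then have B: "v ?B \<ge> Fin (weight (i, j) + b * int p)"
    by (cases "j = 0") (auto simp: diff)
  show "v (field_binomial (Z + \<eta>) i * field_binomial (x1 + 1) j - basis (i, j)) \<ge> Fin (weight (i, j) + (b + r))"
    unfolding eq using assms by (intro v_add A v_mono[OF B]) auto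
  show "v (field_binomial (Z + \<eta>) i * field_binomial (x1 + 1) j - basis (i, j)) = Fin (weight (i, j) + (b + r))"
    if "0 < i" "v \<eta> = Fin r" "r + b < b * int p"
  proof -
    have "v ?A = Fin ((- (b * int i) + b + r) + - (b * int p * int j))"
      using that by (intro v_mult_Fin v_shift(2) vb1 assms)
    then have "v ?A = Fin (weight (i, j) + (b + r))"
      by (simp add: w algebra_simps)
    then show ?thesis
      unfolding eq by (rule v_add_eq) (rule v_mono[OF B], use that in simp)
  qed
  show "v (field_binomial (Z + \<eta>) i * field_binomial (x1 + 1) j - basis (i, j)) = Fin (weight (i, j) + b * int p)"
    if "0 < j" "v \<eta> \<ge> Fin (b * int p - b + 1)"
  proof -
    have "b * int p \<ge> b * 1"
      using b_pos p_pos by (intro mult_left_mono) auto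
    then have "v ?A \<ge> Fin (weight (i, j) + (b + (b * int p - b + 1)))"
      by (intro A that(2)) simp
    then have "v ?A \<ge> Fin (weight (i, j) + b * int p + 1)"
      by (simp add: algebra_simps)
    then show ?thesis
      unfolding eq by (rule v_add_eq_right[OF B_exact[OF that(1)]])
  qed
qed

lemma raises_X1: "raises b X1"
proof (rule raises_by_basis[OF X_K_linear(1)])
  fix a assume "a \<in> index"
  then obtain i j where a: "a = (i, j)" "i < p" "j < p" by auto
  have "v (- (s + \<delta>)) \<ge> Fin 0"
    unfolding v_uminus by (intro v_add v_F_ge[OF s_in] v_mono[OF v_\<delta>_ge]) (use c_gt_b in simp)
  moreover have "X1 (basis a) = field_binomial (Z + - (s + \<delta>)) i * field_binomial (x1 + 1) j - basis (i, j)"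
  proof -
    have "\<sigma>1 Z = Z + - (s + \<delta>)"
      by (simp add: \<sigma>_Z)
    then show ?thesis
      by (simp only: X1_def basis_def a prod.case galois_apply(2)[OF \<sigma>1] K.galois_field_binomial[OF \<sigma>1] \<sigma>_x)
  qed
  moreover have "b \<le> b * int p"
    using b_pos p_pos mult_left_mono[of 1 "int p" b] by simp
  ultimately show "v (X1 (basis a)) \<ge> Fin (weight a + b)"
    using v_basis_shift(1)[of 0 "- (s + \<delta>)" i j] a by (simp only:) simp
qed

lemma X2_pow_basis:
  assumes "i < p" "j < p"
  shows "(X2 ^^ m) (basis (i, j)) = (if m \<le> i then basis (i - m, j) else 0)"
proof -
  have "X2 (basis (i, j)) = (if i = 0 then 0 else basis (i - 1, j))" if "i < p" for i
    using field_binomial_pascal[of "i - 1" Z] that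
    by (cases i) (auto simp: X2_def basis_def galois_apply[OF \<sigma>2] K.galois_field_binomial[OF \<sigma>2] \<sigma>_x \<sigma>_Z algebra_simps)
  then show ?thesis
    using assms by (induction m) (auto simp: diff_Suc split: nat.splits)
qed

lemma raises_X2: "raises b X2"
proof (rule raises_by_basis[OF X_K_linear(2)])
  fix a assume "a \<in> index"
  then obtain i j where a: "a = (i, j)" "i < p" "j < p" by auto
  show "v (X2 (basis a)) \<ge> Fin (weight a + b)"
    using X2_pow_basis[OF a(2,3), of 1] v_basis[of "i - 1" j] a
    by (auto simp: weight_def of_nat_diff algebra_simps)
qed

lemma X_pow_K_linear: "K_linear (X1 ^^ i)" "K_linear (X2 ^^ i)"
  by (induction i; use X_K_linear in \<open>simp add: K_linear_def\<close>)+

lemma v_X2_pow: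
  assumes "v \<rho> = Fin n" "n mod (int p)\<^sup>2 = b mod (int p)\<^sup>2" "m < p"
  shows "v ((X2 ^^ m) \<rho>) = Fin (n + int m * b)"
proof (rule exact_by_top[OF X_pow_K_linear(2) raises_pow[OF raises_X2] _ assms(1,2)])
  have "(X2 ^^ m) (basis (p - 1, p - 1)) = basis (p - 1 - m, p - 1)"
    using assms(3) by (subst X2_pow_basis) auto
  then show "v ((X2 ^^ m) (basis (p - 1, p - 1))) = Fin (weight (p - 1, p - 1) + int m * b)"
    using assms(3) v_basis[of "p - 1 - m" "p - 1"] by (simp add: weight_def of_nat_diff algebra_simps)
qed

lemma X2_pow_p: "(X2 ^^ p) y = 0"
proof -
  have "X2 = (\<lambda>y. \<sigma>2 y - y)"
    by (auto simp: X2_def)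
  then show ?thesis
    using galois_minus_one_pow_p[OF \<sigma>2] by simp
qed

lemma raises_galois: "g \<in> carrier G \<Longrightarrow> raises 0 g"
proof -
  assume "g \<in> carrier G"
  then obtain i j where g: "g = \<sigma>1 ^^ i \<circ> \<sigma>2 ^^ j"
    using galois_elements by blast
  have "raises 0 (\<lambda>y. X1 y + y)" "raises 0 (\<lambda>y. X2 y + y)"
    using b_pos by (intro raises_add raises_mono[OF raises_X1] raises_mono[OF raises_X2]; simp add: raises_def)+
  then have "raises 0 \<sigma>1" "raises 0 \<sigma>2"
    by (simp_all add: X1_def X2_def)
  then have "raises 0 (\<sigma>1 ^^ i)" "raises 0 (\<sigma>2 ^^ j)"
    using raises_pow[of 0] by simp_all
  from raises_comp[OF this] show ?thesis
    by (simp add: g comp_def)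
qed

lemma raises_act:
  assumes "a \<in> carrier R"
  shows "raises 0 (act a)"
proof -
  have "raises 0 (\<lambda>y. \<Sum>g\<in>carrier G. a g * g y)"
    using R_closedD[OF assms] by (intro raises_sum raises_scale raises_galois v_F_ge)
  then show ?thesis
    by (simp add: algebra_action_def[abs_def])
qed

text \<open>The truncated power of \<open>\<sigma>2\<close> with exponent \<open>u\<close>. On the
  adapted basis it is the substitution of \<open>Z + u\<close> for \<open>Z\<close>.\<close>

definition shift2 :: "'l \<Rightarrow> ('l \<Rightarrow> 'l) \<Rightarrow> 'l" where
  "shift2 u = truncated_power p F G (group_element \<sigma>2) u"

lemma shift2_in: "u \<in> F \<Longrightarrow> shift2 u \<in> carrier R"
  unfolding shift2_def by (intro truncated_power_in group_element_in \<sigma>2)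

lemma act_shift2: "act (shift2 u) y = (\<Sum>r<p. field_binomial u r * (X2 ^^ r) y)"
proof -
  have "(\<lambda>y. act (group_element \<sigma>2) y - y) = X2"
    by (auto simp: act_group_element[OF \<sigma>2] X2_def)
  then show ?thesis
    unfolding shift2_def act_truncated_power[OF group_element_in[OF \<sigma>2]] by simp
qed

lemma act_shift2_basis:
  assumes "i < p" "j < p"
  shows "act (shift2 u) (basis (i, j)) = field_binomial (Z + u) i * field_binomial x1 j"
proof -
  have "act (shift2 u) (basis (i, j)) = (\<Sum>r<p. field_binomial u r * (if r \<le> i then basis (i - r, j) else 0))"
    by (simp add: act_shift2 X2_pow_basis[OF assms])
  also have "\<dots> = (\<Sum>r\<le>i. field_binomial u r * (if r \<le> i then basis (i - r, j) else 0))"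
    by (rule sum_lessThan_if_le_extend[symmetric]) (use assms in auto)
  also have "\<dots> = (\<Sum>r\<le>i. field_binomial u r * field_binomial Z (i - r)) * field_binomial x1 j"
    by (simp add: basis_def sum_distrib_right mult.assoc)
  also have "\<dots> = field_binomial (Z + u) i * field_binomial x1 j"
    using field_binomial_add[OF assms(1), of u Z] by (simp add: add.commute)
  finally show ?thesis .
qed

lemma K_linear_eqI:
  assumes "K_linear T" "K_linear U" "\<And>a. a \<in> index \<Longrightarrow> T (basis a) = U (basis a)"
  shows "T y = U y"
proof -
  obtain d where d: "\<forall>i\<in>index. d i \<in> K" "y = (\<Sum>i\<in>index. d i * basis i)"
    using basis_spanning unfolding K.spanning_def by blast
  show ?thesis
    unfolding d(2) K_linear_sum[OF assms(1)] K_linear_sum[OF assms(2)]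
  proof (rule sum.cong[OF refl])
    fix a assume a: "a \<in> index"
    then have "d a \<in> K"
      using d(1) by blast
    then show "T (d a * basis a) = U (d a * basis a)"
      using assms(1,2) assms(3)[OF a] unfolding K_linear_def by simp
  qed
qed

text \<open>Shifts by \<open>u\<close> and \<open>-u\<close> cancel on the whole basis, so this is
  an identity on all of \<open>L\<close> and not merely one modulo \<open>A ^ k\<close>.\<close>

lemma act_shift2_inverse:
  assumes "u \<in> F"
  shows "act (shift2 u) (act (shift2 (- u)) y) = y"
proof (rule K_linear_eqI[where U = "\<lambda>y. y"])
  show "K_linear (\<lambda>y. act (shift2 u) (act (shift2 (- u)) y))"
    by (simp add: K_linear_def act_add act_scale)
  show "K_linear (\<lambda>y. y)"
    by (simp add: K_linear_def)
  fix a assume "a \<in> index"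
  then obtain i j where a: "a = (i, j)" "i < p" "j < p" by auto
  have uK: "u \<in> K"
    using assms F_sub_K by auto
  have "field_binomial (Z + - u) i * field_binomial x1 j =
      (\<Sum>m\<le>i. field_binomial (- u) m * basis (i - m, j))"
    using field_binomial_add[OF a(2), of "- u" Z]
    by (simp add: basis_def add.commute sum_distrib_right mult.assoc)
  then have "act (shift2 u) (act (shift2 (- u)) (basis a)) =
      (\<Sum>m\<le>i. act (shift2 u) (field_binomial (- u) m * basis (i - m, j)))"
    by (simp only: a(1) act_shift2_basis[OF a(2,3)] act_sum)
  also have "\<dots> = (\<Sum>m\<le>i. field_binomial (- u) m * (field_binomial (Z + u) (i - m) * field_binomial x1 j))"
  proof (rule sum.cong[OF refl])
    fix m
    have "i - m < p"
      using a(2) by simp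
    then show "act (shift2 u) (field_binomial (- u) m * basis (i - m, j)) =
        field_binomial (- u) m * (field_binomial (Z + u) (i - m) * field_binomial x1 j)"
      using act_scale[OF K.field_binomial_in[OF K.uminus_in[OF uK]]] act_shift2_basis[OF _ a(3)] by simp
  qed
  also have "\<dots> = field_binomial (- u + (Z + u)) i * field_binomial x1 j"
    unfolding field_binomial_add[OF a(2)] by (simp add: sum_distrib_right mult.assoc)
  finally show "act (shift2 u) (act (shift2 (- u)) (basis a)) = basis a"
    by (simp add: a(1) basis_def)
qed

text \<open>The factor \<open>shift2 s\<close> compensates the constant \<open>-s\<close> in
  \<open>\<sigma>1 Z\<close>, so that \<open>\<tau>\<close> moves \<open>Z\<close> only by
  \<open>-\<delta>\<close>, and \<open>x1\<close> by \<open>1\<close>.\<close>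

definition \<tau> :: "('l \<Rightarrow> 'l) \<Rightarrow> 'l" where
  "\<tau> = group_element \<sigma>1 \<otimes>\<^bsub>R\<^esub> shift2 s"

definition \<Psi> :: "'l \<Rightarrow> 'l" where
  "\<Psi> y = act \<tau> y - y"

lemma \<tau>_in: "\<tau> \<in> carrier R"
  by (simp add: \<tau>_def group_element_in \<sigma>1 shift2_in s_in)

lemma act_\<tau>: "act \<tau> y = \<sigma>1 (act (shift2 s) y)"
  by (simp add: \<tau>_def act_mult group_element_in \<sigma>1 shift2_in s_in act_group_element)

lemma \<Psi>_K_linear: "K_linear \<Psi>"
  using act_K_linear(2)[of \<tau>] by (simp add: \<Psi>_def[abs_def])

lemma \<Psi>_basis:
  assumes "i < p" "j < p"
  shows "\<Psi> (basis (i, j)) = field_binomial (Z + - \<delta>) i * field_binomial (x1 + 1) j - basis (i, j)"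
  by (simp add: \<Psi>_def act_\<tau> act_shift2_basis[OF assms] galois_apply[OF \<sigma>1] s_in
      K.galois_field_binomial[OF \<sigma>1] \<sigma>_x \<sigma>_Z)

lemma raises_\<Psi>: "raises c \<Psi>"
proof (rule raises_by_basis[OF \<Psi>_K_linear])
  fix a assume "a \<in> index"
  then obtain i j where a: "a = (i, j)" "i < p" "j < p" by auto
  show "v (\<Psi> (basis a)) \<ge> Fin (weight a + c)"
    using v_basis_shift(1)[of "c - b" "- \<delta>" i j] a v_\<delta>_ge c_le c_gt_b by (simp add: \<Psi>_basis)
qed

lemma v_\<Psi>:
  assumes "v \<rho> = Fin n" "n mod (int p)\<^sup>2 = b mod (int p)\<^sup>2"
  shows "v (\<Psi> \<rho>) = Fin (n + c)"
proof (rule exact_by_top[OF \<Psi>_K_linear raises_\<Psi> _ assms])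
  have lt: "p - 1 < p" "0 < p - 1"
    using p_gt_1 by auto
  have ge: "v (- \<delta>) \<ge> Fin (c - b)" "c - b \<ge> 0" "c - b + b \<le> b * int p"
    using v_\<delta>_ge c_gt_b c_le by auto
  from v_\<delta> show "v (\<Psi> (basis (p - 1, p - 1))) = Fin (weight (p - 1, p - 1) + c)"
  proof
    assume "v \<delta> = Fin (c - b) \<and> c < b * int p"
    then have "v (- \<delta>) = Fin (c - b)" "c - b + b < b * int p"
      by simp_all
    then show ?thesis
      using v_basis_shift(2)[OF ge(1,2) lt(1,1) ge(3) lt(2)] unfolding \<Psi>_basis[OF lt(1,1)] by simp
  next
    assume "v \<delta> \<ge> Fin (c - b + 1) \<and> c = b * int p"
    then have "v (- \<delta>) \<ge> Fin (b * int p - b + 1)" "c = b * int p"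
      by auto
    then show ?thesis
      using v_basis_shift(3)[OF ge(1,2) lt(1,1) ge(3) lt(2)] unfolding \<Psi>_basis[OF lt(1,1)] by simp
  qed
qed

text \<open>Hence \<open>\<sigma>1 - 1\<close> lies in \<open>\<Psi> F[G] + X2 F[X2]\<close>.\<close>

lemma X1_eq: "X1 y = \<Psi> (act (shift2 (- s)) y) + (act (shift2 (- s)) y - y)"
  by (simp add: \<Psi>_def act_\<tau> act_shift2_inverse s_in X1_def)

lemma X1_\<Psi>_commute: "X1 (\<Psi> y) = \<Psi> (X1 y)"
proof -
  note \<sigma>1_in = group_element_in[OF \<sigma>1]
  have "\<sigma>1 (act \<tau> y) = act (group_element \<sigma>1 \<otimes>\<^bsub>R\<^esub> \<tau>) y"
    by (simp only: act_mult[OF \<sigma>1_in \<tau>_in] act_group_element[OF \<sigma>1])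
  also have "group_element \<sigma>1 \<otimes>\<^bsub>R\<^esub> \<tau> = \<tau> \<otimes>\<^bsub>R\<^esub> group_element \<sigma>1"
    by (rule R.m_comm[OF \<sigma>1_in \<tau>_in])
  also have "act (\<tau> \<otimes>\<^bsub>R\<^esub> group_element \<sigma>1) y = act \<tau> (\<sigma>1 y)"
    by (simp only: act_mult[OF \<tau>_in \<sigma>1_in] act_group_element[OF \<sigma>1])
  finally have comm: "\<sigma>1 (act \<tau> y) = act \<tau> (\<sigma>1 y)" .
  have diff: "act \<tau> (\<sigma>1 y - y) = act \<tau> (\<sigma>1 y) - act \<tau> y"
    using act_add[of \<tau> "\<sigma>1 y - y" y] by (simp only: diff_add_cancel eq_diff_eq)
  show ?thesis
    unfolding \<Psi>_def X1_def K.galois_diff[OF \<sigma>1] comm diff by (simp only: algebra_simps)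
qed

text \<open>The image of \<open>\<rho>\<close> under the multiples of \<open>X2 ^ n\<close> in
  \<open>F[X2]\<close>. Coefficients in \<open>F\<close> are zero or units, so they do not disturb
  the valuations of the powers.\<close>

definition tail :: "'l \<Rightarrow> nat \<Rightarrow> 'l set" where
  "tail \<rho> n = {z. \<exists>f. (\<forall>m. f m \<in> F) \<and> (\<forall>m<n. f m = 0) \<and> z = (\<Sum>m<p. f m * (X2 ^^ m) \<rho>)}"

lemma tailI: "(\<And>m. f m \<in> F) \<Longrightarrow> (\<And>m. m < n \<Longrightarrow> f m = 0) \<Longrightarrow> z = (\<Sum>m<p. f m * (X2 ^^ m) \<rho>) \<Longrightarrow> z \<in> tail \<rho> n"
  unfolding tail_def by blast

lemma tailE:
  assumes "z \<in> tail \<rho> n"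
  obtains f where "\<And>m. f m \<in> F" "\<And>m. m < n \<Longrightarrow> f m = 0" "z = (\<Sum>m<p. f m * (X2 ^^ m) \<rho>)"
  using assms unfolding tail_def by blast

lemma tail_zero: "0 \<in> tail \<rho> n"
  by (rule tailI[of "\<lambda>_. 0"]) auto

lemma tail_add:
  assumes "y \<in> tail \<rho> n" "z \<in> tail \<rho> n"
  shows "y + z \<in> tail \<rho> n"
proof -
  obtain f where f: "\<And>m. f m \<in> F" "\<And>m. m < n \<Longrightarrow> f m = 0" "y = (\<Sum>m<p. f m * (X2 ^^ m) \<rho>)"
    using assms(1) by (rule tailE) blast
  obtain g where g: "\<And>m. g m \<in> F" "\<And>m. m < n \<Longrightarrow> g m = 0" "z = (\<Sum>m<p. g m * (X2 ^^ m) \<rho>)"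
    using assms(2) by (rule tailE) blast
  show ?thesis
    by (rule tailI[of "\<lambda>m. f m + g m"]) (use f g in \<open>auto simp: distrib_right sum.distrib intro: F.add_in\<close>)
qed

lemma tail_scale:
  assumes "y \<in> tail \<rho> n" "d \<in> F"
  shows "d * y \<in> tail \<rho> n"
proof -
  obtain f where f: "\<And>m. f m \<in> F" "\<And>m. m < n \<Longrightarrow> f m = 0" "y = (\<Sum>m<p. f m * (X2 ^^ m) \<rho>)"
    using assms(1) by (rule tailE) blast
  show ?thesis
    by (rule tailI[of "\<lambda>m. d * f m"]) (use f assms(2) in \<open>auto simp: sum_distrib_left mult.assoc intro: F.mult_in\<close>)
qed

lemma tail_sum: "(\<And>i. i \<in> A \<Longrightarrow> f i \<in> tail \<rho> n) \<Longrightarrow> sum f A \<in> tail \<rho> n"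
  by (induction A rule: infinite_finite_induct) (auto intro: tail_zero tail_add)

lemma tail_mono: "y \<in> tail \<rho> n \<Longrightarrow> m \<le> n \<Longrightarrow> y \<in> tail \<rho> m"
  by (erule tailE, rule tailI) auto

lemma tail_X2:
  assumes "y \<in> tail \<rho> n"
  shows "X2 y \<in> tail \<rho> (Suc n)"
proof -
  obtain f where f: "\<And>m. f m \<in> F" "\<And>m. m < n \<Longrightarrow> f m = 0" "y = (\<Sum>m<p. f m * (X2 ^^ m) \<rho>)"
    using assms by (rule tailE) blast
  obtain q where q: "p = Suc q"
    using p_pos by (cases p) auto
  let ?g = "\<lambda>m. case m of 0 \<Rightarrow> 0 | Suc m \<Rightarrow> f m"
  have "X2 y = (\<Sum>m<p. X2 (f m * (X2 ^^ m) \<rho>))"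
    unfolding f(3) by (rule K_linear_sum[OF X_K_linear(2)])
  also have "\<dots> = (\<Sum>m<p. f m * (X2 ^^ Suc m) \<rho>)"
    using f(1) F_sub_K X_scale(2) by (intro sum.cong) auto
  \<comment> \<open>The last term vanishes because \<open>X2 ^ p = 0\<close>.\<close>
  also have "\<dots> = (\<Sum>m<q. f m * (X2 ^^ Suc m) \<rho>)"
    using X2_pow_p[of \<rho>] unfolding q by simp
  also have "\<dots> = (\<Sum>m<p. ?g m * (X2 ^^ m) \<rho>)"
    unfolding q by (subst sum.lessThan_Suc_shift) simp
  finally show ?thesis
    by (rule tailI[rotated 2]) (use f in \<open>auto split: nat.splits\<close>)
qed

text \<open>In \<open>shift2 u - 1\<close> the constant term has cancelled, so it is divisible by
  \<open>X2\<close>.\<close>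

lemma tail_shift2:
  assumes "z \<in> tail \<rho> n" "u \<in> F"
  shows "act (shift2 u) z - z \<in> tail \<rho> (Suc n)"
proof -
  obtain q where q: "p = Suc q"
    using p_pos by (cases p) auto
  have X: "(X2 ^^ Suc r) z \<in> tail \<rho> (Suc n)" for r
  proof (induction r)
    case 0 show ?case using tail_X2[OF assms(1)] by simp
  next
    case (Suc r)
    then show ?case
      using tail_mono[OF tail_X2[OF Suc], of "Suc n"] by simp
  qed
  have "act (shift2 u) z - z = (\<Sum>r<q. field_binomial u (Suc r) * (X2 ^^ Suc r) z)"
  proof -
    have "(\<Sum>r<p. f r) = f 0 + (\<Sum>r<q. f (Suc r))" for f :: "nat \<Rightarrow> 'l"
      by (simp only: q sum.lessThan_Suc_shift)
    then show ?thesis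
      by (simp add: act_shift2)
  qed
  also have "\<dots> \<in> tail \<rho> (Suc n)"
    by (intro tail_sum tail_scale X F.field_binomial_in assms)
  finally show ?thesis .
qed

text \<open>For a criterion element the nonzero terms have distinct valuations
  \<open>n + mb\<close>, so one of them gives the valuation of the sum exactly.\<close>

lemma v_tail:
  assumes "v \<rho> = Fin n" "n mod (int p)\<^sup>2 = b mod (int p)\<^sup>2" "z \<in> tail \<rho> l" "z \<noteq> 0"
  obtains m where "l \<le> m" "m < p" "v z = Fin (n + int m * b)"
proof -
  obtain f where f: "\<And>m. f m \<in> F" "\<And>m. m < l \<Longrightarrow> f m = 0" "z = (\<Sum>m<p. f m * (X2 ^^ m) \<rho>)"
    using assms(3) by (rule tailE) blast
  have t: "v (f m * (X2 ^^ m) \<rho>) = Fin (n + int m * b)" if "m < p" "f m \<noteq> 0" for m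
    using v_mult_Fin[OF v_F[OF f(1) that(2)] v_X2_pow[OF assms(1,2) that(1)]] by simp
  have distinct: "v (f i * (X2 ^^ i) \<rho>) \<noteq> v (f j * (X2 ^^ j) \<rho>)"
    if "i \<in> {..<p}" "j \<in> {..<p}" "i \<noteq> j" "f i * (X2 ^^ i) \<rho> \<noteq> 0" for i j
  proof (cases "f j = 0")
    case True
    then show ?thesis
      using that t[of i] by auto
  next
    case False
    then show ?thesis
      using that t[of i] t[of j] b_pos by auto
  qed
  have "{..<p} \<noteq> {}"
    using p_pos by (simp add: lessThan_empty_iff)
  then obtain m where m: "m \<in> {..<p}" "v z = v (f m * (X2 ^^ m) \<rho>)"
    unfolding f(3) by (rule v_sum_distinct[of "{..<p}" "\<lambda>m. f m * (X2 ^^ m) \<rho>", OF finite_lessThan _ distinct])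
  have "f m \<noteq> 0"
    using m(2) assms(4) by auto
  then have "l \<le> m" "v z = Fin (n + int m * b)"
    using f(2)[of m] m t[of m] by (auto simp: not_less[symmetric])
  then show ?thesis
    using that m(1) by blast
qed

lemma v_tail_ge:
  assumes "v \<rho> = Fin n" "n mod (int p)\<^sup>2 = b mod (int p)\<^sup>2" "z \<in> tail \<rho> l"
  shows "v z \<ge> Fin (n + int l * b)"
proof (cases "z = 0")
  case False
  obtain m where "l \<le> m" "v z = Fin (n + int m * b)"
    using v_tail[OF assms False] by blast
  then show ?thesis
    using b_pos by (simp add: mult_right_mono)
qed simp

text \<open>With \<open>U = shift2 (- s)\<close>, \<open>X1 = \<Psi> U + (U - 1)\<close>, so
  \<open>X1\<close> sends \<open>\<Psi> u + z\<close> to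
  \<open>\<Psi> (X1 u + U z) + (U z - z)\<close>. Each application gains \<open>b\<close> in
  \<open>u\<close> and one power of \<open>X2\<close> in the tail; the bound for \<open>u\<close> is
  one \<open>b\<close> behind because \<open>U z\<close> enters it without a gain.\<close>

lemma monomial_decomposition:
  assumes \<rho>: "v \<rho> = Fin n" "n mod (int p)\<^sup>2 = b mod (int p)\<^sup>2" and "j < p"
  shows "\<exists>u z. (X1 ^^ i) ((X2 ^^ j) \<rho>) = \<Psi> u + z \<and> v u \<ge> Fin (n + b * (int (i + j) - 1)) \<and> z \<in> tail \<rho> (i + j)"
proof (induction i)
  case 0
  have "(X2 ^^ j) \<rho> = (\<Sum>m<p. (if m = j then 1 else 0) * (X2 ^^ m) \<rho>)"
    using assms(3) by (simp add: if_distrib[of "\<lambda>x. x * _"] sum.delta cong: if_cong)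
  then have "(X2 ^^ j) \<rho> \<in> tail \<rho> j"
    by (rule tailI[rotated 2]) auto
  moreover have "\<Psi> 0 = 0"
    by (simp add: \<Psi>_def)
  ultimately show ?case
    by (intro exI[of _ 0] exI[of _ "(X2 ^^ j) \<rho>"]) simp
next
  case (Suc i)
  then obtain u z where uz: "(X1 ^^ i) ((X2 ^^ j) \<rho>) = \<Psi> u + z" "v u \<ge> Fin (n + b * (int (i + j) - 1))"
    "z \<in> tail \<rho> (i + j)"
    by blast
  let ?Uz = "act (shift2 (- s)) z"
  have s': "- s \<in> F"
    by (intro F.uminus_in s_in)
  have "(X1 ^^ Suc i) ((X2 ^^ j) \<rho>) = \<Psi> (X1 u) + (\<Psi> ?Uz + (?Uz - z))"
    by (simp add: uz(1) X_add X1_\<Psi>_commute) (rule X1_eq)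
  also have "\<dots> = \<Psi> (X1 u + ?Uz) + (?Uz - z)"
    using \<Psi>_K_linear by (simp add: K_linear_def)
  finally have "(X1 ^^ Suc i) ((X2 ^^ j) \<rho>) = \<Psi> (X1 u + ?Uz) + (?Uz - z)" .
  moreover have "?Uz - z \<in> tail \<rho> (Suc i + j)"
    using tail_shift2[OF uz(3) s'] by simp
  moreover have "v (X1 u + ?Uz) \<ge> Fin (n + b * (int (Suc i + j) - 1))"
  proof (rule v_add)
    show "v (X1 u) \<ge> Fin (n + b * (int (Suc i + j) - 1))"
      using raisesD[OF raises_X1 uz(2)] by (simp add: algebra_simps)
    show "v ?Uz \<ge> Fin (n + b * (int (Suc i + j) - 1))"
      using raisesD[OF raises_act[OF shift2_in[OF s']] v_tail_ge[OF \<rho> uz(3)]] by (simp add: algebra_simps)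
  qed
  ultimately show ?case
    by blast
qed

text \<open>Since \<open>k \<ge> 2\<close>, only monomials of total degree at least \<open>2\<close>
  occur. Hence \<open>\<Psi> u\<close> gains at least \<open>b + c\<close>, and the tail starts at
  \<open>X2 ^ 2\<close>.\<close>

lemma augmentation_power_decomposition:
  assumes \<rho>: "v \<rho> = Fin n" "n mod (int p)\<^sup>2 = b mod (int p)\<^sup>2"
    and a: "a \<in> augmentation_power F G k" and k: "2 \<le> k" "k \<le> p"
  obtains u z where "act a \<rho> = \<Psi> u + z" "v u \<ge> Fin (n + b)" "z \<in> tail \<rho> 2"
proof -
  have aR: "a \<in> carrier R"
    using ideal.Icarr[OF ideal_augmentation_power a] .
  obtain d where d: "\<And>i j. d i j \<in> F" "\<And>i j. i + j < k \<Longrightarrow> d i j = 0"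
    "a = (\<lambda>g. \<Sum>i<p. \<Sum>j<p. d i j * monom_R i j g)"
    using kills_expansion[OF aR k(2)] augmentation_power_kills[OF a k(2)] by blast
  define P where "P y \<longleftrightarrow> (\<exists>u z. y = \<Psi> u + z \<and> v u \<ge> Fin (n + b) \<and> z \<in> tail \<rho> 2)" for y
  have \<Psi>0: "\<Psi> 0 = 0"
    by (simp add: \<Psi>_def)
  have P0: "P 0"
    unfolding P_def by (intro exI[of _ 0]) (simp add: \<Psi>0 tail_zero)
  have P_add: "P (y + y')" if y: "P y" and y': "P y'" for y y'
  proof -
    obtain u z where uz: "y = \<Psi> u + z" "v u \<ge> Fin (n + b)" "z \<in> tail \<rho> 2"
      using y unfolding P_def by blast
    obtain u' z' where uz': "y' = \<Psi> u' + z'" "v u' \<ge> Fin (n + b)" "z' \<in> tail \<rho> 2"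
      using y' unfolding P_def by blast
    have "y + y' = \<Psi> (u + u') + (z + z')"
      using \<Psi>_K_linear uz uz' by (simp add: K_linear_def)
    then show ?thesis
      unfolding P_def using v_add[OF uz(2) uz'(2)] tail_add[OF uz(3) uz'(3)] by blast
  qed
  have P_sum: "P (sum f A)" if "\<And>i. i \<in> A \<Longrightarrow> P (f i)" for f and A :: "nat set"
    using that by (induction A rule: infinite_finite_induct) (auto intro: P0 P_add)
  have "P (d i j * (X1 ^^ i) ((X2 ^^ j) \<rho>))" if jp: "j < p" for i j
  proof (cases "i + j < k")
    case True
    then show ?thesis
      using d(2) P0 by simp
  next
    case False
    obtain u z where uz: "(X1 ^^ i) ((X2 ^^ j) \<rho>) = \<Psi> u + z" "v u \<ge> Fin (n + b * (int (i + j) - 1))"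
      "z \<in> tail \<rho> (i + j)"
      using monomial_decomposition[OF \<rho> jp] by blast
    have "b * (int (i + j) - 1) \<ge> b * 1"
      using False k b_pos by (intro mult_left_mono) auto
    then have "v u \<ge> Fin (n + b)"
      by (intro v_mono[OF uz(2)]) simp
    then have "v (d i j * u) \<ge> Fin (0 + (n + b))"
      by (intro v_mult_ge v_F_ge d(1))
    moreover have "d i j * z \<in> tail \<rho> 2"
      using tail_mono[OF uz(3), of 2] False k by (intro tail_scale d(1)) auto
    moreover have "d i j * (X1 ^^ i) ((X2 ^^ j) \<rho>) = \<Psi> (d i j * u) + d i j * z"
    proof -
      have "d i j \<in> K"
        using d(1) F_sub_K by blast
      then show ?thesis
        using \<Psi>_K_linear by (simp add: uz(1) K_linear_def distrib_left)
    qed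
    ultimately show ?thesis
      unfolding P_def by auto
  qed
  then have "P (\<Sum>i<p. \<Sum>j<p. d i j * (X1 ^^ i) ((X2 ^^ j) \<rho>))"
    by (intro P_sum) auto
  moreover have "act a \<rho> = (\<Sum>i<p. \<Sum>j<p. d i j * (X1 ^^ i) ((X2 ^^ j) \<rho>))"
    unfolding d(3) act_pointwise_sum act_pointwise act_monom_R by (rule refl)
  ultimately show ?thesis
    using that unfolding P_def by auto
qed

end

section \<open>Jumps of the classes in the span\<close>

context scaffold
begin

lemma translates_\<tau>: "translates k \<tau> 1 s" if "k \<le> p"
proof -
  have 1: "translates k (group_element \<sigma>1) 1 0"
    by (rule translates_group_element[OF \<sigma>1]) (simp_all add: \<sigma>_x)
  have "translates k (group_element \<sigma>2) 0 1"
    by (rule translates_group_element[OF \<sigma>2]) (simp_all add: \<sigma>_x)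
  then have "translates k (shift2 s) (s * 0) (s * 1)"
    unfolding shift2_def
    by (rule translates_truncated_power[OF group_element_in[OF \<sigma>2] that _ K.zero_in K.one_in])
  moreover have "s * 0 \<in> K" "s * 1 \<in> K"
    using s_in F_sub_K by auto
  ultimately have "translates k \<tau> (1 + s * 0) (0 + s * 1)"
    unfolding \<tau>_def by (intro translates_mult[OF group_element_in[OF \<sigma>1] shift2_in[OF s_in] that 1])
  then show ?thesis by simp
qed

text \<open>A standard representative of the class with vector \<open>(m, m * s + d)\<close>: the
  coordinates \<open>m\<close>, \<open>d\<close> refer to the basis \<open>\<tau>\<close>,
  \<open>\<sigma>2\<close> of the span, which is adapted to the two breaks.\<close>

definition reference :: "'l \<Rightarrow> 'l \<Rightarrow> ('l \<Rightarrow> 'l) \<Rightarrow> 'l" where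
  "reference m d = truncated_power p F G \<tau> m \<otimes>\<^bsub>R\<^esub> shift2 d"

lemma reference_in: "m \<in> F \<Longrightarrow> d \<in> F \<Longrightarrow> reference m d \<in> carrier R"
  unfolding reference_def by (intro R.m_closed truncated_power_in \<tau>_in shift2_in)

lemma translates_reference:
  assumes "k \<le> p" "m \<in> F" "d \<in> F"
  shows "translates k (reference m d) m (m * s + d)"
proof -
  have K: "m \<in> K" "d \<in> K" "s \<in> K"
    using assms s_in F_sub_K by auto
  have 1: "translates k (truncated_power p F G \<tau> m) (m * 1) (m * s)"
    by (rule translates_truncated_power[OF \<tau>_in assms(1) translates_\<tau>[OF assms(1)] K.one_in K(3)])
  have "translates k (group_element \<sigma>2) 0 1"
    by (rule translates_group_element[OF \<sigma>2]) (simp_all add: \<sigma>_x)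
  then have 2: "translates k (shift2 d) (d * 0) (d * 1)"
    unfolding shift2_def
    by (rule translates_truncated_power[OF group_element_in[OF \<sigma>2] assms(1) _ K.zero_in K.one_in])
  have "d * 0 \<in> K" "d * 1 \<in> K"
    using K by auto
  then have "translates k (reference m d) (m * 1 + d * 0) (m * s + d * 1)"
    unfolding reference_def
    by (intro translates_mult[OF truncated_power_in[OF \<tau>_in assms(2)] shift2_in[OF assms(3)] assms(1) 1 2])
  then show ?thesis by simp
qed

lemma act_\<tau>_power: "act (truncated_power p F G \<tau> m) y = (\<Sum>r<p. field_binomial m r * (\<Psi> ^^ r) y)"
  unfolding act_truncated_power[OF \<tau>_in] by (simp add: \<Psi>_def[abs_def])

lemma sum_two_terms:
  fixes f :: "nat \<Rightarrow> 'l"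
  shows "(\<Sum>r<p. f r) = f 0 + f 1 + (\<Sum>r\<in>{2..<p}. f r)"
proof -
  have "{..<p} = insert 0 (insert 1 {2..<p})"
    using p_gt_1 by auto
  then show ?thesis by (simp add: add.assoc)
qed

lemma raises_truncated:
  assumes "m \<in> F" "raises r T" "r > 0"
  shows "raises (2 * r) (\<lambda>y. \<Sum>i\<in>{2..<p}. field_binomial m i * (T ^^ i) y)"
proof (intro raises_sum raises_scale v_F_ge F.field_binomial_in assms(1))
  fix i assume "i \<in> {2..<p}"
  then have "2 * r \<le> int i * r"
    using assms(3) by (intro mult_right_mono) auto
  then show "raises (2 * r) (T ^^ i)"
    by (rule raises_mono[OF raises_pow[OF assms(2)]])
qed

lemma \<tau>_power_minus_one:
  "act (truncated_power p F G \<tau> m) y - y = m * \<Psi> y + (\<Sum>r\<in>{2..<p}. field_binomial m r * (\<Psi> ^^ r) y)"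
  unfolding act_\<tau>_power sum_two_terms by simp

lemma shift2_minus_one:
  "act (shift2 d) y - y = d * X2 y + (\<Sum>r\<in>{2..<p}. field_binomial d r * (X2 ^^ r) y)"
  unfolding act_shift2 sum_two_terms by simp

lemma c_pos: "c > 0"
  using c_gt_b b_pos by simp

lemma raises_\<tau>_power: "m \<in> F \<Longrightarrow> raises c (\<lambda>y. act (truncated_power p F G \<tau> m) y - y)"
  unfolding \<tau>_power_minus_one
  by (intro raises_add raises_scale v_F_ge raises_\<Psi> raises_mono[OF raises_truncated[OF _ raises_\<Psi> c_pos]])
    (use c_pos in auto)

lemma raises_shift2: "d \<in> F \<Longrightarrow> raises b (\<lambda>y. act (shift2 d) y - y)"
  unfolding shift2_minus_one
  by (intro raises_add raises_scale v_F_ge raises_X2 raises_mono[OF raises_truncated[OF _ raises_X2 b_pos]])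
    (use b_pos in auto)

lemma act_reference:
  assumes "m \<in> F" "d \<in> F"
  shows "act (reference m d) y - y =
    (act (truncated_power p F G \<tau> m) (act (shift2 d) y) - act (shift2 d) y) + (act (shift2 d) y - y)"
  unfolding reference_def by (simp add: act_mult truncated_power_in \<tau>_in shift2_in assms)

lemma act_shift2_0: "act (shift2 0) y = y"
proof -
  have "field_binomial 0 r = (if r = 0 then 1 else 0::'l)" if "r < p" for r
    using field_binomial_of_nat[OF that, of 0] by (cases r) auto
  then have "act (shift2 0) y = (\<Sum>r<p. if r = 0 then (X2 ^^ r) y else 0)"
    unfolding act_shift2 by (intro sum.cong) auto
  then show ?thesis
    using p_pos by (simp add: sum.delta)
qed

text \<open>The raising clause is a lower bound for the maximum attached to the class, the last
  clause an upper bound. The former concerns all elements and the latter only criterion elements, so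
  both kinds of refined breaks can be read off.\<close>

definition has_jump :: "(('l \<Rightarrow> 'l) \<Rightarrow> 'l) set \<Rightarrow> int \<Rightarrow> bool" where
  "has_jump C r \<longleftrightarrow> C \<subseteq> carrier R \<and> (\<exists>\<gamma>\<in>C. raises r (\<lambda>y. act \<gamma> y - y)) \<and>
    (\<forall>\<gamma>\<in>C. \<forall>\<rho> n. v \<rho> = Fin n \<longrightarrow> n mod (int p)\<^sup>2 = b mod (int p)\<^sup>2 \<longrightarrow> v (act \<gamma> \<rho> - \<rho>) \<le> Fin (n + r))"

context
  fixes k :: nat
  assumes k: "2 \<le> k" "k \<le> p"
begin

lemma class_carrier: "a \<in> carrier R \<Longrightarrow> truncated_class F G k a \<subseteq> carrier R"
  using truncated_class_iff by blast

lemma act_class: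
  assumes "a \<in> carrier R" "\<gamma> \<in> truncated_class F G k a"
    and \<rho>: "v \<rho> = Fin n" "n mod (int p)\<^sup>2 = b mod (int p)\<^sup>2"
  obtains u z where "act \<gamma> \<rho> - \<rho> = (act a \<rho> - \<rho>) + (\<Psi> u + z)" "v u \<ge> Fin (n + b)" "z \<in> tail \<rho> 2"
proof -
  have "(\<lambda>g. \<gamma> g - a g) \<in> augmentation_power F G k"
    using truncated_class_iff[OF assms(1)] assms(2) by simp
  then obtain u z where "act (\<lambda>g. \<gamma> g - a g) \<rho> = \<Psi> u + z" "v u \<ge> Fin (n + b)" "z \<in> tail \<rho> 2"
    using augmentation_power_decomposition[OF \<rho> _ k] by blast
  then show ?thesis
    using that[of u z] by (simp add: act_pointwise algebra_simps)
qed

text \<open>The leading term is \<open>d * X2 \<rho>\<close> with gain exactly \<open>b\<close>; the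
  \<open>\<tau>\<close> part gains at least \<open>c > b\<close>, and all errors from
  \<open>A ^ k\<close> or from higher powers of \<open>X2\<close> gain more than
  \<open>b\<close>.\<close>

lemma has_jump_b:
  assumes "m \<in> F" "d \<in> F" "d \<noteq> 0"
  shows "has_jump (truncated_class F G k (reference m d)) b"
  unfolding has_jump_def
proof (intro conjI ballI allI impI)
  note ref = reference_in[OF assms(1,2)]
  show "truncated_class F G k (reference m d) \<subseteq> carrier R"
    by (rule class_carrier[OF ref])
  have "raises b (\<lambda>y. act (truncated_power p F G \<tau> m) (act (shift2 d) y) - act (shift2 d) y)"
    using raises_comp[OF raises_\<tau>_power[OF assms(1)] raises_act[OF shift2_in[OF assms(2)]]] c_gt_b
    by (auto elim: raises_mono)
  then have "raises b (\<lambda>y. act (reference m d) y - y)"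
    unfolding act_reference[OF assms(1,2)] by (intro raises_add raises_shift2 assms(2))
  then show "\<exists>\<gamma>\<in>truncated_class F G k (reference m d). raises b (\<lambda>y. act \<gamma> y - y)"
    using truncated_class_mem[OF ref] by blast
  fix \<gamma> \<rho> n
  assume \<gamma>: "\<gamma> \<in> truncated_class F G k (reference m d)"
    and \<rho>: "v \<rho> = Fin n" "n mod (int p)\<^sup>2 = b mod (int p)\<^sup>2"
  obtain u z where uz: "act \<gamma> \<rho> - \<rho> = (act (reference m d) \<rho> - \<rho>) + (\<Psi> u + z)" "v u \<ge> Fin (n + b)" "z \<in> tail \<rho> 2"
    using act_class[OF ref \<gamma> \<rho>] by blast
  let ?y = "act (shift2 d) \<rho>"
  let ?A = "act (truncated_power p F G \<tau> m) ?y - ?y"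
  let ?B = "\<Sum>r\<in>{2..<p}. field_binomial d r * (X2 ^^ r) \<rho>"
  have eq: "act \<gamma> \<rho> - \<rho> = d * X2 \<rho> + (?B + (?A + (\<Psi> u + z)))"
    unfolding uz(1) act_reference[OF assms(1,2)] shift2_minus_one by (simp only: add_ac)
  have "v (d * X2 \<rho>) = Fin (0 + (n + b))"
    using v_X2_pow[OF \<rho>, of 1] p_gt_1 by (intro v_mult_Fin v_F assms) simp
  then have 1: "v (d * X2 \<rho>) = Fin (n + b)"
    by simp
  have \<rho>_ge: "v \<rho> \<ge> Fin n"
    using \<rho>(1) by simp
  have y_ge: "v ?y \<ge> Fin n"
    using raisesD[OF raises_act[OF shift2_in[OF assms(2)]] \<rho>_ge] by simp
  have "v (?B + (?A + (\<Psi> u + z))) \<ge> Fin (n + b + 1)"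
  proof (intro v_add)
    show "v ?B \<ge> Fin (n + b + 1)"
      by (rule v_mono[OF raisesD[OF raises_truncated[OF assms(2) raises_X2 b_pos] \<rho>_ge]]) (use b_pos in simp)
    show "v ?A \<ge> Fin (n + b + 1)"
      by (rule v_mono[OF raisesD[OF raises_\<tau>_power[OF assms(1)] y_ge]]) (use c_gt_b in simp)
    show "v (\<Psi> u) \<ge> Fin (n + b + 1)"
      by (rule v_mono[OF raisesD[OF raises_\<Psi> uz(2)]]) (use c_pos in simp)
    show "v z \<ge> Fin (n + b + 1)"
      by (rule v_mono[OF v_tail_ge[OF \<rho> uz(3)]]) (use b_pos in simp)
  qed
  then have "v (act \<gamma> \<rho> - \<rho>) = Fin (n + b)"
    unfolding eq by (rule v_add_eq[OF 1])
  then show "v (act \<gamma> \<rho> - \<rho>) \<le> Fin (n + b)"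
    by simp
qed

text \<open>Apart from the tail, everything is dominated by \<open>m * \<Psi> \<rho>\<close> with
  gain exactly \<open>c\<close>. A nonzero tail has gain \<open>ib \<noteq> c\<close>, so no
  cancellation can occur: the total gain is the smaller of the two.\<close>

lemma has_jump_c:
  assumes "m \<in> F" "m \<noteq> 0"
  shows "has_jump (truncated_class F G k (reference m 0)) c"
  unfolding has_jump_def
proof (intro conjI ballI allI impI)
  note ref = reference_in[OF assms(1) F.zero_in]
  show "truncated_class F G k (reference m 0) \<subseteq> carrier R"
    by (rule class_carrier[OF ref])
  have act_ref: "act (reference m 0) y - y = act (truncated_power p F G \<tau> m) y - y" for y
    unfolding act_reference[OF assms(1) F.zero_in] act_shift2_0 by simp
  have "raises c (\<lambda>y. act (reference m 0) y - y)"
    unfolding act_ref by (rule raises_\<tau>_power[OF assms(1)])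
  then show "\<exists>\<gamma>\<in>truncated_class F G k (reference m 0). raises c (\<lambda>y. act \<gamma> y - y)"
    using truncated_class_mem[OF ref] by blast
  fix \<gamma> \<rho> n
  assume \<gamma>: "\<gamma> \<in> truncated_class F G k (reference m 0)"
    and \<rho>: "v \<rho> = Fin n" "n mod (int p)\<^sup>2 = b mod (int p)\<^sup>2"
  obtain u z where uz: "act \<gamma> \<rho> - \<rho> = (act (reference m 0) \<rho> - \<rho>) + (\<Psi> u + z)" "v u \<ge> Fin (n + b)" "z \<in> tail \<rho> 2"
    using act_class[OF ref \<gamma> \<rho>] by blast
  let ?B = "\<Sum>r\<in>{2..<p}. field_binomial m r * (\<Psi> ^^ r) \<rho>"
  define y where "y = m * \<Psi> \<rho> + (?B + \<Psi> u)"
  have eq: "act \<gamma> \<rho> - \<rho> = y + z"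
    unfolding y_def uz(1) act_ref \<tau>_power_minus_one by (simp only: add_ac)
  have "v (m * \<Psi> \<rho>) = Fin (0 + (n + c))"
    by (intro v_mult_Fin v_F assms v_\<Psi> \<rho>)
  then have 1: "v (m * \<Psi> \<rho>) = Fin (n + c)"
    by simp
  have \<rho>_ge: "v \<rho> \<ge> Fin n"
    using \<rho>(1) by simp
  have "v (?B + \<Psi> u) \<ge> Fin (n + c + 1)"
  proof (intro v_add)
    show "v ?B \<ge> Fin (n + c + 1)"
      by (rule v_mono[OF raisesD[OF raises_truncated[OF assms(1) raises_\<Psi> c_pos] \<rho>_ge]]) (use c_pos in simp)
    show "v (\<Psi> u) \<ge> Fin (n + c + 1)"
      by (rule v_mono[OF raisesD[OF raises_\<Psi> uz(2)]]) (use b_pos in simp)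
  qed
  then have y: "v y = Fin (n + c)"
    unfolding y_def by (rule v_add_eq[OF 1])
  show "v (act \<gamma> \<rho> - \<rho>) \<le> Fin (n + c)"
  proof (cases "z = 0")
    case True
    then show ?thesis
      using eq y by simp
  next
    case False
    obtain i where i: "2 \<le> i" "i < p" "v z = Fin (n + int i * b)"
      using v_tail[OF \<rho> uz(3) False] by blast
    have "int i * b \<noteq> c"
      using c_neq[OF i(2)] by (simp add: mult.commute)
    then consider "int i * b < c" | "int i * b > c"
      by linarith
    then show ?thesis
    proof cases
      case 1
      then have "v (z + y) = Fin (n + int i * b)"
        using y by (intro v_add_eq[OF i(3)]) simp
      then show ?thesis
        using 1 eq by (simp add: add.commute)
    next
      case 2
      then have "v (y + z) = Fin (n + c)"
        using i(3) by (intro v_add_eq[OF y]) simp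
      then show ?thesis
        using eq by simp
    qed
  qed
qed

text \<open>Equality of vectors replaces the class by that of \<open>reference m d'\<close>. A
  nonzero \<open>d'\<close> gives \<open>b\<close>; if only \<open>m\<close> is nonzero the jump is
  \<open>c\<close>; the zero vector belongs to the trivial class.\<close>

lemma span_has_jump:
  assumes "C \<in> group_span p F G k" "C \<noteq> \<one>\<^bsub>truncated_algebra F G k\<^esub>"
  shows "has_jump C b \<or> has_jump C c"
proof -
  obtain a m d where a: "a \<in> carrier R" "m \<in> F" "d \<in> F" "C = truncated_class F G k a" "translates k a m d"
    using group_span_translates[OF assms(1) k(2)] by blast
  define d' where "d' = d - m * s"
  have d': "d' \<in> F"
    unfolding d'_def by (intro F.diff_in F.mult_in a s_in)
  have "translates k (reference m d') m d"
    using translates_reference[OF k(2) a(2) d'] by (simp add: d'_def)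
  then have C: "C = truncated_class F G k (reference m d')"
    unfolding a(4) by (rule translates_unique[OF a(1) reference_in[OF a(2) d'] k(2) a(5)])
  consider "d' \<noteq> 0" | "d' = 0" "m \<noteq> 0" | "d' = 0" "m = 0"
    by blast
  then show ?thesis
  proof cases
    case 1
    then show ?thesis
      unfolding C using has_jump_b[OF a(2) d'] by simp
  next
    case 2
    then show ?thesis
      unfolding C using has_jump_c[OF a(2)] by simp
  next
    case 3
    have "translates k (group_element id) 0 0"
      using translates_group_element[OF G.one_closed] by simp
    moreover have "d = 0" "m = 0"
      using 3 by (simp_all add: d'_def)
    ultimately have "truncated_class F G k a = truncated_class F G k (group_element id)"
      using translates_unique[OF a(1) group_element_in[OF G.one_closed] k(2)] a(5) by simp
    then show ?thesis
      using assms(2) a(4) one_truncated_algebra[of k] by simp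
  qed
qed

text \<open>The representative \<open>1\<close> gives \<open>\<rho> - \<rho> = 0\<close>, whose
  valuation \<open>Pinf\<close> exceeds every finite bound.\<close>

lemma one_no_jump: "\<not> has_jump \<one>\<^bsub>truncated_algebra F G k\<^esub> r"
proof
  assume jump: "has_jump \<one>\<^bsub>truncated_algebra F G k\<^esub> r"
  obtain \<rho> where \<rho>: "v \<rho> = Fin b"
    using v_surj by blast
  have "group_element \<one>\<^bsub>G\<^esub> \<in> \<one>\<^bsub>truncated_algebra F G k\<^esub>"
    unfolding one_truncated_algebra by (rule truncated_class_mem[OF group_element_in[OF G.one_closed]])
  then have "v (act (group_element \<one>\<^bsub>G\<^esub>) \<rho> - \<rho>) \<le> Fin (b + r)"
    using jump \<rho> unfolding has_jump_def by blast
  moreover have "act (group_element \<one>\<^bsub>G\<^esub>) \<rho> - \<rho> = 0"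
    using act_group_element[OF G.one_closed, of \<rho>] by simp
  ultimately show False by simp
qed

text \<open>\<open>\<sigma>2\<close> realizes \<open>b\<close> and \<open>\<tau>\<close> realizes
  \<open>c\<close>; \<open>\<tau>\<close> is in the span as a product of a group element and a
  truncated power.\<close>

lemma exists_jump:
  assumes "r = b \<or> r = c"
  obtains C where "C \<in> group_span p F G k" "C \<noteq> \<one>\<^bsub>truncated_algebra F G k\<^esub>" "has_jump C r"
proof -
  have s2: "truncated_class F G k (group_element \<sigma>2) \<in> group_span p F G k"
    by (rule group_span.base[OF \<sigma>2])
  have s1: "truncated_class F G k (group_element \<sigma>1) \<in> group_span p F G k"
    by (rule group_span.base[OF \<sigma>1])
  have aug: "group_element \<sigma>2 \<in> one_plus_augmentation F G"
    using group_element_in[OF \<sigma>2] group_element_minus_one_in[OF \<sigma>2]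
    by (simp add: one_plus_augmentation_def)
  have sh: "truncated_class F G k (shift2 s) \<in> group_span p F G k"
    unfolding shift2_def by (rule group_span.scale[OF aug s2 s_in])
  have "truncated_class F G k \<tau> \<in> group_span p F G k"
    using group_span.mult[OF s1 sh]
    by (simp only: truncated_class_mult[OF group_element_in[OF \<sigma>1] shift2_in[OF s_in]] \<tau>_def)
  moreover have "truncated_class F G k \<tau> = truncated_class F G k (reference 1 0)"
    using translates_\<tau>[OF k(2)] translates_reference[OF k(2) F.one_in F.zero_in]
    by (intro translates_unique[OF \<tau>_in reference_in[OF F.one_in F.zero_in] k(2)]) simp_all
  ultimately have c: "truncated_class F G k (reference 1 0) \<in> group_span p F G k"
    by simp
  have "translates k (group_element \<sigma>2) 0 1"
    by (rule translates_group_element[OF \<sigma>2]) (simp_all add: \<sigma>_x)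
  then have "truncated_class F G k (group_element \<sigma>2) = truncated_class F G k (reference 0 1)"
    using translates_reference[OF k(2) F.zero_in F.one_in]
    by (intro translates_unique[OF group_element_in[OF \<sigma>2] reference_in[OF F.zero_in F.one_in] k(2)]) simp_all
  then have b: "truncated_class F G k (reference 0 1) \<in> group_span p F G k"
    using s2 by simp
  have "\<exists>C\<in>group_span p F G k. has_jump C r"
    using assms b c has_jump_b[OF F.zero_in F.one_in] has_jump_c[OF F.one_in] by auto
  then show ?thesis
    using that one_no_jump by blast
qed

section \<open>Both kinds of refined breaks computed from the jumps\<close>

lemma VC_index_eq:
  assumes C: "has_jump C r" and \<rho>: "v \<rho> = Fin n" "n mod (int p)\<^sup>2 = b mod (int p)\<^sup>2"
  shows "VC_index F G v \<rho> C = Fin (n + r)"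
  unfolding VC_index_def act_minus_one
proof (rule Greatest_equality)
  obtain \<gamma> where \<gamma>: "\<gamma> \<in> C" "raises r (\<lambda>y. act \<gamma> y - y)"
    using C unfolding has_jump_def by blast
  have "v (act \<gamma> \<rho> - \<rho>) \<ge> Fin (n + r)"
    using raisesD[OF \<gamma>(2), of n \<rho>] \<rho>(1) by simp
  moreover have "v (act \<gamma> \<rho> - \<rho>) \<le> Fin (n + r)"
    using C \<gamma>(1) \<rho> unfolding has_jump_def by blast
  ultimately show "\<exists>\<gamma>\<in>C. Fin (n + r) = v (act \<gamma> \<rho> - \<rho>)"
    using \<gamma>(1) by (intro bexI[of _ \<gamma>]) auto
  fix y assume "\<exists>\<gamma>\<in>C. y = v (act \<gamma> \<rho> - \<rho>)"
  then show "y \<le> Fin (n + r)"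
    using C \<rho> unfolding has_jump_def by blast
qed

lemma VC_set_eq:
  assumes "valuation_criterion p v b \<rho>"
  shows "VC_set p F G v k \<rho> = {Fin b, Fin c}"
proof -
  obtain n where \<rho>: "v \<rho> = Fin n" "n mod (int p)\<^sup>2 = b mod (int p)\<^sup>2"
    using assms unfolding valuation_criterion_def by blast
  have val: "VC_index F G v \<rho> C - v \<rho> = Fin r" if "has_jump C r" for C r
    using VC_index_eq[OF that \<rho>] \<rho>(1) by simp
  show ?thesis
  proof
    show "VC_set p F G v k \<rho> \<subseteq> {Fin b, Fin c}"
    proof
      fix x assume "x \<in> VC_set p F G v k \<rho>"
      then obtain C where C: "C \<in> group_span p F G k" "C \<noteq> \<one>\<^bsub>truncated_algebra F G k\<^esub>"
        "x = VC_index F G v \<rho> C - v \<rho>"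
        unfolding VC_set_def by blast
      then show "x \<in> {Fin b, Fin c}"
        using span_has_jump[OF C(1,2)] val by auto
    qed
    have "Fin r \<in> VC_set p F G v k \<rho>" if r: "r = b \<or> r = c" for r
    proof -
      obtain C where C: "C \<in> group_span p F G k" "C \<noteq> \<one>\<^bsub>truncated_algebra F G k\<^esub>" "has_jump C r"
        using exists_jump[OF r] by blast
      have "Fin r = VC_index F G v \<rho> C - v \<rho>"
        using val[OF C(3)] by simp
      then show ?thesis
        unfolding VC_set_def using C(1,2) by blast
    qed
    then show "{Fin b, Fin c} \<subseteq> VC_set p F G v k \<rho>"
      by simp
  qed
qed

lemma VC_refined_breaks_eq:
  "VC_refined_breaks_defined p F G v b k" "VC_refined_breaks p F G v b k = {Fin b, Fin c}"
proof -
  show "VC_refined_breaks_defined p F G v b k"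
    unfolding VC_refined_breaks_defined_def by (simp add: VC_set_eq)
  obtain \<rho> where "v \<rho> = Fin b"
    using v_surj by blast
  then have \<rho>: "valuation_criterion p v b \<rho>"
    by (simp add: valuation_criterion_def)
  show "VC_refined_breaks p F G v b k = {Fin b, Fin c}"
    unfolding VC_refined_breaks_def
  proof (rule the_equality)
    show "\<forall>\<rho>. valuation_criterion p v b \<rho> \<longrightarrow> VC_set p F G v k \<rho> = {Fin b, Fin c}"
      by (simp add: VC_set_eq)
    fix B assume "\<forall>\<rho>. valuation_criterion p v b \<rho> \<longrightarrow> VC_set p F G v k \<rho> = B"
    then show "B = {Fin b, Fin c}"
      using \<rho> VC_set_eq[OF \<rho>] by simp
  qed
qed

lemma v_minus_ge:
  assumes "raises r T" "x \<noteq> 0"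
  shows "v (T x) - v x \<ge> Fin r"
proof -
  obtain m where m: "v x = Fin m"
    using v_Fin[OF assms(2)] by blast
  then have "v (T x) \<ge> Fin (m + r)"
    using raisesD[OF assms(1), of m x] by simp
  then show ?thesis
    using m by (cases "v (T x)") auto
qed

text \<open>Existence of the minimum needs an argument, since \<open>int extended\<close> is not
  well-ordered: \<open>raises_act\<close> bounds the values below by \<open>0\<close>, so the finite
  ones are natural numbers.\<close>

lemma algebra_valuation_least:
  assumes "a \<in> carrier R"
  shows "\<exists>x. x \<noteq> 0 \<and> algebra_valuation G v a = v (act a x) - v x"
    and "x \<noteq> 0 \<Longrightarrow> algebra_valuation G v a \<le> v (act a x) - v x"
proof -
  let ?S = "\<lambda>n. \<exists>x. x \<noteq> 0 \<and> n = v (act a x) - v x"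
  have "\<exists>n. ?S n \<and> (\<forall>m. ?S m \<longrightarrow> n \<le> m)"
  proof (cases "\<exists>i. ?S (Fin (int i))")
    case True
    define i where "i = (LEAST i. ?S (Fin (int i)))"
    have i: "?S (Fin (int i))"
      unfolding i_def using True by (rule LeastI_ex)
    have "Fin (int i) \<le> m" if m: "?S m" for m
    proof -
      have "m \<ge> Fin 0"
        using m v_minus_ge[OF raises_act[OF assms]] by blast
      then consider "m = Pinf" | j where "m = Fin (int j)"
        by (cases m) (auto dest: zero_le_imp_eq_int)
      then show ?thesis
      proof cases
        case 2
        then have "i \<le> j"
          unfolding i_def using m by (intro Least_le) simp
        then show ?thesis
          using 2 by simp
      qed simp
    qed
    then show ?thesis
      using i by blast
  next
    case False
    have "m = Pinf" if m: "?S m" for m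
    proof -
      have "m \<ge> Fin 0"
        using m v_minus_ge[OF raises_act[OF assms]] by blast
      then consider "m = Pinf" | j where "m = Fin (int j)"
        by (cases m) (auto dest: zero_le_imp_eq_int)
      then show ?thesis
        using False m by cases auto
    qed
    moreover have "?S (v (act a 1) - v 1)"
      using one_neq_zero by blast
    ultimately show ?thesis
      by (metis order_refl)
  qed
  then obtain n where n: "?S n" "\<And>m. ?S m \<Longrightarrow> n \<le> m"
    by blast
  then have least: "algebra_valuation G v a = n"
    unfolding algebra_valuation_def by (intro Least_equality) blast+
  show "\<exists>x. x \<noteq> 0 \<and> algebra_valuation G v a = v (act a x) - v x"
    using n(1) least by simp
  show "x \<noteq> 0 \<Longrightarrow> algebra_valuation G v a \<le> v (act a x) - v x"
    unfolding least using n(2) by blast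
qed

lemma class_minus_one:
  assumes "C \<in> group_span p F G k"
  shows "C \<ominus>\<^bsub>truncated_algebra F G k\<^esub> \<one>\<^bsub>truncated_algebra F G k\<^esub> =
    {a \<in> carrier R. (\<lambda>g. a g + \<one>\<^bsub>R\<^esub> g) \<in> C}"
proof -
  obtain a where a: "a \<in> carrier R" "C = truncated_class F G k a"
    using group_span_translates[OF assms k(2)] by blast
  have one: "\<one>\<^bsub>R\<^esub> \<in> carrier R"
    by (rule R.one_closed)
  have one': "\<one>\<^bsub>truncated_algebra F G k\<^esub> = truncated_class F G k \<one>\<^bsub>R\<^esub>"
    by (simp only: one_truncated_algebra R_simps)
  have diff: "(\<lambda>g. a g - \<one>\<^bsub>R\<^esub> g) \<in> carrier R"
    using R.minus_closed[OF a(1) one] R_diff[OF one, of a] by simp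
  show ?thesis
    unfolding one' a(2) truncated_class_diff[OF a(1) one]
  proof (rule Set.set_eqI)
    fix x
    have "(\<lambda>g. x g - (a g - \<one>\<^bsub>R\<^esub> g)) = (\<lambda>g. (x g + \<one>\<^bsub>R\<^esub> g) - a g)"
      by (rule ext) (simp only: algebra_simps)
    moreover have "(\<lambda>g. x g + \<one>\<^bsub>R\<^esub> g) \<in> carrier R" if "x \<in> carrier R"
      using that one by (rule R_add_closed)
    ultimately show "x \<in> truncated_class F G k (\<lambda>g. a g - \<one>\<^bsub>R\<^esub> g) \<longleftrightarrow>
        x \<in> {x \<in> carrier R. (\<lambda>g. x g + \<one>\<^bsub>R\<^esub> g) \<in> truncated_class F G k a}"
      using truncated_class_iff[OF diff, of x k] truncated_class_iff[OF a(1), of "\<lambda>g. x g + \<one>\<^bsub>R\<^esub> g" k]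
      by auto
  qed
qed

text \<open>Testing on a single element of valuation \<open>b\<close> bounds every representative
  from above; the representative that raises by \<open>r\<close> attains the bound.\<close>

lemma coset_valuation_jump:
  assumes "C \<in> group_span p F G k" "has_jump C r"
  shows "coset_valuation G v (C \<ominus>\<^bsub>truncated_algebra F G k\<^esub> \<one>\<^bsub>truncated_algebra F G k\<^esub>) = Fin r"
  unfolding coset_valuation_def class_minus_one[OF assms(1)]
proof (rule Greatest_equality)
  obtain \<rho> where \<rho>: "v \<rho> = Fin b"
    using v_surj by blast
  then have "\<rho> \<noteq> 0" by auto
  have le: "algebra_valuation G v a \<le> Fin r"
    if a: "a \<in> carrier R" "(\<lambda>g. a g + \<one>\<^bsub>R\<^esub> g) \<in> C" for a
  proof -
    have "v (act (\<lambda>g. a g + \<one>\<^bsub>R\<^esub> g) \<rho> - \<rho>) \<le> Fin (b + r)"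
      using assms(2) a(2) \<rho> unfolding has_jump_def by blast
    then have "v (act a \<rho>) - v \<rho> \<le> Fin r"
      using \<rho> by (cases "v (act a \<rho>)") (simp_all add: act_pointwise act_one)
    then show ?thesis
      using algebra_valuation_least(2)[OF a(1) \<open>\<rho> \<noteq> 0\<close>] by (rule order_trans[rotated])
  qed
  then show "y \<le> Fin r"
    if "\<exists>\<gamma>\<in>{a \<in> carrier R. (\<lambda>g. a g + \<one>\<^bsub>R\<^esub> g) \<in> C}. y = algebra_valuation G v \<gamma>" for y
    using that by blast
  obtain \<gamma> where \<gamma>: "\<gamma> \<in> C" "raises r (\<lambda>y. act \<gamma> y - y)"
    using assms(2) unfolding has_jump_def by blast
  have one: "\<one>\<^bsub>R\<^esub> \<in> carrier R"
    by (rule R.one_closed)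
  have \<gamma>R: "\<gamma> \<in> carrier R"
    using assms(2) \<gamma>(1) unfolding has_jump_def by blast
  define a where "a = (\<lambda>g. \<gamma> g - \<one>\<^bsub>R\<^esub> g)"
  have a: "a \<in> carrier R" "(\<lambda>g. a g + \<one>\<^bsub>R\<^esub> g) = \<gamma>"
    using R.minus_closed[OF \<gamma>R one] R_diff[OF one, of \<gamma>] by (simp_all add: a_def)
  have "act a = (\<lambda>y. act \<gamma> y - y)"
    by (rule ext) (simp add: a_def act_pointwise act_one)
  then have "raises r (act a)"
    using \<gamma>(2) by simp
  moreover obtain x where "x \<noteq> 0" "algebra_valuation G v a = v (act a x) - v x"
    using algebra_valuation_least(1)[OF a(1)] by blast
  ultimately have "algebra_valuation G v a \<ge> Fin r"
    using v_minus_ge by simp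
  moreover have "algebra_valuation G v a \<le> Fin r"
    using le a \<gamma>(1) by simp
  ultimately show "\<exists>\<gamma>\<in>{a \<in> carrier R. (\<lambda>g. a g + \<one>\<^bsub>R\<^esub> g) \<in> C}. Fin r = algebra_valuation G v \<gamma>"
    using a \<gamma>(1) by (intro bexI[of _ a]) auto
qed

text \<open>The coset contains \<open>0\<close>, of valuation \<open>Pinf\<close>, so the trivial
  class lies in every step of the filtration and creates no break.\<close>

lemma coset_valuation_one:
  assumes "\<one>\<^bsub>truncated_algebra F G k\<^esub> \<in> group_span p F G k"
  shows "coset_valuation G v (\<one>\<^bsub>truncated_algebra F G k\<^esub> \<ominus>\<^bsub>truncated_algebra F G k\<^esub> \<one>\<^bsub>truncated_algebra F G k\<^esub>) = Pinf"
  unfolding coset_valuation_def class_minus_one[OF assms]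
proof (rule Greatest_equality)
  have zero: "\<zero>\<^bsub>R\<^esub> \<in> carrier R"
    by (rule R.zero_closed)
  obtain x where x: "x \<noteq> 0" "algebra_valuation G v \<zero>\<^bsub>R\<^esub> = v (act \<zero>\<^bsub>R\<^esub> x) - v x"
    using algebra_valuation_least(1)[OF zero] by blast
  have "act \<zero>\<^bsub>R\<^esub> x = 0"
    by (simp add: algebra_action_def R_simps)
  then have "algebra_valuation G v \<zero>\<^bsub>R\<^esub> = Pinf"
    using x v_Fin[OF x(1)] by auto
  moreover have "(\<lambda>g. \<zero>\<^bsub>R\<^esub> g + \<one>\<^bsub>R\<^esub> g) \<in> \<one>\<^bsub>truncated_algebra F G k\<^esub>"
    using truncated_class_mem[OF group_element_in[OF G.one_closed], of k]
    by (simp only: one_truncated_algebra R_simps add_0)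
  ultimately show "\<exists>\<gamma>\<in>{a \<in> carrier R. (\<lambda>g. a g + \<one>\<^bsub>R\<^esub> g) \<in> \<one>\<^bsub>truncated_algebra F G k\<^esub>}. Pinf = algebra_valuation G v \<gamma>"
    using zero by (intro bexI[of _ "\<zero>\<^bsub>R\<^esub>"]) auto
qed simp

lemma SS_refined_breaks_eq: "SS_refined_breaks p F G v k = {b, c}"
proof -
  let ?val = "\<lambda>C. coset_valuation G v (C \<ominus>\<^bsub>truncated_algebra F G k\<^esub> \<one>\<^bsub>truncated_algebra F G k\<^esub>)"
  have mem: "C \<in> SS_filtration p F G v k h \<longleftrightarrow> C \<in> group_span p F G k \<and> ?val C \<ge> Fin h" for C h
    by (simp add: SS_filtration_def)
  have vals: "?val C = Pinf \<or> ?val C = Fin b \<or> ?val C = Fin c" if "C \<in> group_span p F G k" for C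
    using span_has_jump[OF that] coset_valuation_jump[OF that] coset_valuation_one that by metis
  have sub: "SS_filtration p F G v k (h + 1) \<subseteq> SS_filtration p F G v k h" for h
  proof
    fix C assume C: "C \<in> SS_filtration p F G v k (h + 1)"
    have "Fin h \<le> Fin (h + 1)"
      by simp
    then show "C \<in> SS_filtration p F G v k h"
      using C unfolding mem by (meson order_trans)
  qed
  have "SS_filtration p F G v k (h + 1) \<noteq> SS_filtration p F G v k h \<longleftrightarrow> h = b \<or> h = c" for h
  proof
    assume "SS_filtration p F G v k (h + 1) \<noteq> SS_filtration p F G v k h"
    then obtain C where "C \<in> SS_filtration p F G v k h" "C \<notin> SS_filtration p F G v k (h + 1)"
      using sub by blast
    then have C: "C \<in> group_span p F G k" "?val C \<ge> Fin h" "\<not> ?val C \<ge> Fin (h + 1)"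
      unfolding mem by blast+
    show "h = b \<or> h = c"
      using vals[OF C(1)] C(2,3) by auto
  next
    assume "h = b \<or> h = c"
    then obtain C where C: "C \<in> group_span p F G k" "has_jump C h"
      using exists_jump by blast
    have "?val C = Fin h"
      by (rule coset_valuation_jump[OF C])
    then have "C \<in> SS_filtration p F G v k h" "C \<notin> SS_filtration p F G v k (h + 1)"
      unfolding mem using C(1) by simp_all
    then show "SS_filtration p F G v k (h + 1) \<noteq> SS_filtration p F G v k h"
      by blast
  qed
  then show ?thesis
    unfolding SS_refined_breaks_def using b_pos c_pos by auto
qed

end

end

section \<open>From the hypotheses of the theorem to the locales\<close>

context type_subfield
begin

lemma galois_eq_if_eq_on_generators:
  assumes "g \<in> carrier (galois_group K)" "h \<in> carrier (galois_group K)"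
    and gen: "generate_field ring_of_type_algebra (K \<union> S) = UNIV" and eq: "\<And>x. x \<in> S \<Longrightarrow> g x = h x"
  shows "g = h"
proof
  fix y
  have fix_K: "g x = x" "h x = x" if "x \<in> K" for x
    using assms(1,2) that by (simp_all add: galois_group_iff)
  have "y \<in> generate_field ring_of_type_algebra (K \<union> S)"
    using gen by simp
  then show "g y = h y"
  proof (induction rule: generate_field.induct)
    case one
    then show ?case by (simp add: fix_K)
  next
    case (incl x)
    then show ?case using eq fix_K by auto
  next
    case (a_inv x)
    then show ?case
      using galois_diff[OF assms(1), of 0 x] galois_diff[OF assms(2), of 0 x] by (simp add: fix_K)
  next
    case (m_inv x)
    then have "x \<noteq> 0" by simp
    then show ?case
      using galois_divide[OF assms(1), of 1 x] galois_divide[OF assms(2), of 1 x] m_inv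
      by (simp add: fix_K m_inv_ring_of_type_algebra inverse_eq_divide)
  next
    case (eng_add x y)
    then show ?case
      using assms(1,2) by (simp add: galois_group_iff)
  next
    case (eng_mult x y)
    then show ?case
      using assms(1,2) by (simp add: galois_group_iff)
  qed
qed

end

lemma card_galois_group:
  assumes "galois_group K \<cong> integer_mod_group p \<times>\<times> integer_mod_group p" "p > 0"
  shows "card (carrier (galois_group K)) = p * p"
proof -
  obtain f where "f \<in> iso (galois_group K) (integer_mod_group p \<times>\<times> integer_mod_group p)"
    using assms(1) by (auto simp: is_iso_def)
  then have "bij_betw f (carrier (galois_group K)) (carrier (integer_mod_group p \<times>\<times> integer_mod_group p))"
    by (simp add: iso_def)
  then have "card (carrier (galois_group K)) = card (carrier (integer_mod_group p \<times>\<times> integer_mod_group p))"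
    by (rule bij_betw_same_card)
  then show ?thesis
    using assms(2) by (simp add: carrier_integer_mod_group card_cartesian_product)
qed

text \<open>The differences \<open>g x1 - x1\<close> and \<open>g x2 - x2\<close> are roots of
  \<open>X ^ p - X\<close>, hence in the prime field. The resulting map from the group to pairs
  below \<open>p\<close> is injective because \<open>x1\<close>, \<open>x2\<close> generate, and
  bijective by counting; \<open>\<sigma>1\<close>, \<open>\<sigma>2\<close> are the preimages of
  \<open>(1, 0)\<close> and \<open>(0, 1)\<close>.\<close>

lemma exists_bicyclic:
  fixes K F :: "'l::field set"
  assumes p: "Factorial_Ring.prime p" "CHAR('l) = p"
    and K: "subfield K ring_of_type_algebra" and F: "subfield F ring_of_type_algebra" "F \<subseteq> K"
    and fixed: "{x. \<forall>\<sigma>\<in>carrier (galois_group K). \<sigma> x = x} = K"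
    and card: "card (carrier (galois_group K)) = p * p"
    and x: "x1 ^ p - x1 \<in> K" "x2 ^ p - x2 \<in> K"
    and gen: "generate_field ring_of_type_algebra (K \<union> {x1, x2}) = UNIV"
  shows "\<exists>\<sigma>1 \<sigma>2. bicyclic p K F \<sigma>1 \<sigma>2 x1 x2"
proof -
  interpret prime_char p "TYPE('l)"
    using p by unfold_locales
  interpret K: type_subfield K
    by (rule type_subfield.intro[OF K])
  let ?G = "carrier (galois_group K)"
  have translate: "\<exists>i<p. g y = y + of_nat i" if g: "g \<in> ?G" and y: "y ^ p - y \<in> K" for g y
  proof -
    have "g y ^ p - g y = g (y ^ p - y)"
      by (simp add: K.galois_power[OF g] K.galois_diff[OF g])
    also have "\<dots> = y ^ p - y"
      using g y by (simp add: K.galois_group_iff)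
    finally have "(g y - y) ^ p = g y - y"
      unfolding freshman_diff by (simp add: algebra_simps)
    then obtain i where "i < p" "g y - y = of_nat i"
      by (rule artin_schreier_root)
    then show ?thesis
      by (intro exI[of _ i]) (simp add: algebra_simps)
  qed
  obtain i where i: "\<And>g. g \<in> ?G \<Longrightarrow> i g < p \<and> g x1 = x1 + of_nat (i g)"
    using translate[OF _ x(1)] by metis
  obtain j where j: "\<And>g. g \<in> ?G \<Longrightarrow> j g < p \<and> g x2 = x2 + of_nat (j g)"
    using translate[OF _ x(2)] by metis
  have eqI: "g = h" if "g \<in> ?G" "h \<in> ?G" "g x1 = h x1" "g x2 = h x2" for g h
    by (rule K.galois_eq_if_eq_on_generators[OF that(1,2) gen]) (use that in auto)
  have "inj_on (\<lambda>g. (i g, j g)) ?G"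
  proof (rule inj_onI)
    fix g h assume gh: "g \<in> ?G" "h \<in> ?G" "(i g, j g) = (i h, j h)"
    then show "g = h"
      using i[of g] i[of h] j[of g] j[of h] by (intro eqI) auto
  qed
  then have "card ((\<lambda>g. (i g, j g)) ` ?G) = card ({..<p} \<times> {..<p})"
    by (simp add: card_image card card_cartesian_product)
  moreover have "(\<lambda>g. (i g, j g)) ` ?G \<subseteq> {..<p} \<times> {..<p}"
    using i j by auto
  ultimately have surj: "(\<lambda>g. (i g, j g)) ` ?G = {..<p} \<times> {..<p}"
    by (intro card_subset_eq) auto
  have "(1, 0) \<in> (\<lambda>g. (i g, j g)) ` ?G" "(0, 1) \<in> (\<lambda>g. (i g, j g)) ` ?G"
    using p_gt_1 unfolding surj by auto
  then obtain \<sigma>1 \<sigma>2 where \<sigma>: "\<sigma>1 \<in> ?G" "i \<sigma>1 = 1" "j \<sigma>1 = 0" "\<sigma>2 \<in> ?G" "i \<sigma>2 = 0" "j \<sigma>2 = 1"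
    by auto
  have \<sigma>_x: "\<sigma>1 x1 = x1 + 1" "\<sigma>1 x2 = x2" "\<sigma>2 x1 = x1" "\<sigma>2 x2 = x2 + 1"
    using i[OF \<sigma>(1)] j[OF \<sigma>(1)] i[OF \<sigma>(4)] j[OF \<sigma>(4)] \<sigma> by simp_all
  have apply1: "\<sigma>1 (y + z) = \<sigma>1 y + \<sigma>1 z" "\<sigma>1 (of_nat n) = of_nat n" "\<sigma>1 1 = 1" for y z n
    using \<sigma>(1) K.of_nat_in K.one_in by (auto simp: K.galois_group_iff)
  have apply2: "\<sigma>2 (y + z) = \<sigma>2 y + \<sigma>2 z" "\<sigma>2 (of_nat n) = of_nat n" "\<sigma>2 1 = 1" for y z n
    using \<sigma>(4) K.of_nat_in K.one_in by (auto simp: K.galois_group_iff)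
  interpret G: group "galois_group K"
    by (rule K.group_galois_group)
  have comp_in: "g \<circ> h \<in> ?G" if "g \<in> ?G" "h \<in> ?G" for g h
    using G.m_closed[OF that] by simp
  have id_in: "id \<in> ?G"
    using G.one_closed by simp
  have pow_in: "g ^^ n \<in> ?G" if "g \<in> ?G" for g n
    by (induction n) (simp_all only: funpow.simps id_in comp_in that)
  have pow_x: "(\<sigma>1 ^^ n) x1 = x1 + of_nat n" "(\<sigma>1 ^^ n) x2 = x2" "(\<sigma>2 ^^ n) x1 = x1" "(\<sigma>2 ^^ n) x2 = x2 + of_nat n" for n
    by (induction n; simp add: \<sigma>_x apply1 apply2 add_ac)+
  have pow_nat: "(\<sigma>1 ^^ n) (y + of_nat m) = (\<sigma>1 ^^ n) y + of_nat m" for n m y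
    by (induction n) (simp_all add: apply1)
  have "\<sigma>1 \<circ> \<sigma>2 = \<sigma>2 \<circ> \<sigma>1"
    by (rule eqI[OF comp_in comp_in]) (simp_all add: \<sigma> \<sigma>_x apply1 apply2)
  then have commute: "\<sigma>1 (\<sigma>2 y) = \<sigma>2 (\<sigma>1 y)" for y
    by (metis comp_apply)
  have elements: "\<exists>m<p. \<exists>n<p. g = \<sigma>1 ^^ m \<circ> \<sigma>2 ^^ n" if g: "g \<in> ?G" for g
  proof -
    have "g = \<sigma>1 ^^ i g \<circ> \<sigma>2 ^^ j g"
      by (rule eqI[OF g comp_in[OF pow_in[OF \<sigma>(1)] pow_in[OF \<sigma>(4)]]])
        (use i[OF g] j[OF g] in \<open>simp_all add: pow_x pow_nat\<close>)
    then show ?thesis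
      using i[OF g] j[OF g] by blast
  qed
  have "bicyclic p K F \<sigma>1 \<sigma>2 x1 x2"
  proof (intro bicyclic.intro bicyclic_axioms.intro prime_char_axioms K.type_subfield_axioms
      type_subfield.intro F)
    show "x \<in> K" if "\<And>g. g \<in> ?G \<Longrightarrow> g x = x" for x
      using that fixed by blast
  qed (fact \<sigma> \<sigma>_x commute elements)+
  then show ?thesis by blast
qed

theorem corollary4p9:
  fixes p k :: nat
    and K F :: "'l::field set"
    and vK vL :: "'l \<Rightarrow> int extended"
    and b :: int
    and \<beta> \<omega>1 \<omega>2 \<epsilon>1 \<epsilon>2 :: 'l
  assumes "Factorial_Ring.prime p" and "CHAR('l) = p"
    and "local_field K vK"
    and "coefficient_field F K vK" and "perfect_of_char p F"
    and "finite_galois K"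
    and "normalized_valuation UNIV vL" and "totally_ramified K vK vL"
    and "galois_group K \<cong> integer_mod_group p \<times>\<times> integer_mod_group p"
    and "b > 0" and "ramification_breaks K vL = {b}"
    and "artin_schreier_data p F K vK b \<beta> (\<omega>1, \<omega>2) (\<epsilon>1, \<epsilon>2)"
    and "\<omega>1 = 1" and "\<epsilon>1 = 0"
    and "2 \<le> k" and "k \<le> p"
  shows "let e2 = - vK \<epsilon>2;
             bs = min (map_extended ((*) (int p)) (Fin b - e2) + Fin b) (Fin (b * int p));
             B1 = {Fin b, bs};
             G = galois_group K
         in VC_refined_breaks_defined p F G vL b k \<and>
            VC_refined_breaks p F G vL b k = B1 \<and>
            Fin ` SS_refined_breaks p F G vL k = B1"
proof -
  interpret prime_char p "TYPE('l)"
    using assms(1,2) by unfold_locales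
  have subK: "subfield K ring_of_type_algebra" and normK: "normalized_valuation K vK"
    using assms(3) by (simp_all add: local_field_def)
  have subF: "subfield F ring_of_type_algebra" and F_sub: "F \<subseteq> {x \<in> K. vK x \<ge> 0}"
    and res: "\<And>x. x \<in> K \<Longrightarrow> vK x \<ge> 0 \<Longrightarrow> \<exists>a. a \<in> F \<and> vK (x - a) > 0"
    using assms(4) by (auto simp: coefficient_field_def)
  have FK: "F \<subseteq> K"
    using F_sub by blast
  interpret K: type_subfield K
    by (rule type_subfield.intro[OF subK])
  interpret F: type_subfield F
    by (rule type_subfield.intro[OF subF])
  interpret valued vL
    using assms(7) by unfold_locales
  obtain x1 x2 where data: "\<beta> \<in> K" "vK \<beta> = Fin (- b)" "\<omega>2 \<in> F" "independent_over_prime_field 1 \<omega>2"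
    "\<epsilon>2 \<in> K" "reduced_error_term p F vK b \<epsilon>2" "x1 ^ p - x1 = \<beta>" "x2 ^ p - x2 = \<omega>2 ^ p\<^sup>2 * \<beta> + \<epsilon>2"
    "generate_field ring_of_type_algebra (K \<union> {x1, x2}) = UNIV"
    using assms(12) unfolding artin_schreier_data_def assms(13,14) by auto
  have finite_dim: "ring.finite_dimension ring_of_type_algebra K (UNIV :: 'l set)"
    and fixed: "{x. \<forall>\<sigma>\<in>carrier (galois_group K). \<sigma> x = x} = K"
    using assms(6) by (simp_all add: finite_galois_def)
  have "x1 ^ p - x1 \<in> K" "x2 ^ p - x2 \<in> K"
    using subsetD[OF FK data(3)] unfolding data(7,8)
    by (intro data K.add_in K.mult_in K.power_in; assumption)+
  then obtain \<sigma>1 \<sigma>2 where "bicyclic p K F \<sigma>1 \<sigma>2 x1 x2"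
    using exists_bicyclic[OF assms(1,2) subK subF FK fixed card_galois_group[OF assms(9) p_pos] _ _ data(9)] by blast
  then interpret bicyclic p K F \<sigma>1 \<sigma>2 x1 x2 .
  \<comment> \<open>The degree in \<open>totally_ramified\<close> has become \<open>p^2\<close> by
    \<open>dim_eq\<close>.\<close>
  have vLK: "vL x = map_extended ((*) ((int p)\<^sup>2)) (vK x)" if "x \<in> K" for x
    using assms(8) that by (simp add: totally_ramified_def dim_eq)
  have p2: "(int p)\<^sup>2 > 0"
    using p_pos by simp
  have vK_Fin: "\<exists>n. vK x = Fin n" if "x \<in> K" "x \<noteq> 0" for x
    using normK that unfolding normalized_valuation_def by (cases "vK x") auto
  have vL_Fin: "vL x = Fin ((int p)\<^sup>2 * n)" if "x \<in> K" "vK x = Fin n" for x n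
    using vLK[OF that(1)] that(2) by simp
  have vL_ge: "vL x \<ge> Fin ((int p)\<^sup>2 * n)" if "x \<in> K" "vK x \<ge> Fin n" for x n
    using vLK[OF that(1)] that(2) p2 by (cases "vK x") auto
  have vK_ge: "vK x \<ge> Fin n" if "x \<in> K" "vL x \<ge> Fin ((int p)\<^sup>2 * n)" for x n
    using vLK[OF that(1)] that(2) p2 by (cases "vK x") auto
  have F_ge: "vL c \<ge> Fin 0" if "c \<in> F" for c
    using vL_ge[of c 0] F_sub that by (auto simp: zero_extended_def)
  interpret ramified_bicyclic p K F \<sigma>1 \<sigma>2 x1 x2 vL
  proof unfold_locales
    show "0 < (int p)\<^sup>2"
      by (rule p2)
    show "\<exists>m. vL c = Fin ((int p)\<^sup>2 * m)" if "c \<in> K" "c \<noteq> 0" for c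
      using vK_Fin[OF that] vL_Fin[OF that(1)] by blast
    show "ring.finite_dimension ring_of_type_algebra K (UNIV :: 'l set)"
      by (rule finite_dim)
    show "vL c = Fin 0" if c: "c \<in> F" "c \<noteq> 0" for c
    proof -
      obtain n where n: "vL c = Fin n"
        using v_Fin[OF c(2)] by blast
      \<comment> \<open>The inverse lies in \<open>F\<close> too, and all elements of
        \<open>F\<close> are integral, so nonzero ones are units.\<close>
      have "vL (inverse c) \<ge> Fin 0"
        by (rule F_ge[OF F.inverse_in[OF c(1)]])
      then show ?thesis
        using F_ge[OF c(1)] n v_inverse[OF n] by simp
    qed
  qed
  have "ramification_group K vL b \<noteq> ramification_group K vL (b + 1)"
    using assms(11) unfolding ramification_breaks_def by blast
  moreover have "ramification_group K vL (b + 1) \<subseteq> ramification_group K vL b"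
  proof -
    have "vL y \<ge> Fin (b + 1)" if "vL y \<ge> Fin (b + 1 + 1)" for y
      using that by (rule v_mono) simp
    then show ?thesis
      unfolding ramification_group_def by blast
  qed
  ultimately obtain g where "g \<in> ramification_group K vL b" "g \<notin> ramification_group K vL (b + 1)"
    by blast
  then have not_dvd: "\<not> int p dvd b"
    by (rule break_not_dvd[OF assms(10)])
  interpret artin_schreier_tower p K F \<sigma>1 \<sigma>2 x1 x2 vL b \<beta> \<omega>2 \<epsilon>2
  proof unfold_locales
    show "vL \<beta> = Fin (- b * (int p)\<^sup>2)"
      using vL_Fin[OF data(1,2)] by (simp add: mult.commute)
    show "\<omega>2 ^ p \<noteq> \<omega>2"
    proof
      assume "\<omega>2 ^ p = \<omega>2"
      then obtain n where n: "\<omega>2 = of_nat n"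
        by (rule artin_schreier_root)
      have "of_int (- int n) * 1 + of_int 1 * \<omega>2 = (0::'l)"
        by (simp add: n)
      then have "of_int 1 = (0::'l)"
        using data(4) unfolding independent_over_prime_field_def by blast
      then show False by simp
    qed
    show "\<exists>a\<in>F. vL (y - a) \<ge> Fin 1" if y: "y \<in> K" "vL y \<ge> Fin 0" for y
    proof -
      obtain a where a: "a \<in> F" "vK (y - a) > 0"
        using res[OF y(1)] vK_ge[of y 0] y by (auto simp: zero_extended_def)
      then have "vK (y - a) \<ge> Fin 1"
        by (cases "vK (y - a)") (auto simp: zero_extended_def)
      then have "vL (y - a) \<ge> Fin ((int p)\<^sup>2 * 1)"
        using a(1) FK y(1) by (intro vL_ge K.diff_in) auto
      then have "vL (y - a) \<ge> Fin 1"
        by (rule v_mono) (use p2 in simp)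
      then show ?thesis
        using a(1) by blast
    qed
    show "\<exists>c\<in>F. c ^ p = a" if "a \<in> F" for a
      using assms(5) that by (simp add: perfect_of_char_def)
    show "\<exists>t\<in>K. vL t = Fin ((int p)\<^sup>2 * n)" for n
    proof -
      obtain t where "t \<in> K" "vK t = Fin n"
        using normK unfolding normalized_valuation_def by blast
      then show ?thesis
        using vL_Fin by blast
    qed
  qed (fact assms(10) not_dvd data)+
  define bs where "bs = min (map_extended ((*) (int p)) (Fin b - (- vK \<epsilon>2)) + Fin b) (Fin (b * int p))"
  \<comment> \<open>\<open>m\<close> is e2 if \<open>\<epsilon>2\<close> has a pole and
    \<open>0\<close> if \<open>\<epsilon>2 \<in> F\<close>. In the latter case e2 is
    \<open>0\<close> or \<open>Minf\<close>, and either value makes the minimum equal to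
    \<open>bp\<close>.\<close>
  obtain m c where m: "vL \<epsilon>2 \<ge> Fin (- ((int p)\<^sup>2 * int m))" "int m < b"
    "int p * int m > b \<Longrightarrow> vL \<epsilon>2 = Fin (- ((int p)\<^sup>2 * int m)) \<and> \<not> p dvd m"
    "c = min ((b - int m) * int p + b) (b * int p)" and bs: "bs = Fin c"
  proof (cases "\<exists>n. vK \<epsilon>2 = Fin n \<and> n < 0 \<and> \<not> int p dvd n")
    case True
    then obtain n where n: "vK \<epsilon>2 = Fin n" "n < 0" "\<not> int p dvd n"
      by blast
    have "n > - b"
      using data(6) n(1) by (simp add: reduced_error_term_def)
    define m where "m = nat (- n)"
    have mn: "int m = - n"
      using n(2) by (simp add: m_def)
    have "\<not> int p dvd int m"
      using n(3) by (simp add: mn)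
    then have "\<not> p dvd m"
      by simp
    moreover have "vL \<epsilon>2 = Fin (- ((int p)\<^sup>2 * int m))"
      using vL_Fin[OF data(5) n(1)] by (simp add: mn)
    moreover have "bs = Fin (min ((b - int m) * int p + b) (b * int p))"
      by (simp add: bs_def n(1) mn mult.commute)
    ultimately show ?thesis
      using that[of m] \<open>n > - b\<close> mn by simp
  next
    case False
    then have \<epsilon>F: "\<epsilon>2 \<in> F"
      using data(6) by (auto simp: reduced_error_term_def)
    have "vK \<epsilon>2 = Pinf \<or> vK \<epsilon>2 = Fin 0"
    proof (cases "\<epsilon>2 = 0")
      case True
      then show ?thesis
        using normK K.zero_in unfolding normalized_valuation_def by blast
    next
      case False
      obtain n where n: "vK \<epsilon>2 = Fin n"
        using vK_Fin[OF data(5) False] by blast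
      then have "(int p)\<^sup>2 * n = 0"
        using vL_Fin[OF data(5) n] v_F[OF \<epsilon>F False] by simp
      then show ?thesis
        using n p_pos by simp
    qed
    moreover have "min (b * int p + b) (b * int p) = b * int p"
      using assms(10) by simp
    ultimately have "bs = Fin (b * int p)"
      unfolding bs_def by (auto simp: mult.commute)
    then show ?thesis
      using that[of 0 "b * int p"] F_ge[OF \<epsilon>F] assms(10) by simp
  qed
  obtain Z \<delta> where Z: "vL Z = Fin (- b)" "\<sigma>2 Z = Z + 1" "\<sigma>1 Z = Z - \<omega>2 ^ p - \<delta>"
    "(vL \<delta> = Fin (c - b) \<and> c < b * int p) \<or> (vL \<delta> \<ge> Fin (c - b + 1) \<and> c = b * int p)"
    "c > b" "\<And>i. i < p \<Longrightarrow> c \<noteq> b * int i"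
    using exists_generator[OF m] by blast
  interpret scaffold p K F \<sigma>1 \<sigma>2 x1 x2 vL b c Z \<delta> "\<omega>2 ^ p"
    by unfold_locales (fact assms(10) not_dvd v_x1 Z F.power_in[OF data(3)])+
  show ?thesis
    using VC_refined_breaks_eq[OF assms(15,16)] SS_refined_breaks_eq[OF assms(15,16)] bs
    by (simp add: Let_def bs_def)
qed

end
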